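(* Let $X$ be a complex analytic supermanifold, let $v$ be an odd holomorphic vector field on $X$, and let $D_v\in\mathcal D_X$ be the corresponding differential operator. Then the series $e^{D_v}=\sum_{i=0}^\infty D_v^i/i!$ defines a section of $\mathcal D^\infty_X$, the sheaf of differential operators of infinite order on $X$.
   Context: For a supermanifold $X$ of dimension $n|m$, a section of $\mathcal D_X^\infty$ (a differential operator of infinite order $\mathcal O_X\to\mathcal O_X$) is given, in any local coordinate system $(z_1,\dots,z_n,\xi_1,\dots,\xi_m)$ ($z_i$ even, $\xi_j$ odd), by a series $\sum_{I,J,K}a_{IJK}(z)\,\xi^I\partial_\xi^J\partial_z^K$ with $a_{IJK}$ holomorphic, such that for each $I,J$ the overconvergence condition holds: the series $\sum_K k_1!\cdots k_n!\,a_{IJK}(z)\,p_1^{k_1}\cdots p_n^{k_n}$ represents an entire function of $(p_1,\dots,p_n)\in\mathbb C^n$ (holomorphic in $z$ as well). Such operators act on $\mathcal O_X$ by sheaf endomorphisms. Note that $e^{D_v}$ is the literal infinite series, without odd parameters multiplying $v$. *)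

theory Defs
  imports "HOL-Analysis.Analysis" "HOL-Algebra.Algebraic_Closure_Type"
begin

section \<open>Holomorphic functions of several variables\<close>

text \<open>
  The space \<open>\<complex>\<^sup>n\<close>, including \<open>n = 0\<close>, is rendered as in \<open>Euclidean_space\<close>: sequences that
  vanish from index \<open>n\<close> on, with the topology induced by the product topology.
\<close>

definition Cspace :: "nat \<Rightarrow> (nat \<Rightarrow> complex) set" where
  "Cspace n = {z. \<forall>i\<ge>n. z i = 0}"

abbreviation open_in_Cspace :: "nat \<Rightarrow> (nat \<Rightarrow> complex) set \<Rightarrow> bool" where
  "open_in_Cspace n V \<equiv> openin (top_of_set (Cspace n)) V"

text \<open>Continuous and holomorphic in each variable separately; used for open sets \<open>V\<close> only.\<close>

definition several_holomorphic_on ::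
  "nat \<Rightarrow> (nat \<Rightarrow> complex) set \<Rightarrow> ((nat \<Rightarrow> complex) \<Rightarrow> complex) \<Rightarrow> bool" where
  "several_holomorphic_on n V f \<longleftrightarrow>
     continuous_on V f \<and>
     (\<forall>z\<in>V. \<forall>i<n. (\<lambda>w. f (z(i := w))) field_differentiable at (z i))"

definition multi_indices :: "nat \<Rightarrow> (nat \<Rightarrow> nat) set" where
  "multi_indices n = {K. \<forall>i\<ge>n. K i = 0}"


section \<open>Superalgebras over the complex numbers\<close>

record 's superalg = "(complex, 's) module" +
  grade :: "nat \<Rightarrow> 's set"

text \<open>The grades are \<open>0\<close> (even) and \<open>1\<close> (odd); only these two values of \<open>grade\<close> matter.\<close>

locale superalgebra =
  M?: Module.module "ring_of_type_algebra :: complex ring" A + S?: ring A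
  for A :: "'s superalg" (structure) +
  assumes smult_mult_left: "\<lbrakk>x \<in> carrier A; y \<in> carrier A\<rbrakk> \<Longrightarrow> (c \<odot> x) \<otimes> y = c \<odot> (x \<otimes> y)"
    and smult_mult_right: "\<lbrakk>x \<in> carrier A; y \<in> carrier A\<rbrakk> \<Longrightarrow> x \<otimes> (c \<odot> y) = c \<odot> (x \<otimes> y)"
    and grade_submodule: "p < 2 \<Longrightarrow> submodule (grade A p) (ring_of_type_algebra :: complex ring) A"
    and grade_Int: "grade A 0 \<inter> grade A 1 = {\<zero>}"
    and grade_sum: "x \<in> carrier A \<Longrightarrow> \<exists>x0 \<in> grade A 0. \<exists>x1 \<in> grade A 1. x = x0 \<oplus> x1"
    and one_even: "\<one> \<in> grade A 0"
    and grade_mult: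
      "\<lbrakk>p < 2; q < 2; x \<in> grade A p; y \<in> grade A q\<rbrakk> \<Longrightarrow> x \<otimes> y \<in> grade A ((p + q) mod 2)"
    and supercommute:
      "\<lbrakk>p < 2; q < 2; x \<in> grade A p; y \<in> grade A q\<rbrakk> \<Longrightarrow> x \<otimes> y = (- 1) ^ (p * q) \<odot> (y \<otimes> x)"

definition superalg_hom :: "'s superalg \<Rightarrow> 't superalg \<Rightarrow> ('s \<Rightarrow> 't) set" where
  "superalg_hom A B =
     {h \<in> ring_hom A B.
        (\<forall>c. \<forall>x \<in> carrier A. h (c \<odot>\<^bsub>A\<^esub> x) = c \<odot>\<^bsub>B\<^esub> h x) \<and>
        (\<forall>p<2. h ` grade A p \<subseteq> grade B p)}"

definition superalg_iso :: "'s superalg \<Rightarrow> 't superalg \<Rightarrow> ('s \<Rightarrow> 't) set" where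
  "superalg_iso A B = {h \<in> superalg_hom A B. bij_betw h (carrier A) (carrier B)}"


section \<open>The model superdomains\<close>

text \<open>
  A superfunction \<open>F = \<Sum>\<^sub>I F\<^sub>I(z) \<xi>\<^sup>I\<close> is the family of its coefficients, where
  \<open>\<xi>\<^sup>I = \<xi>\<^bsub>i\<^sub>1\<^esub> \<dots> \<xi>\<^bsub>i\<^sub>r\<^esub>\<close> with \<open>i\<^sub>1 < \<dots> < i\<^sub>r\<close> the elements of \<open>I\<close>.
\<close>

type_synonym superfun = "nat set \<Rightarrow> (nat \<Rightarrow> complex) \<Rightarrow> complex"

text \<open>The sign in \<open>\<xi>\<^sup>J \<xi>\<^sup>K = \<plusminus> \<xi>\<^bsup>J \<union> K\<^esup>\<close> for disjoint \<open>J\<close> and \<open>K\<close>.\<close>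

definition shuffle_sign :: "nat set \<Rightarrow> nat set \<Rightarrow> complex" where
  "shuffle_sign J K = (- 1) ^ card {(j, k). j \<in> J \<and> k \<in> K \<and> k < j}"

definition superfun_mult :: "superfun \<Rightarrow> superfun \<Rightarrow> superfun" where
  "superfun_mult F G = (\<lambda>I z. \<Sum>J\<in>Pow I. shuffle_sign J (I - J) * F J z * G (I - J) z)"

definition superfun_monom :: "nat set \<Rightarrow> ((nat \<Rightarrow> complex) \<Rightarrow> complex) \<Rightarrow> superfun" where
  "superfun_monom I a = (\<lambda>L z. if L = I then a z else 0)"

definition superfun_restrict :: "(nat \<Rightarrow> complex) set \<Rightarrow> superfun \<Rightarrow> superfun" where
  "superfun_restrict V F = (\<lambda>I z. if z \<in> V then F I z else 0)"

definition superfuns :: "nat \<Rightarrow> nat \<Rightarrow> (nat \<Rightarrow> complex) set \<Rightarrow> superfun set" where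
  "superfuns n m V =
     {F. (\<forall>I. several_holomorphic_on n V (F I)) \<and>
         (\<forall>I z. \<not> (I \<subseteq> {..<m} \<and> z \<in> V) \<longrightarrow> F I z = 0)}"

text \<open>The superalgebra \<open>\<O>(V) \<otimes> \<Lambda>[\<xi>\<^sub>0, \<dots>, \<xi>\<^bsub>m-1\<^esub>]\<close> for \<open>V\<close> open in \<open>\<complex>\<^sup>n\<close>.\<close>

definition superdomain :: "nat \<Rightarrow> nat \<Rightarrow> (nat \<Rightarrow> complex) set \<Rightarrow> superfun superalg" where
  "superdomain n m V =
     \<lparr>carrier = superfuns n m V,
      mult = superfun_mult,
      one = superfun_restrict V (superfun_monom {} (\<lambda>_. 1)),
      zero = (\<lambda>_ _. 0),
      add = (\<lambda>F G I z. F I z + G I z),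
      smult = (\<lambda>c F I z. c * F I z),
      grade = (\<lambda>p. {F \<in> superfuns n m V. \<forall>I z. card I mod 2 \<noteq> p \<longrightarrow> F I z = 0})\<rparr>"


section \<open>Complex supermanifolds\<close>

record ('x, 's) superspace =
  body :: "'x topology"
  sect :: "'x set \<Rightarrow> 's superalg"
  restr :: "'x set \<Rightarrow> 'x set \<Rightarrow> 's \<Rightarrow> 's" \<comment> \<open>\<open>restr \<X> U W\<close> maps sections over \<open>U\<close> to sections over \<open>W\<close>\<close>

locale superalgebra_sheaf =
  fixes \<X> :: "('x, 's) superspace"
  assumes sect_superalgebra: "openin (body \<X>) U \<Longrightarrow> superalgebra (sect \<X> U)"
    and restr_hom:
      "\<lbrakk>openin (body \<X>) U; openin (body \<X>) W; W \<subseteq> U\<rbrakk>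
        \<Longrightarrow> restr \<X> U W \<in> superalg_hom (sect \<X> U) (sect \<X> W)"
    and restr_id:
      "\<lbrakk>openin (body \<X>) U; f \<in> carrier (sect \<X> U)\<rbrakk> \<Longrightarrow> restr \<X> U U f = f"
    and restr_restr:
      "\<lbrakk>openin (body \<X>) U; openin (body \<X>) V; openin (body \<X>) W; W \<subseteq> V; V \<subseteq> U;
        f \<in> carrier (sect \<X> U)\<rbrakk> \<Longrightarrow> restr \<X> V W (restr \<X> U V f) = restr \<X> U W f"
    and gluing:
      "\<lbrakk>\<And>U. U \<in> \<U> \<Longrightarrow> openin (body \<X>) U;
        \<And>U. U \<in> \<U> \<Longrightarrow> s U \<in> carrier (sect \<X> U);
        \<And>U W. \<lbrakk>U \<in> \<U>; W \<in> \<U>\<rbrakk> \<Longrightarrow> restr \<X> U (U \<inter> W) (s U) = restr \<X> W (U \<inter> W) (s W)\<rbrakk>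
        \<Longrightarrow> \<exists>!f. f \<in> carrier (sect \<X> (\<Union>\<U>)) \<and> (\<forall>U\<in>\<U>. restr \<X> (\<Union>\<U>) U f = s U)"

text \<open>
  A local coordinate system on \<open>U\<close>: an isomorphism \<open>(\<phi>, \<Phi>)\<close> of superspaces from \<open>U\<close> onto a
  superdomain.  The coordinate functions \<open>z\<^sub>i\<close>, \<open>\<xi>\<^sub>j\<close> on \<open>U\<close> are the preimages of the standard ones
  under \<open>\<Phi> U\<close>.  No locality condition on stalks is needed, as a ring isomorphism of local rings
  is local.
\<close>

definition super_chart ::
  "nat \<Rightarrow> nat \<Rightarrow> ('x, 's) superspace \<Rightarrow> 'x set \<Rightarrow> ('x \<Rightarrow> nat \<Rightarrow> complex)
    \<Rightarrow> ('x set \<Rightarrow> 's \<Rightarrow> superfun) \<Rightarrow> bool" where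
  "super_chart n m \<X> U \<phi> \<Phi> \<longleftrightarrow>
     openin (body \<X>) U \<and>
     open_in_Cspace n (\<phi> ` U) \<and>
     homeomorphic_map (subtopology (body \<X>) U) (top_of_set (\<phi> ` U)) \<phi> \<and>
     (\<forall>W. openin (body \<X>) W \<and> W \<subseteq> U \<longrightarrow>
        \<Phi> W \<in> superalg_iso (sect \<X> W) (superdomain n m (\<phi> ` W))) \<and>
     (\<forall>W W'. openin (body \<X>) W \<and> openin (body \<X>) W' \<and> W' \<subseteq> W \<and> W \<subseteq> U \<longrightarrow>
        (\<forall>f \<in> carrier (sect \<X> W). \<Phi> W' (restr \<X> W W' f) = superfun_restrict (\<phi> ` W') (\<Phi> W f)))"

locale complex_supermanifold = superalgebra_sheaf \<X>
  for n m :: nat and \<X> :: "('x, 's) superspace" +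
  assumes Hausdorff: "Hausdorff_space (body \<X>)"
    and second_countable: "second_countable (body \<X>)"
    and charts: "x \<in> topspace (body \<X>) \<Longrightarrow> \<exists>U \<phi> \<Phi>. x \<in> U \<and> super_chart n m \<X> U \<phi> \<Phi>"


section \<open>Vector fields and differential operators of infinite order\<close>

type_synonym ('x, 's) sheaf_operator = "'x set \<Rightarrow> 's \<Rightarrow> 's"

definition sheaf_endomorphism ::
  "('x, 's) superspace \<Rightarrow> ('x, 's) sheaf_operator \<Rightarrow> bool" where
  "sheaf_endomorphism \<X> P \<longleftrightarrow>
     (\<forall>U. openin (body \<X>) U \<longrightarrow>
        (\<forall>f \<in> carrier (sect \<X> U). P U f \<in> carrier (sect \<X> U)) \<and>
        (\<forall>f \<in> carrier (sect \<X> U). \<forall>g \<in> carrier (sect \<X> U).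
           P U (f \<oplus>\<^bsub>sect \<X> U\<^esub> g) = P U f \<oplus>\<^bsub>sect \<X> U\<^esub> P U g) \<and>
        (\<forall>c. \<forall>f \<in> carrier (sect \<X> U). P U (c \<odot>\<^bsub>sect \<X> U\<^esub> f) = c \<odot>\<^bsub>sect \<X> U\<^esub> P U f)) \<and>
     (\<forall>U W. openin (body \<X>) U \<and> openin (body \<X>) W \<and> W \<subseteq> U \<longrightarrow>
        (\<forall>f \<in> carrier (sect \<X> U). P W (restr \<X> U W f) = restr \<X> U W (P U f)))"

text \<open>
  A holomorphic vector field is a superderivation of the structure sheaf.  The operator \<open>D\<^sub>v\<close> is
  this derivation, regarded as an endomorphism of the sheaf.
\<close>

definition odd_vector_field ::
  "('x, 's) superspace \<Rightarrow> ('x, 's) sheaf_operator \<Rightarrow> bool" where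
  "odd_vector_field \<X> v \<longleftrightarrow>
     sheaf_endomorphism \<X> v \<and>
     (\<forall>U. openin (body \<X>) U \<longrightarrow>
        (\<forall>q<2. v U ` grade (sect \<X> U) q \<subseteq> grade (sect \<X> U) ((1 + q) mod 2)) \<and>
        (\<forall>q<2. \<forall>f \<in> grade (sect \<X> U) q. \<forall>g \<in> carrier (sect \<X> U).
           v U (f \<otimes>\<^bsub>sect \<X> U\<^esub> g) =
             (v U f \<otimes>\<^bsub>sect \<X> U\<^esub> g) \<oplus>\<^bsub>sect \<X> U\<^esub>
             ((- 1) ^ q \<odot>\<^bsub>sect \<X> U\<^esub> (f \<otimes>\<^bsub>sect \<X> U\<^esub> v U g))))"

definition even_partial :: "nat \<Rightarrow> superfun \<Rightarrow> superfun" where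
  "even_partial i F = (\<lambda>I z. deriv (\<lambda>w. F I (z(i := w))) (z i))"

text \<open>The left derivative: \<open>\<partial>\<^bsub>\<xi>\<^sub>j\<^esub> (\<xi>\<^sub>j \<xi>\<^sup>I) = \<xi>\<^sup>I\<close> for \<open>j \<notin> I\<close>.\<close>

definition odd_partial :: "nat \<Rightarrow> superfun \<Rightarrow> superfun" where
  "odd_partial j F =
     (\<lambda>I z. if j \<in> I then 0 else (- 1) ^ card {i \<in> I. i < j} * F (insert j I) z)"

text \<open>The operator \<open>a(z) \<xi>\<^sup>I \<partial>\<^sub>\<xi>\<^sup>J \<partial>\<^sub>z\<^sup>K\<close>.\<close>

definition diff_op_term ::
  "nat \<Rightarrow> ((nat \<Rightarrow> complex) \<Rightarrow> complex) \<Rightarrow> nat set \<Rightarrow> nat set \<Rightarrow> (nat \<Rightarrow> nat)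
    \<Rightarrow> superfun \<Rightarrow> superfun" where
  "diff_op_term n a I J K F =
     superfun_mult (superfun_monom I a)
       (foldr odd_partial (sorted_list_of_set J)
         (foldr (\<lambda>i. even_partial i ^^ K i) [0..<n] F))"

definition overconvergence_term ::
  "nat \<Rightarrow> ((nat \<Rightarrow> nat) \<Rightarrow> (nat \<Rightarrow> complex) \<Rightarrow> complex)
    \<Rightarrow> (nat \<Rightarrow> complex) \<Rightarrow> (nat \<Rightarrow> complex) \<Rightarrow> (nat \<Rightarrow> nat) \<Rightarrow> complex" where
  "overconvergence_term n a z p K = (\<Prod>i<n. fact (K i)) * a K z * (\<Prod>i<n. p i ^ K i)"

text \<open>
  The sum has to be holomorphic in \<open>(z, p) \<in> V \<times> \<complex>\<^sup>n\<close>.  Such a pair is encoded as the point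
  \<open>x = (z\<^sub>0, \<dots>, z\<^bsub>n-1\<^esub>, p\<^sub>0, \<dots>, p\<^bsub>n-1\<^esub>)\<close> of \<open>\<complex>\<^sup>2\<^sup>n\<close>.
\<close>

definition overconvergent ::
  "nat \<Rightarrow> (nat \<Rightarrow> complex) set \<Rightarrow> ((nat \<Rightarrow> nat) \<Rightarrow> (nat \<Rightarrow> complex) \<Rightarrow> complex) \<Rightarrow> bool" where
  "overconvergent n V a \<longleftrightarrow>
     (\<forall>z\<in>V. \<forall>p\<in>Cspace n. overconvergence_term n a z p summable_on multi_indices n) \<and>
     (let zpart = (\<lambda>x i. if i < n then x i else 0); ppart = (\<lambda>x i. if i < n then x (n + i) else 0)
      in several_holomorphic_on (2 * n) {x \<in> Cspace (2 * n). zpart x \<in> V}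
           (\<lambda>x. \<Sum>\<^sub>\<infinity>K\<in>multi_indices n. overconvergence_term n a (zpart x) (ppart x) K))"

text \<open>Global sections of \<open>\<D>\<^sup>\<infinity>\<close>, identified with the sheaf endomorphisms they induce.\<close>

definition infinite_order_operator ::
  "nat \<Rightarrow> nat \<Rightarrow> ('x, 's) superspace \<Rightarrow> ('x, 's) sheaf_operator \<Rightarrow> bool" where
  "infinite_order_operator n m \<X> P \<longleftrightarrow>
     sheaf_endomorphism \<X> P \<and>
     (\<forall>U \<phi> \<Phi>. super_chart n m \<X> U \<phi> \<Phi> \<longrightarrow>
        (\<exists>a :: nat set \<Rightarrow> nat set \<Rightarrow> (nat \<Rightarrow> nat) \<Rightarrow> (nat \<Rightarrow> complex) \<Rightarrow> complex.
           (\<forall>I J. I \<subseteq> {..<m} \<and> J \<subseteq> {..<m} \<longrightarrow>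
              (\<forall>K \<in> multi_indices n. several_holomorphic_on n (\<phi> ` U) (a I J K)) \<and>
              overconvergent n (\<phi> ` U) (a I J)) \<and>
           (\<forall>W. openin (body \<X>) W \<and> W \<subseteq> U \<longrightarrow>
              (\<forall>f \<in> carrier (sect \<X> W). \<forall>L \<subseteq> {..<m}. \<forall>z \<in> \<phi> ` W.
                 ((\<lambda>(I, J, K). diff_op_term n (a I J K) I J K (\<Phi> W f) L z)
                    has_sum \<Phi> W (P W f) L z)
                   (Pow {..<m} \<times> Pow {..<m} \<times> multi_indices n)))))"

text \<open>
  Convergence of a series of sections over an open set \<open>W\<close>: in every local coordinate system the
  coefficient functions of the partial sums converge uniformly on compact sets.
\<close>

definition section_sums ::
  "nat \<Rightarrow> nat \<Rightarrow> ('x, 's) superspace \<Rightarrow> 'x set \<Rightarrow> (nat \<Rightarrow> 's) \<Rightarrow> 's \<Rightarrow> bool" where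
  "section_sums n m \<X> W s t \<longleftrightarrow>
     (\<forall>U \<phi> \<Phi>. super_chart n m \<X> U \<phi> \<Phi> \<longrightarrow>
        (\<forall>L \<subseteq> {..<m}. \<forall>C. compact C \<and> C \<subseteq> \<phi> ` (U \<inter> W) \<longrightarrow>
           uniform_limit C
             (\<lambda>N z. \<Sum>k<N. \<Phi> (U \<inter> W) (restr \<X> W (U \<inter> W) (s k)) L z)
             (\<Phi> (U \<inter> W) (restr \<X> W (U \<inter> W) t) L) sequentially))"

definition operator_sums ::
  "nat \<Rightarrow> nat \<Rightarrow> ('x, 's) superspace \<Rightarrow> (nat \<Rightarrow> ('x, 's) sheaf_operator)
    \<Rightarrow> ('x, 's) sheaf_operator \<Rightarrow> bool" where
  "operator_sums n m \<X> Q P \<longleftrightarrow>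
     (\<forall>W. openin (body \<X>) W \<longrightarrow>
        (\<forall>f \<in> carrier (sect \<X> W). section_sums n m \<X> W (\<lambda>k. Q k W f) (P W f)))"

definition exp_term ::
  "('x, 's) superspace \<Rightarrow> ('x, 's) sheaf_operator \<Rightarrow> nat \<Rightarrow> ('x, 's) sheaf_operator" where
  "exp_term \<X> D k = (\<lambda>W f. (1 / fact k) \<odot>\<^bsub>sect \<X> W\<^esub> ((D W ^^ k) f))"

end

theory Submission
  imports Defs "HOL-Complex_Analysis.Cauchy_Integral_Formula"
begin

text \<open>
  Write \<open>D\<close> for the operator of the odd field.  Both \<open>D\<close> and the even operator \<open>D\<^sup>2\<close> are of
  first order, so by Hadamard's lemma each of them maps functions bounded by \<open>B\<close> on a polydisc
  of radius \<open>s\<close> to functions bounded by \<open>C B / (s - r)\<close> on the one of radius \<open>r < s\<close>.  Iterating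
  \<open>D\<^sup>2\<close> in \<open>k\<close> equal steps gives the factor \<open>(C k / (s - r))\<^sup>k\<close>, and as \<open>(2k)! \<ge> k\<^sup>k k!\<close> the
  exponential series converges for every \<open>r < s\<close>: its sum \<open>P\<close> is bounded between polydiscs of
  arbitrarily close radii.  Hence the value at \<open>z\<close> of \<open>P\<close> applied to \<open>(y - z)\<^sup>K \<xi>\<^sup>M\<close> is at most
  \<open>C\<^sub>\<epsilon> \<epsilon>\<^bsup>\<bar>K\<bar>\<^esup>\<close> for every \<open>\<epsilon> > 0\<close>, which is overconvergence of the coefficients, and
  Taylor expansion at \<open>z\<close> gives the symbol of \<open>P\<close>.  Transition maps between charts are continuous
  for locally uniform convergence, so the local sums agree on overlaps and can be glued.
\<close>

section \<open>Polydiscs and holomorphic functions of several variables\<close>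

text \<open>For a general field each application of \<open>D\<close> costs a derivative, so
  \<open>j\<close> of them give (C j / (s - r))^j / j!, roughly geometric in 1 / (s - r): no
  convergence between close radii, as translations show. For an odd field the cross terms of
  \<open>D (D (a F))\<close> cancel when \<open>a\<close> is even, so \<open>2 k\<close>
  applications cost only \<open>k\<close> derivatives.

  A chart is merely an algebraic isomorphism, and nothing in its definition makes a change of charts
  respect limits. Continuity is derived from the algebra: a homomorphism from germs at
  \<open>p\<close> to the exterior algebra sends each \<open>z i - p i\<close> to an element without
  body, hence nilpotent, and Hadamard's lemma then allows an induction on the number of odd
  generators.

  The symbol is found for any operator bounded between polydiscs of close radii. Coefficients are
  first taken with respect to the matrix units \<open>\<xi>\<^sup>M \<mapsto> \<xi>\<^sup>L\<close>,
  which test monomials read off directly; passing to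
  \<open>\<xi>\<^sup>I \<partial>\<^sub>\<xi>\<^sup>J\<close> is finite linear algebra.
  Overconvergence is therefore carried as an estimate that is closed under linear
  combinations.\<close>

definition polydisc :: "nat \<Rightarrow> (nat \<Rightarrow> complex) \<Rightarrow> real \<Rightarrow> (nat \<Rightarrow> complex) set" where
  "polydisc n p r = {z \<in> Cspace n. \<forall>i<n. dist (p i) (z i) < r}"

lemma fun_upd_in_Cspace: "z \<in> Cspace n \<Longrightarrow> i < n \<Longrightarrow> z(i := w) \<in> Cspace n"
  by (auto simp: Cspace_def)

lemma centre_in_polydisc: "p \<in> Cspace n \<Longrightarrow> 0 < r \<Longrightarrow> p \<in> polydisc n p r"
  by (simp add: polydisc_def)

lemma polydisc_mono: "r \<le> s \<Longrightarrow> polydisc n p r \<subseteq> polydisc n p s"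
  by (force simp: polydisc_def)

lemma polydisc_subset_polydisc:
  assumes "z \<in> polydisc n p r" shows "polydisc n z t \<subseteq> polydisc n p (r + t)"
proof
  fix y assume y: "y \<in> polydisc n z t"
  have "dist (p i) (y i) < r + t" if "i < n" for i
  proof -
    have "dist (p i) (z i) < r" "dist (z i) (y i) < t"
      using assms y that by (auto simp: polydisc_def)
    then show ?thesis using dist_triangle[of "p i" "y i" "z i"] by linarith
  qed
  then show "y \<in> polydisc n p (r + t)" using y by (auto simp: polydisc_def)
qed

text \<open>A slice in one variable is a disc about the coordinate of the centre, whichever point of
  the polydisc it passes through. One-variable results therefore apply with one radius for all
  points.\<close>

lemma fun_upd_in_polydisc_iff:
  "z \<in> polydisc n p r \<Longrightarrow> i < n \<Longrightarrow> z(i := w) \<in> polydisc n p r \<longleftrightarrow> w \<in> ball (p i) r"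
  by (auto simp: polydisc_def Cspace_def)

lemma open_polydisc: "open_in_Cspace n (polydisc n p r)"
proof -
  have "open (\<Inter>i\<in>{..<n}. {z :: nat \<Rightarrow> complex. dist (p i) (z i) < r})"
    by (intro open_INT ballI open_Collect_less continuous_intros) auto
  moreover have "polydisc n p r = Cspace n \<inter> (\<Inter>i\<in>{..<n}. {z. dist (p i) (z i) < r})"
    by (auto simp: polydisc_def)
  ultimately show ?thesis by (simp add: openin_open_Int)
qed

lemma polydisc_subset_open:
  assumes V: "open_in_Cspace n V" and p: "p \<in> V"
  obtains r where "r > 0" "polydisc n p r \<subseteq> V"
proof -
  obtain T where T: "open T" "V = Cspace n \<inter> T" using V openin_open by blast
  have "openin (product_topology (\<lambda>_. euclidean) UNIV) T" "p \<in> T"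
    using T p by (auto simp: open_fun_def)
  from product_topology_open_contains_basis[OF this]
  obtain Q where Q: "p \<in> PiE UNIV Q" "\<And>i. open (Q i)" "PiE UNIV Q \<subseteq> T" by auto
  have "\<forall>i. \<exists>e>0. ball (p i) e \<subseteq> Q i"
    using Q(1,2) by (metis UNIV_I PiE_E open_contains_ball)
  then obtain e where e: "\<And>i. e i > 0" "\<And>i. ball (p i) (e i) \<subseteq> Q i" by metis
  \<comment> \<open>The 1 keeps the minimum over a nonempty set when \<open>n = 0\<close>.
    Coordinates from \<open>n\<close> on impose nothing, being 0 on both sides.\<close>
  define r where "r = Min (insert 1 (e ` {..<n}))"
  have "r > 0" using e by (auto simp: r_def)
  moreover have "polydisc n p r \<subseteq> V"
  proof
    fix z assume z: "z \<in> polydisc n p r"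
    have "z i \<in> Q i" for i
    proof (cases "i < n")
      case True
      then have "r \<le> e i" by (auto simp: r_def intro!: Min_le)
      moreover have "dist (p i) (z i) < r" using z True by (auto simp: polydisc_def)
      ultimately show ?thesis using e(2)[of i] by auto
    next
      case False
      then have "z i = p i" using z p T by (auto simp: polydisc_def Cspace_def)
      then show ?thesis using Q(1) by auto
    qed
    then show "z \<in> V" using z Q(3) T by (auto simp: polydisc_def)
  qed
  ultimately show ?thesis using that by blast
qed

text \<open>Relatively open polydiscs form a neighbourhood basis of the product topology on
  \<open>Cspace n\<close>, because only finitely many coordinates can vary there.\<close>

lemma continuous_on_Cspace_iff:
  fixes f :: "(nat \<Rightarrow> complex) \<Rightarrow> 'b::metric_space"
  assumes V: "open_in_Cspace n V"
  shows "continuous_on V f \<longleftrightarrow> (\<forall>p\<in>V. \<forall>e>0. \<exists>r>0. \<forall>z\<in>polydisc n p r. dist (f z) (f p) < e)"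
proof -
  have sub: "V \<subseteq> Cspace n" using V openin_imp_subset by blast
  have "(\<forall>\<^sub>F z in at p within V. dist (f z) (f p) < e) \<longleftrightarrow>
      (\<exists>r>0. \<forall>z\<in>polydisc n p r. dist (f z) (f p) < e)" (is "?L \<longleftrightarrow> ?R") if p: "p \<in> V" "e > 0" for p e
  proof
    assume ?L
    then obtain S where S: "open S" "p \<in> S" "\<And>x. x \<in> S \<Longrightarrow> x \<noteq> p \<Longrightarrow> x \<in> V \<Longrightarrow> dist (f x) (f p) < e"
      unfolding eventually_at_topological by blast
    have "open_in_Cspace n (V \<inter> S)" using V S(1) openin_Int_open by blast
    then obtain r where r: "r > 0" "polydisc n p r \<subseteq> V \<inter> S"
      using polydisc_subset_open p S(2) by (metis IntI)
    then show ?R using S(3) p(2) by (intro exI[of _ r]) (metis IntE dist_self subsetD)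
  next
    assume ?R
    then obtain r where r: "r > 0" "\<And>z. z \<in> polydisc n p r \<Longrightarrow> dist (f z) (f p) < e" by blast
    obtain S where S: "open S" "polydisc n p r = Cspace n \<inter> S"
      using open_polydisc[of n p r] unfolding openin_open by blast
    have "p \<in> S" using S(2) centre_in_polydisc[of p n r] r(1) p sub by blast
    moreover have "dist (f z) (f p) < e" if "z \<in> S" "z \<in> V" for z using that S r(2) sub by auto
    ultimately show ?L unfolding eventually_at_topological using S(1) by auto
  qed
  then show ?thesis by (simp add: continuous_on tendsto_iff)
qed

text \<open>The definition differentiates at \<open>z i\<close> only. Letting the base point run
  along its slice gives holomorphy on the whole slice, which is open because \<open>V\<close>
  is.\<close>

lemma several_holomorphic_on_iff_slices:
  assumes V: "open_in_Cspace n V"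
  shows "several_holomorphic_on n V f \<longleftrightarrow> continuous_on V f \<and>
    (\<forall>z\<in>V. \<forall>i<n. (\<lambda>w. f (z(i := w))) holomorphic_on {w. z(i := w) \<in> V})"
proof -
  have op: "open {w. z(i := w) \<in> V}" if z: "z \<in> V" "i < n" for z i
  proof -
    obtain T where T: "open T" "V = Cspace n \<inter> T" using V openin_open by blast
    have "continuous_on UNIV (\<lambda>w. z(i := w))"
    proof (rule continuous_on_coordinatewise_then_product)
      show "continuous_on UNIV (\<lambda>w. (z(i := w)) j)" for j
        by (cases "j = i") auto
    qed
    then have "open ((\<lambda>w. z(i := w)) -` T)" using T open_vimage by blast
    moreover have "{w. z(i := w) \<in> V} = (\<lambda>w. z(i := w)) -` T"
      using T z fun_upd_in_Cspace by auto
    ultimately show ?thesis by simp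
  qed
  show ?thesis
  proof (intro iffI conjI ballI allI impI)
    assume f: "several_holomorphic_on n V f"
    then show "continuous_on V f" by (simp add: several_holomorphic_on_def)
    fix z i assume z: "z \<in> V" "i < n"
    have "(\<lambda>w'. f (z(i := w'))) field_differentiable at w" if "z(i := w) \<in> V" for w
    proof -
      have "(\<lambda>w'. f ((z(i := w))(i := w'))) field_differentiable at ((z(i := w)) i)"
        using f that z(2) unfolding several_holomorphic_on_def by blast
      then show ?thesis by simp
    qed
    then show "(\<lambda>w. f (z(i := w))) holomorphic_on {w. z(i := w) \<in> V}"
      by (auto simp: holomorphic_on_def intro: field_differentiable_at_within)
  next
    assume *: "continuous_on V f \<and>
      (\<forall>z\<in>V. \<forall>i<n. (\<lambda>w. f (z(i := w))) holomorphic_on {w. z(i := w) \<in> V})"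
    show "several_holomorphic_on n V f"
      unfolding several_holomorphic_on_def
    proof (intro conjI ballI allI impI)
      fix z i assume z: "z \<in> V" "i < n"
      then have "(\<lambda>w. f (z(i := w))) holomorphic_on {w. z(i := w) \<in> V}" using * by blast
      then show "(\<lambda>w. f (z(i := w))) field_differentiable at (z i)"
        using op[OF z] z by (intro holomorphic_on_imp_differentiable_at) auto
    qed (use * in auto)
  qed
qed

text \<open>The definition mentions values at points \<open>z(i := w)\<close> that may lie outside
  \<open>V\<close>. In the form with slices inside the open set \<open>V\<close> these values
  disappear, so agreement on \<open>V\<close> suffices.\<close>

lemma several_holomorphic_on_cong:
  assumes V: "open_in_Cspace n V" and "\<And>z. z \<in> V \<Longrightarrow> f z = g z"
  shows "several_holomorphic_on n V f \<longleftrightarrow> several_holomorphic_on n V g"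
proof -
  have "continuous_on V f \<longleftrightarrow> continuous_on V g" using assms(2) by (intro continuous_on_cong) auto
  moreover have "(\<lambda>w. f (z(i := w))) holomorphic_on {w. z(i := w) \<in> V} \<longleftrightarrow>
      (\<lambda>w. g (z(i := w))) holomorphic_on {w. z(i := w) \<in> V}" for z i
    using assms(2) by (intro holomorphic_cong) auto
  ultimately show ?thesis using several_holomorphic_on_iff_slices[OF V] by auto
qed

section \<open>Closure properties of holomorphic functions\<close>

lemma several_holomorphic_on_subset:
  "several_holomorphic_on n V f \<Longrightarrow> W \<subseteq> V \<Longrightarrow> several_holomorphic_on n W f"
  unfolding several_holomorphic_on_def using continuous_on_subset by blast

lemma several_holomorphic_on_const: "several_holomorphic_on n V (\<lambda>_. c)"
  by (simp add: several_holomorphic_on_def)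

lemma several_holomorphic_on_add:
  "several_holomorphic_on n V f \<Longrightarrow> several_holomorphic_on n V g \<Longrightarrow> several_holomorphic_on n V (\<lambda>z. f z + g z)"
  unfolding several_holomorphic_on_def by (auto intro!: continuous_intros derivative_intros field_differentiable_add)

lemma several_holomorphic_on_diff:
  "several_holomorphic_on n V f \<Longrightarrow> several_holomorphic_on n V g \<Longrightarrow> several_holomorphic_on n V (\<lambda>z. f z - g z)"
  unfolding several_holomorphic_on_def by (auto intro!: continuous_intros field_differentiable_diff)

lemma several_holomorphic_on_mult:
  "several_holomorphic_on n V f \<Longrightarrow> several_holomorphic_on n V g \<Longrightarrow> several_holomorphic_on n V (\<lambda>z. f z * g z)"
  unfolding several_holomorphic_on_def by (auto intro!: continuous_intros field_differentiable_mult)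

lemma several_holomorphic_on_divide:
  "several_holomorphic_on n V f \<Longrightarrow> several_holomorphic_on n V g \<Longrightarrow> (\<And>z. z \<in> V \<Longrightarrow> g z \<noteq> 0) \<Longrightarrow>
    several_holomorphic_on n V (\<lambda>z. f z / g z)"
  unfolding several_holomorphic_on_def by (auto intro!: continuous_intros field_differentiable_divide)

lemma several_holomorphic_on_sum:
  "(\<And>i. i \<in> A \<Longrightarrow> several_holomorphic_on n V (f i)) \<Longrightarrow> several_holomorphic_on n V (\<lambda>z. \<Sum>i\<in>A. f i z)"
  by (induction A rule: infinite_finite_induct)
    (auto intro: several_holomorphic_on_const several_holomorphic_on_add)

lemma several_holomorphic_on_prod:
  "(\<And>i. i \<in> A \<Longrightarrow> several_holomorphic_on n V (f i)) \<Longrightarrow> several_holomorphic_on n V (\<lambda>z. \<Prod>i\<in>A. f i z)"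
  by (induction A rule: infinite_finite_induct)
    (auto intro: several_holomorphic_on_const several_holomorphic_on_mult)

lemma several_holomorphic_on_power:
  "several_holomorphic_on n V f \<Longrightarrow> several_holomorphic_on n V (\<lambda>z. f z ^ k)"
  by (induction k) (auto intro: several_holomorphic_on_const several_holomorphic_on_mult)

lemma several_holomorphic_on_coordinate: "several_holomorphic_on n V (\<lambda>z. z i)"
proof -
  have "(\<lambda>w. (z(j := w)) i) field_differentiable at (z j)" for z :: "nat \<Rightarrow> complex" and j
    by (cases "i = j") auto
  then show ?thesis
    unfolding several_holomorphic_on_def
    by (auto intro: continuous_on_subset[OF continuous_on_product_coordinates])
qed

lemmas several_holomorphic_intros =
  several_holomorphic_on_const several_holomorphic_on_add several_holomorphic_on_diff
  several_holomorphic_on_mult several_holomorphic_on_sum several_holomorphic_on_prod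
  several_holomorphic_on_power several_holomorphic_on_coordinate

section \<open>Slices, local bounds, uniform limits and compact sets\<close>

lemma several_holomorphic_on_slice_polydisc:
  assumes "several_holomorphic_on n (polydisc n p r) f" "z \<in> polydisc n p r" "i < n"
  shows "(\<lambda>w. f (z(i := w))) holomorphic_on ball (p i) r"
proof -
  have "{w. z(i := w) \<in> polydisc n p r} = ball (p i) r"
    using fun_upd_in_polydisc_iff[OF assms(2,3)] by blast
  then show ?thesis
    using assms several_holomorphic_on_iff_slices[OF open_polydisc] by metis
qed

lemma several_holomorphic_on_locally_bounded:
  assumes "several_holomorphic_on n V f" "open_in_Cspace n V" "p \<in> V"
  obtains r B where "r > 0" "polydisc n p r \<subseteq> V" "B > 0" "\<And>z. z \<in> polydisc n p r \<Longrightarrow> cmod (f z) \<le> B"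
proof -
  obtain r1 where r1: "r1 > 0" "polydisc n p r1 \<subseteq> V" using polydisc_subset_open assms by blast
  have "continuous_on V f" using assms by (simp add: several_holomorphic_on_def)
  then obtain r2 where r2: "r2 > 0" "\<And>z. z \<in> polydisc n p r2 \<Longrightarrow> dist (f z) (f p) < 1"
    using continuous_on_Cspace_iff[OF assms(2)] assms(3) by (metis zero_less_one)
  have "cmod (f z) \<le> cmod (f p) + 1" if "z \<in> polydisc n p (min r1 r2)" for z
  proof -
    have "dist (f z) (f p) < 1" using r2 that polydisc_mono[of "min r1 r2" r2] by auto
    then show ?thesis using norm_triangle_ineq2[of "f z" "f p"] by (simp add: dist_norm)
  qed
  moreover have "polydisc n p (min r1 r2) \<subseteq> V" using r1 polydisc_mono[of "min r1 r2" r1] by auto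
  moreover have "min r1 r2 > 0" using r1 r2 by simp
  ultimately show ?thesis using that[of "min r1 r2" "cmod (f p) + 1"]
    by (simp add: add_nonneg_pos)
qed

text \<open>Weierstrass' theorem on limits. The approximating family may depend on the point and the
  filter is arbitrary, so that the same lemma serves power series, partial sums over finite sets of
  multi-indices, and, with constant families, gluing.\<close>

lemma several_holomorphic_on_uniform_limit:
  assumes V: "open_in_Cspace n V" and F: "F \<noteq> bot"
    and loc: "\<And>p. p \<in> V \<Longrightarrow> \<exists>r>0. polydisc n p r \<subseteq> V \<and>
      (\<exists>f. (\<forall>\<^sub>F k in F. several_holomorphic_on n (polydisc n p r) (f k)) \<and>
           uniform_limit (polydisc n p r) f g F)"
  shows "several_holomorphic_on n V g"
proof -
  have key: "(\<forall>e>0. \<exists>r>0. \<forall>z\<in>polydisc n p r. dist (g z) (g p) < e) \<and>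
      (\<forall>i<n. (\<lambda>w. g (p(i := w))) field_differentiable at (p i))" if p: "p \<in> V" for p
  proof -
    obtain r f where r: "r > 0" "polydisc n p r \<subseteq> V"
      and f: "\<forall>\<^sub>F k in F. several_holomorphic_on n (polydisc n p r) (f k)"
      and lim: "uniform_limit (polydisc n p r) f g F"
      using loc[OF p] by blast
    have pp: "p \<in> polydisc n p r" using r p openin_imp_subset[OF V] by (auto intro: centre_in_polydisc)
    have "continuous_on (polydisc n p r) g"
      by (rule uniform_limit_theorem[OF _ lim F])
        (use f in eventually_elim, auto simp: several_holomorphic_on_def)
    then have 1: "\<forall>e>0. \<exists>r>0. \<forall>z\<in>polydisc n p r. dist (g z) (g p) < e"
      using continuous_on_Cspace_iff[OF open_polydisc] pp by blast
    have 2: "(\<lambda>w. g (p(i := w))) field_differentiable at (p i)" if i: "i < n" for i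
    proof -
      \<comment> \<open>The one-variable limit theorem wants continuity up to the boundary, hence
        the closed disc of half the radius.\<close>
      have sub: "cball (p i) (r/2) \<subseteq> ball (p i) r" using r by auto
      have "uniform_limit (cball (p i) (r/2)) (\<lambda>k w. f k (p(i := w))) (\<lambda>w. g (p(i := w))) F"
        unfolding uniform_limit_iff
      proof (intro allI impI)
        fix e :: real assume "e > 0"
        with lim have "\<forall>\<^sub>F k in F. \<forall>z\<in>polydisc n p r. dist (f k z) (g z) < e"
          by (simp add: uniform_limit_iff)
        then show "\<forall>\<^sub>F k in F. \<forall>w\<in>cball (p i) (r/2). dist (f k (p(i := w))) (g (p(i := w))) < e"
          by eventually_elim (use sub fun_upd_in_polydisc_iff[OF pp i] in blast)
      qed
      moreover have "\<forall>\<^sub>F k in F. continuous_on (cball (p i) (r/2)) (\<lambda>w. f k (p(i := w))) \<and>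
          (\<lambda>w. f k (p(i := w))) holomorphic_on ball (p i) (r/2)"
        using f
      proof eventually_elim
        case (elim k)
        from several_holomorphic_on_slice_polydisc[OF elim pp i] show ?case
          using sub by (meson ball_subset_cball holomorphic_on_imp_continuous_on holomorphic_on_subset)
      qed
      ultimately have "(\<lambda>w. g (p(i := w))) holomorphic_on ball (p i) (r/2)"
        using F by (elim holomorphic_uniform_limit[rotated])
      then show ?thesis using r by (intro holomorphic_on_imp_differentiable_at[of _ "ball (p i) (r/2)"]) auto
    qed
    show ?thesis using 1 2 by blast
  qed
  then show ?thesis unfolding several_holomorphic_on_def continuous_on_Cspace_iff[OF V] by blast
qed

lemma several_holomorphic_on_local:
  assumes V: "open_in_Cspace n V"
    and loc: "\<And>p. p \<in> V \<Longrightarrow> \<exists>r>0. polydisc n p r \<subseteq> V \<and> several_holomorphic_on n (polydisc n p r) g"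
  shows "several_holomorphic_on n V g"
proof (rule several_holomorphic_on_uniform_limit[OF V sequentially_bot])
  fix p assume "p \<in> V"
  with loc obtain r where r: "r > 0" "polydisc n p r \<subseteq> V" "several_holomorphic_on n (polydisc n p r) g" by blast
  show "\<exists>r>0. polydisc n p r \<subseteq> V \<and> (\<exists>f. (\<forall>\<^sub>F k in sequentially. several_holomorphic_on n (polydisc n p r) (f k)) \<and>
           uniform_limit (polydisc n p r) f g sequentially)"
    using r by (intro exI[of _ r] conjI exI[of _ "\<lambda>_::nat. g"]) (auto simp: uniform_limit_iff)
qed

lemma uniform_limit_compact_Cspace:
  fixes f :: "'k \<Rightarrow> (nat \<Rightarrow> complex) \<Rightarrow> 'b::metric_space"
  assumes C: "compact C" "C \<subseteq> Cspace n"
    and loc: "\<And>p. p \<in> C \<Longrightarrow> \<exists>r>0. uniform_limit (polydisc n p r) f g F"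
  shows "uniform_limit C f g F"
proof -
  obtain r where r: "\<And>p. p \<in> C \<Longrightarrow> r p > 0" "\<And>p. p \<in> C \<Longrightarrow> uniform_limit (polydisc n p (r p)) f g F"
    using loc by metis
  have "\<forall>p. \<exists>S. open S \<and> polydisc n p (r p) = Cspace n \<inter> S" using open_polydisc unfolding openin_open by simp
  then obtain S where S: "\<And>p. open (S p)" "\<And>p. polydisc n p (r p) = Cspace n \<inter> S p" by metis
  have "p \<in> S p" if "p \<in> C" for p
    using centre_in_polydisc[of p n "r p"] S(2)[of p] r(1)[OF that] C(2) that by blast
  then have "C \<subseteq> (\<Union>p\<in>C. S p)" by blast
  from compactE_image[OF C(1) S(1) this]
  obtain C' where C': "C' \<subseteq> C" "finite C'" "C \<subseteq> (\<Union>p\<in>C'. S p)" .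
  have "uniform_limit (\<Union>p\<in>C'. polydisc n p (r p)) f g F"
    using C' r(2) by (intro uniform_limit_on_UNION) auto
  moreover have "C \<subseteq> (\<Union>p\<in>C'. polydisc n p (r p))" using C'(3) C(2) S(2) by blast
  ultimately show ?thesis by (rule uniform_limit_on_subset)
qed

section \<open>Partial derivatives\<close>

text \<open>The scalar version of \<open>even_partial\<close>; \<open>foldr_even_partial\<close>
  links the two.\<close>

definition cpartial :: "nat \<Rightarrow> ((nat \<Rightarrow> complex) \<Rightarrow> complex) \<Rightarrow> (nat \<Rightarrow> complex) \<Rightarrow> complex" where
  "cpartial i f = (\<lambda>z. deriv (\<lambda>w. f (z(i := w))) (z i))"

text \<open>All points \<open>z(i := w)\<close> share the same slice in direction \<open>i\<close>,
  so the iteration never leaves a single one-variable function.\<close>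

lemma funpow_cpartial: "(cpartial i ^^ k) f z = (deriv ^^ k) (\<lambda>w. f (z(i := w))) (z i)"
proof (induction k arbitrary: z)
  case (Suc k)
  have "(cpartial i ^^ Suc k) f z = deriv (\<lambda>w. (cpartial i ^^ k) f (z(i := w))) (z i)"
    by (simp add: cpartial_def)
  also have "(\<lambda>w. (cpartial i ^^ k) f (z(i := w))) = (deriv ^^ k) (\<lambda>w. f (z(i := w)))"
    by (intro ext) (simp only: Suc.IH fun_upd_upd fun_upd_same)
  also have "deriv ((deriv ^^ k) (\<lambda>w. f (z(i := w)))) (z i) = (deriv ^^ Suc k) (\<lambda>w. f (z(i := w))) (z i)"
    by (simp only: funpow.simps o_apply)
  finally show ?case .
qed simp

text \<open>Cauchy's inequality holds on every smaller closed disc, and \<open>s\<close> tends to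
  \<open>t\<close> from the left; so nothing is asked of \<open>f\<close> on the bounding
  circle.\<close>

lemma Cauchy_deriv_bound_ball:
  assumes f: "f holomorphic_on ball x t" "\<And>w. w \<in> ball x t \<Longrightarrow> cmod (f w) \<le> B" and t: "t > 0"
  shows "cmod ((deriv ^^ k) f x) \<le> fact k * B / t ^ k"
proof (rule tendsto_lowerbound[of "\<lambda>s. fact k * B / s ^ k" _ "at_left t"])
  show "((\<lambda>s. fact k * B / s ^ k) \<longlongrightarrow> fact k * B / t ^ k) (at_left t)"
    using t by (intro tendsto_intros) auto
  have "\<forall>\<^sub>F s in at_left t. s \<in> {0<..<t}" using eventually_at_left_real[OF t] .
  then show "\<forall>\<^sub>F s in at_left t. cmod ((deriv ^^ k) f x) \<le> fact k * B / s ^ k"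
  proof eventually_elim
    case (elim s)
    then have sub: "cball x s \<subseteq> ball x t" by auto
    show ?case
      by (rule Cauchy_inequality)
        (use f elim sub in \<open>auto simp: dist_norm norm_minus_commute intro: holomorphic_on_subset holomorphic_on_imp_continuous_on\<close>)
  qed
qed simp

text \<open>A Taylor remainder of second order. Around points within s/4 of \<open>a\<close> a disc
  of radius s/4 still fits into the domain, so the second derivative is at most 2 B / (s/4)^2 = 32 B
  / s^2.\<close>

lemma difference_quotient_bound:
  assumes g: "g holomorphic_on ball a s" "\<And>w. w \<in> ball a s \<Longrightarrow> cmod (g w) \<le> B"
    and h: "h \<noteq> 0" "cmod h \<le> s / 4"
  shows "cmod ((g (a + h) - g a) / h - deriv g a) \<le> cmod h * (32 * B / s\<^sup>2)"
proof -
  have s: "s > 0" using h by (metis norm_ge_zero norm_le_zero_iff not_le_imp_less order_trans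
      divide_nonpos_pos zero_less_numeral)
  let ?S = "cball a (s/4)"
  have sub: "?S \<subseteq> ball a s" using s by auto
  have "cmod ((\<lambda>i. (deriv ^^ i) g) 0 (a + h) - (\<Sum>i\<le>1. (deriv ^^ i) g a * ((a + h) - a) ^ i / fact i))
      \<le> (32 * B / s\<^sup>2) * cmod ((a + h) - a) ^ Suc 1 / fact 1"
  proof (rule complex_Taylor[of ?S])
    fix i x assume x: "x \<in> ?S"
    have "(deriv ^^ i) g holomorphic_on ball a s" using g by (intro holomorphic_higher_deriv) auto
    then show "((deriv ^^ i) g has_field_derivative (deriv ^^ Suc i) g x) (at x within ?S)"
      using x sub by (metis comp_apply funpow.simps(2) has_field_derivative_at_within holomorphic_derivI open_ball subsetD)
  next
    fix x assume x: "x \<in> ?S"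
    have sub': "ball x (s/4) \<subseteq> ball a s"
    proof
      fix y assume "y \<in> ball x (s/4)"
      then show "y \<in> ball a s" using x s dist_triangle[of a y x] by (auto simp: dist_commute)
    qed
    have "cmod ((deriv ^^ 2) g x) \<le> fact 2 * B / (s/4) ^ 2"
      using g s sub' by (intro Cauchy_deriv_bound_ball) (auto intro: holomorphic_on_subset)
    then show "cmod ((deriv ^^ Suc 1) g x) \<le> 32 * B / s\<^sup>2"
      by (simp add: numeral_2_eq_2[symmetric] power2_eq_square)
  qed (use h s in \<open>auto simp: dist_norm\<close>)
  then have le: "cmod (g (a + h) - g a - deriv g a * h) \<le> (32 * B / s\<^sup>2) * (cmod h)\<^sup>2"
    by (simp add: numeral_2_eq_2 algebra_simps)
  have "cmod ((g (a + h) - g a) / h - deriv g a) = cmod (g (a + h) - g a - deriv g a * h) / cmod h"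
    using h by (simp add: norm_divide[symmetric] divide_simps)
  also have "\<dots> \<le> (32 * B / s\<^sup>2) * (cmod h)\<^sup>2 / cmod h" using le by (intro divide_right_mono) auto
  also have "\<dots> = cmod h * (32 * B / s\<^sup>2)" using h by (simp add: power2_eq_square)
  finally show ?thesis .
qed

text \<open>Joint continuity of a partial derivative cannot be read off the slices. It comes from
  the difference quotients, which converge locally uniformly by
  \<open>difference_quotient_bound\<close>.\<close>

lemma several_holomorphic_on_cpartial:
  assumes V: "open_in_Cspace n V" and f: "several_holomorphic_on n V f" and i: "i < n"
  shows "several_holomorphic_on n V (cpartial i f)"
proof (rule several_holomorphic_on_uniform_limit[OF V sequentially_bot])
  fix p assume p: "p \<in> V"
  obtain r B where r: "r > 0" "polydisc n p r \<subseteq> V" "B > 0" "\<And>z. z \<in> polydisc n p r \<Longrightarrow> cmod (f z) \<le> B"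
    using several_holomorphic_on_locally_bounded[OF f V p] by metis
  define s where "s = r / 2"
  have s: "s > 0" "s + s = r" using r by (auto simp: s_def)
  \<comment> \<open>Nonzero steps tending to 0 and never above s/4: the bound for difference
    quotients applies, and shifted points stay in the polydisc of radius r = s + s.\<close>
  define h :: "nat \<Rightarrow> complex" where "h k = of_real (s / 4 / real (Suc k))" for k
  have cmod_h: "cmod (h k) = s / 4 / real (Suc k)" for k
    using s unfolding h_def norm_of_real by simp
  have h: "h k \<noteq> 0" "cmod (h k) \<le> s / 4" "cmod (h k) < s" for k
  proof -
    have "s / 4 / real (Suc k) \<le> s / 4 / 1" using s by (intro divide_left_mono) auto
    then show le: "cmod (h k) \<le> s / 4" by (simp add: cmod_h)
    show "cmod (h k) < s" using le s by linarith
    show "h k \<noteq> 0" using s cmod_h[of k] by auto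
  qed
  define q where "q k z = (f (z(i := z i + h k)) - f z) / h k" for k z
  let ?D = "polydisc n p s"
  have D: "?D \<subseteq> V" using polydisc_mono[of s r n p] s r by auto
  have shift: "z(i := z i + h k) \<in> V" if z: "z \<in> ?D" for z k
  proof -
    have "z(i := z i + h k) \<in> polydisc n z s"
      using z i h(3)[of k] s by (auto simp: polydisc_def Cspace_def dist_norm)
    then show ?thesis using polydisc_subset_polydisc[OF z, of s] s r by auto
  qed
  have "several_holomorphic_on n ?D (q k)" for k
  proof -
    have cont: "continuous_on ?D (\<lambda>z. f (z(i := z i + h k)))"
    proof (rule continuous_on_compose2[of V f])
      show "continuous_on V f" using f by (simp add: several_holomorphic_on_def)
      show "continuous_on ?D (\<lambda>z. z(i := z i + h k))"
      proof (rule continuous_on_coordinatewise_then_product)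
        show "continuous_on ?D (\<lambda>z. (z(i := z i + h k)) j)" for j
          by (cases "j = i") (auto intro!: continuous_intros continuous_on_subset[OF continuous_on_product_coordinates])
      qed
      show "(\<lambda>z. z(i := z i + h k)) ` ?D \<subseteq> V" using shift by blast
    qed
    have "several_holomorphic_on n ?D (\<lambda>z. f (z(i := z i + h k)))"
      unfolding several_holomorphic_on_def
    proof (intro conjI cont ballI allI impI)
      fix z j assume z: "z \<in> ?D" and j: "j < n"
      let ?y = "z(i := z i + h k)"
      have fd: "(\<lambda>w. f (?y(j := w))) field_differentiable at (?y j)"
        using f shift[OF z] j unfolding several_holomorphic_on_def by blast
      show "(\<lambda>w. f ((z(j := w))(i := (z(j := w)) i + h k))) field_differentiable at (z j)"
      proof (cases "j = i")
        case True
        have "(\<lambda>w. f (?y(i := w))) \<circ> (\<lambda>w. w + h k) field_differentiable at (z i)"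
          using fd True by (intro field_differentiable_compose field_differentiable_add) auto
        then show ?thesis using True by (simp add: o_def)
      next
        case False
        then show ?thesis using fd by (simp add: fun_upd_twist)
      qed
    qed
    then show ?thesis unfolding q_def
      using f D h(1) by (intro several_holomorphic_on_divide several_holomorphic_on_diff several_holomorphic_on_const)
        (auto intro: several_holomorphic_on_subset)
  qed
  moreover have "uniform_limit ?D q (cpartial i f) sequentially"
  proof (rule uniform_limitI)
    fix e :: real assume e: "e > 0"
    have "(\<lambda>k. (s / 4 * (32 * B / s\<^sup>2)) * inverse (real (Suc k))) \<longlonglongrightarrow> (s / 4 * (32 * B / s\<^sup>2)) * 0"
      by (intro tendsto_mult tendsto_const LIMSEQ_inverse_real_of_nat)
    then have "\<forall>\<^sub>F k in sequentially. (s / 4 * (32 * B / s\<^sup>2)) * inverse (real (Suc k)) < e"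
      unfolding mult_zero_right
      using e by (rule order_tendstoD(2))
    then show "\<forall>\<^sub>F k in sequentially. \<forall>z\<in>?D. dist (q k z) (cpartial i f z) < e"
    proof eventually_elim
      case (elim k)
      show ?case
      proof
        fix z assume z: "z \<in> ?D"
        have sub: "polydisc n z s \<subseteq> polydisc n p r" using polydisc_subset_polydisc[OF z, of s] s by simp
        have zz: "z \<in> polydisc n z s" using z s by (auto simp: polydisc_def)
        let ?g = "\<lambda>w. f (z(i := w))"
        have "cmod ((?g (z i + h k) - ?g (z i)) / h k - deriv ?g (z i)) \<le> cmod (h k) * (32 * B / s\<^sup>2)"
        proof (rule difference_quotient_bound)
          show "?g holomorphic_on ball (z i) s"
            using f sub r(2) zz i by (intro several_holomorphic_on_slice_polydisc) (auto intro: several_holomorphic_on_subset)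
          fix w assume "w \<in> ball (z i) s"
          then show "cmod (?g w) \<le> B" using fun_upd_in_polydisc_iff[OF zz i] sub r(4) by blast
        qed (use h in auto)
        moreover have "cmod (h k) * (32 * B / s\<^sup>2) < e"
          using elim unfolding cmod_h divide_inverse[of _ "real (Suc k)"] by (simp only: mult_ac)
        ultimately show "dist (q k z) (cpartial i f z) < e"
          by (simp add: dist_norm q_def cpartial_def)
      qed
    qed
  qed
  ultimately show "\<exists>r>0. polydisc n p r \<subseteq> V \<and> (\<exists>f'. (\<forall>\<^sub>F k in sequentially. several_holomorphic_on n (polydisc n p r) (f' k)) \<and>
           uniform_limit (polydisc n p r) f' (cpartial i f) sequentially)"
    using s D by (intro exI[of _ s] conjI exI[of _ q]) auto
qed

section \<open>Hadamard's lemma and Taylor expansion\<close>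

lemma override_on_in_polydisc:
  "z \<in> polydisc n p r \<Longrightarrow> p \<in> Cspace n \<Longrightarrow> r > 0 \<Longrightarrow> override_on z p A \<in> polydisc n p r"
  by (auto simp: polydisc_def Cspace_def override_on_def)

lemma override_on_fun_upd:
  "override_on (z(i := w)) p A = (if i \<in> A then override_on z p A else (override_on z p A)(i := w))"
  by (auto simp: override_on_def)

lemma several_holomorphic_on_override:
  assumes f: "several_holomorphic_on n (polydisc n p r) f" and p: "p \<in> Cspace n" "r > 0"
  shows "several_holomorphic_on n (polydisc n p r) (\<lambda>z. f (override_on z p A))"
  unfolding several_holomorphic_on_def
proof (intro conjI ballI allI impI)
  show "continuous_on (polydisc n p r) (\<lambda>z. f (override_on z p A))"
  proof (rule continuous_on_compose2[of "polydisc n p r" f])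
    show "continuous_on (polydisc n p r) f" using f by (simp add: several_holomorphic_on_def)
    show "continuous_on (polydisc n p r) (\<lambda>z. override_on z p A)"
    proof (rule continuous_on_coordinatewise_then_product)
      show "continuous_on (polydisc n p r) (\<lambda>z. override_on z p A i)" for i
        by (cases "i \<in> A") (auto intro: continuous_on_subset[OF continuous_on_product_coordinates])
    qed
  qed (use p override_on_in_polydisc in auto)
next
  fix z i assume z: "z \<in> polydisc n p r" and i: "i < n"
  have fd: "(\<lambda>w. f ((override_on z p A)(i := w))) field_differentiable at (override_on z p A i)"
    using f override_on_in_polydisc[OF z p] i unfolding several_holomorphic_on_def by blast
  show "(\<lambda>w. f (override_on (z(i := w)) p A)) field_differentiable at (z i)"
    using fd by (cases "i \<in> A") (simp_all add: override_on_fun_upd)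
qed

lemma several_holomorphic_on_funpow_cpartial:
  "open_in_Cspace n V \<Longrightarrow> several_holomorphic_on n V f \<Longrightarrow> i < n \<Longrightarrow> several_holomorphic_on n V ((cpartial i ^^ k) f)"
  by (induction k) (auto intro: several_holomorphic_on_cpartial)

text \<open>A removable singularity with parameters. Away from the hyperplane
  \<open>z i = p i\<close> the function is a quotient; near it, the power series in
  \<open>z i - p i\<close> with one factor removed converges uniformly and has holomorphic partial
  sums.\<close>

lemma several_holomorphic_on_divided_difference:
  assumes f: "several_holomorphic_on n (polydisc n p r) f" and p: "p \<in> Cspace n" "r > 0" and i: "i < n"
  shows "several_holomorphic_on n (polydisc n p r)
    (\<lambda>z. if z i = p i then cpartial i f z else (f z - f (z(i := p i))) / (z i - p i))"
    (is "several_holomorphic_on n ?D ?q")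
proof (rule several_holomorphic_on_local[OF open_polydisc])
  have upd: "override_on z p {i} = z(i := p i)" for z by (auto simp: override_on_def)
  have fi: "several_holomorphic_on n ?D (\<lambda>z. h (z(i := p i)))" if "several_holomorphic_on n ?D h" for h
    using several_holomorphic_on_override[OF that p, of "{i}"] by (simp add: upd)
  fix z0 assume z0: "z0 \<in> ?D"
  show "\<exists>r'>0. polydisc n z0 r' \<subseteq> ?D \<and> several_holomorphic_on n (polydisc n z0 r') ?q"
  proof (cases "z0 i = p i")
    case False
    have "open {z :: nat \<Rightarrow> complex. z i \<noteq> p i}"
      by (intro open_Collect_neq continuous_intros) auto
    then have "open_in_Cspace n (?D \<inter> {z. z i \<noteq> p i})" using open_polydisc openin_Int_open by blast
    then obtain t where t: "t > 0" "polydisc n z0 t \<subseteq> ?D \<inter> {z. z i \<noteq> p i}"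
      using polydisc_subset_open z0 False by (metis (mono_tags) IntI mem_Collect_eq)
    have "several_holomorphic_on n (?D \<inter> {z. z i \<noteq> p i}) (\<lambda>z. (f z - f (z(i := p i))) / (z i - p i))"
      using f fi[OF f] by (intro several_holomorphic_on_divide several_holomorphic_intros)
        (auto intro: several_holomorphic_on_subset)
    then have "several_holomorphic_on n (polydisc n z0 t) (\<lambda>z. (f z - f (z(i := p i))) / (z i - p i))"
      using t(2) by (rule several_holomorphic_on_subset)
    moreover have "several_holomorphic_on n (polydisc n z0 t) (\<lambda>z. (f z - f (z(i := p i))) / (z i - p i)) \<longleftrightarrow>
        several_holomorphic_on n (polydisc n z0 t) ?q"
      using t by (intro several_holomorphic_on_cong open_polydisc) auto
    ultimately show ?thesis using t by blast
  next
    case True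
    obtain s B where s: "s > 0" "polydisc n z0 s \<subseteq> ?D" "B > 0" "\<And>z. z \<in> polydisc n z0 s \<Longrightarrow> cmod (f z) \<le> B"
      using several_holomorphic_on_locally_bounded[OF f open_polydisc z0] by metis
    \<comment> \<open>Taylor coefficients in the variable \<open>z i\<close> at the hyperplane; they
      depend holomorphically on the other variables.\<close>
    define a where "a k z = (cpartial i ^^ k) f (z(i := p i)) / fact k" for k z
    \<comment> \<open>Half the radius makes the series geometric with ratio 1/2.\<close>
    let ?E = "polydisc n z0 (s/2)"
    have E: "?E \<subseteq> polydisc n z0 s" using polydisc_mono[of "s/2" s] s by auto
    have hol: "several_holomorphic_on n ?E (\<lambda>z. \<Sum>k<N. a (Suc k) z * (z i - p i) ^ k)" for N
    proof -
      have "several_holomorphic_on n ?D (a k)" for k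
        unfolding a_def using f i
        by (intro several_holomorphic_on_divide several_holomorphic_intros fi
            several_holomorphic_on_funpow_cpartial open_polydisc) auto
      then have "several_holomorphic_on n ?D (\<lambda>z. \<Sum>k<N. a (Suc k) z * (z i - p i) ^ k)"
        by (intro several_holomorphic_intros)
      then show ?thesis using E s(2) by (rule several_holomorphic_on_subset[OF _ order_trans])
    qed
    have sl: "(\<lambda>w. f (z(i := w))) holomorphic_on ball (p i) s"
      and bd: "\<And>w. w \<in> ball (p i) s \<Longrightarrow> cmod (f (z(i := w))) \<le> B"
      and zi: "dist (p i) (z i) < s / 2" if "z \<in> ?E" for z
    proof -
      have zz: "z \<in> polydisc n z0 s" using that E by auto
      show "(\<lambda>w. f (z(i := w))) holomorphic_on ball (p i) s"
        using several_holomorphic_on_slice_polydisc[OF several_holomorphic_on_subset[OF f s(2)] zz i] True by simp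
      show "cmod (f (z(i := w))) \<le> B" if "w \<in> ball (p i) s" for w
        using fun_upd_in_polydisc_iff[OF zz i] s(4) that True by metis
      show "dist (p i) (z i) < s / 2" using that i True by (auto simp: polydisc_def)
    qed
    have a: "a k z = (deriv ^^ k) (\<lambda>w. f (z(i := w))) (p i) / fact k" for k z
      by (simp add: a_def funpow_cpartial)
    have bound: "cmod (a (Suc k) z * (z i - p i) ^ k) \<le> B / s * (1 / 2) ^ k" if z: "z \<in> ?E" for k z
    proof -
      have "cmod ((deriv ^^ Suc k) (\<lambda>w. f (z(i := w))) (p i)) \<le> fact (Suc k) * B / s ^ Suc k"
        using sl[OF z] bd[OF z] s by (intro Cauchy_deriv_bound_ball) auto
      then have "cmod (a (Suc k) z) \<le> B / s ^ Suc k"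
        using s unfolding a norm_divide norm_fact
        by (simp add: pos_divide_le_eq mult.commute del: funpow.simps fact_Suc power_Suc)
      moreover have "cmod ((z i - p i) ^ k) \<le> (s / 2) ^ k"
        using zi[OF z] by (simp add: norm_power dist_norm norm_minus_commute power_mono)
      ultimately have "cmod (a (Suc k) z) * cmod ((z i - p i) ^ k) \<le> B / s ^ Suc k * (s / 2) ^ k"
        using s by (intro mult_mono) auto
      also have "\<dots> = B / s * (1 / 2) ^ k" using s by (simp add: power_divide)
      finally show ?thesis by (simp add: norm_mult)
    qed
    have sm: "(\<lambda>k. a (Suc k) z * (z i - p i) ^ k) sums ?q z" if z: "z \<in> ?E" for z
    proof (cases "z i = p i")
      case True
      then have "z(i := p i) = z" by auto
      then have "(\<lambda>k. a (Suc k) z * (z i - p i) ^ k) = (\<lambda>k. if k = 0 then cpartial i f z else 0)"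
        using True by (intro ext) (simp add: a_def)
      moreover have "\<dots> sums cpartial i f z" using sums_single[of 0 "\<lambda>_. cpartial i f z"] by simp
      ultimately show ?thesis using True by simp
    next
      case False
      have "(\<lambda>k. a k z * (z i - p i) ^ k) sums f (z(i := z i))"
        unfolding a using zi[OF z] s by (intro holomorphic_power_series[OF sl[OF z]]) auto
      then have "(\<lambda>k. a (Suc k) z * (z i - p i) ^ Suc k) sums (f z - a 0 z)"
        by (subst sums_Suc_iff) simp
      then have "(\<lambda>k. a (Suc k) z * (z i - p i) ^ Suc k / (z i - p i)) sums ((f z - a 0 z) / (z i - p i))"
        by (rule sums_divide)
      then show ?thesis using False by (simp add: a_def)
    qed
    have "uniform_limit ?E (\<lambda>N z. \<Sum>k<N. a (Suc k) z * (z i - p i) ^ k) (\<lambda>z. \<Sum>k. a (Suc k) z * (z i - p i) ^ k) sequentially"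
      by (rule Weierstrass_m_test[of _ _ "\<lambda>k. B / s * (1 / 2) ^ k"]) (use bound in \<open>auto intro: summable_mult\<close>)
    moreover have "uniform_limit ?E (\<lambda>N z. \<Sum>k<N. a (Suc k) z * (z i - p i) ^ k) (\<lambda>z. \<Sum>k. a (Suc k) z * (z i - p i) ^ k) sequentially
        \<longleftrightarrow> uniform_limit ?E (\<lambda>N z. \<Sum>k<N. a (Suc k) z * (z i - p i) ^ k) ?q sequentially"
      by (intro uniform_limit_cong) (use sm in \<open>auto simp: sums_iff\<close>)
    ultimately have lim: "uniform_limit ?E (\<lambda>N z. \<Sum>k<N. a (Suc k) z * (z i - p i) ^ k) ?q sequentially" by blast
    have "several_holomorphic_on n ?E ?q"
    proof (rule several_holomorphic_on_uniform_limit[OF open_polydisc sequentially_bot])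
      fix y assume "y \<in> ?E"
      then obtain t where t: "t > 0" "polydisc n y t \<subseteq> ?E" using polydisc_subset_open open_polydisc by metis
      show "\<exists>r>0. polydisc n y r \<subseteq> ?E \<and> (\<exists>f. (\<forall>\<^sub>F k in sequentially. several_holomorphic_on n (polydisc n y r) (f k)) \<and>
           uniform_limit (polydisc n y r) f ?q sequentially)"
        using t(1,2) several_holomorphic_on_subset[OF hol t(2)] uniform_limit_on_subset[OF lim t(2)]
        by (intro exI[of _ t] conjI exI[of _ "\<lambda>N z. \<Sum>k<N. a (Suc k) z * (z i - p i) ^ k"]) auto
    qed
    then show ?thesis using s E by (intro exI[of _ "s/2"]) auto
  qed
qed

text \<open>Freezing the coordinates at \<open>p\<close> one after another makes
  \<open>f z - f p\<close> telescope, and \<open>g i\<close> is the divided difference at stage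
  \<open>i\<close>. On half the polydisc, discs of radius s/2 give the derivative bound 2 B / s. As
  \<open>B\<close> is quantified after \<open>g\<close>, the bound is linear in any sup bound of
  \<open>f\<close>.\<close>

lemma hadamard:
  assumes f: "several_holomorphic_on n (polydisc n p s) f" and p: "p \<in> Cspace n" "s > 0"
  shows "\<exists>g. (\<forall>i<n. several_holomorphic_on n (polydisc n p s) (g i)) \<and>
    (\<forall>z\<in>polydisc n p s. f z = f p + (\<Sum>i<n. (z i - p i) * g i z)) \<and>
    (\<forall>i<n. \<forall>z\<in>polydisc n p (s/2). \<forall>B. (\<forall>y\<in>polydisc n p s. cmod (f y) \<le> B) \<longrightarrow> cmod (g i z) \<le> 2 * B / s)"
proof -
  let ?D = "polydisc n p s"
  define fi where "fi i z = f (override_on z p {..<i})" for i z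
  define g where "g i z = (if z i = p i then cpartial i (fi i) z else (fi i z - fi i (z(i := p i))) / (z i - p i))" for i z
  have fi: "several_holomorphic_on n ?D (fi i)" for i
    unfolding fi_def by (rule several_holomorphic_on_override[OF f p])
  have g: "several_holomorphic_on n ?D (g i)" if "i < n" for i
    unfolding g_def by (rule several_holomorphic_on_divided_difference[OF fi p that])
  have step: "(z i - p i) * g i z = fi i z - fi (Suc i) z" for i z
  proof -
    have e: "fi (Suc i) z = fi i (z(i := p i))"
      by (auto simp: fi_def override_on_def fun_eq_iff intro!: arg_cong[of _ _ f])
    show ?thesis
    proof (cases "z i = p i")
      case True
      then have "z(i := p i) = z" by auto
      then show ?thesis using True e by simp
    qed (simp add: g_def e)
  qed
  have eq: "f z = f p + (\<Sum>i<n. (z i - p i) * g i z)" if z: "z \<in> ?D" for z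
  proof -
    have "override_on z p {..<n} = p"
      using z p by (auto simp: override_on_def polydisc_def Cspace_def fun_eq_iff)
    then have "fi n z = f p" "fi 0 z = f z" by (auto simp: fi_def)
    moreover have "(\<Sum>i<n. fi i z - fi (Suc i) z) = fi 0 z - fi n z" by (rule sum_lessThan_telescope')
    ultimately show ?thesis by (simp add: step)
  qed
  have bound: "cmod (g i z) \<le> 2 * B / s"
    if i: "i < n" and z: "z \<in> polydisc n p (s/2)" and B: "\<And>y. y \<in> ?D \<Longrightarrow> cmod (f y) \<le> B" for i z B
  proof -
    have zD: "z \<in> ?D" using z polydisc_mono[of "s/2" s] p by auto
    let ?h = "\<lambda>w. fi i (z(i := w))"
    have h: "?h holomorphic_on ball (p i) s" by (rule several_holomorphic_on_slice_polydisc[OF fi zD i])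
    have hB: "cmod (?h w) \<le> B" if "w \<in> ball (p i) s" for w
    proof -
      have "z(i := w) \<in> ?D" using fun_upd_in_polydisc_iff[OF zD i] that by blast
      then show ?thesis unfolding fi_def by (intro B override_on_in_polydisc p)
    qed
    have d: "cmod (deriv ?h w) \<le> 2 * B / s" if w: "w \<in> ball (p i) (s/2)" for w
    proof -
      have sub: "ball w (s/2) \<subseteq> ball (p i) s"
      proof
        fix y assume "y \<in> ball w (s/2)"
        then show "y \<in> ball (p i) s" using w dist_triangle[of "p i" y w] by auto
      qed
      have "cmod ((deriv ^^ 1) ?h w) \<le> fact 1 * B / (s/2) ^ 1"
        using h hB sub p by (intro Cauchy_deriv_bound_ball) (auto intro: holomorphic_on_subset)
      then show ?thesis by (simp add: mult.commute)
    qed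
    have zi: "z i \<in> ball (p i) (s/2)" using z i by (auto simp: polydisc_def)
    show ?thesis
    proof (cases "z i = p i")
      case True
      then show ?thesis using d[OF zi] by (simp add: g_def cpartial_def)
    next
      case False
      have "cmod (?h (z i) - ?h (p i)) \<le> 2 * B / s * cmod (z i - p i)"
      proof (rule field_differentiable_bound[of "ball (p i) (s/2)" ?h "deriv ?h"])
        fix w assume "w \<in> ball (p i) (s/2)"
        then have "w \<in> ball (p i) s" using p by auto
        then show "(?h has_field_derivative deriv ?h w) (at w within ball (p i) (s/2))"
          using h by (meson has_field_derivative_at_within holomorphic_derivI open_ball)
      qed (use d zi p in auto)
      then show ?thesis using False using p by (simp add: g_def norm_divide divide_simps)
    qed
  qed
  show ?thesis using g eq bound by blast
qed

section \<open>Multi-indices and the Taylor expansion\<close>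

abbreviation multi_partial :: "nat list \<Rightarrow> (nat \<Rightarrow> nat) \<Rightarrow> ((nat \<Rightarrow> complex) \<Rightarrow> complex) \<Rightarrow> (nat \<Rightarrow> complex) \<Rightarrow> complex" where
  "multi_partial is K f \<equiv> foldr (\<lambda>i. cpartial i ^^ K i) is f"

text \<open>Supports in an arbitrary set of variables let sums over multi-indices be treated one
  variable at a time.\<close>

definition indices_on :: "nat set \<Rightarrow> (nat \<Rightarrow> nat) set" where
  "indices_on A = {K. \<forall>i. i \<notin> A \<longrightarrow> K i = 0}"

lemma multi_indices_eq: "multi_indices n = indices_on {..<n}"
  by (auto simp: multi_indices_def indices_on_def)

lemma bij_betw_indices_on_insert:
  assumes "i \<notin> A"
  shows "bij_betw (\<lambda>(K, k). K(i := k)) (indices_on A \<times> UNIV) (indices_on (insert i A))"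
proof (rule bij_betwI[where g = "\<lambda>K. (K(i := 0), K i)"])
qed (use assms in \<open>auto simp: indices_on_def fun_eq_iff split: if_splits\<close>)

lemma geometric_summable_on_indices:
  fixes \<rho> :: "nat \<Rightarrow> real"
  assumes "finite A" "\<And>i. i \<in> A \<Longrightarrow> 0 \<le> \<rho> i \<and> \<rho> i < 1"
  shows "(\<lambda>K. \<Prod>i\<in>A. \<rho> i ^ K i) summable_on indices_on A"
  using assms
proof (induction A)
  case empty
  have "indices_on {} = {\<lambda>_. 0}" by (auto simp: indices_on_def)
  then show ?case by simp
next
  case (insert i A)
  let ?f = "\<lambda>(K, k). (\<Prod>j\<in>A. \<rho> j ^ K j) * \<rho> i ^ k"
  have "?f summable_on (indices_on A \<times> UNIV)"
  proof (rule summable_on_SigmaI)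
    fix K :: "nat \<Rightarrow> nat"
    have "(\<lambda>k. \<rho> i ^ k) sums (1 / (1 - \<rho> i))" using insert.prems by (intro geometric_sums) auto
    then have "((\<lambda>k. \<rho> i ^ k) has_sum (1 / (1 - \<rho> i))) UNIV"
      using insert.prems by (intro sums_nonneg_imp_has_sum) auto
    from has_sum_cmult_right[OF this]
    show "((\<lambda>k. ?f (K, k)) has_sum (\<Prod>j\<in>A. \<rho> j ^ K j) * (1 / (1 - \<rho> i))) UNIV" by simp
  next
    show "(\<lambda>K. (\<Prod>j\<in>A. \<rho> j ^ K j) * (1 / (1 - \<rho> i))) summable_on indices_on A"
      using insert by (intro summable_on_cmult_left) auto
  next
    fix K k show "?f (K, k) \<ge> 0" using insert.prems by (auto intro!: mult_nonneg_nonneg prod_nonneg)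
  qed
  moreover have "?f x = (\<lambda>K. \<Prod>j\<in>insert i A. \<rho> j ^ K j) ((\<lambda>(K, k). K(i := k)) x)" for x
  proof (cases x)
    case (Pair K k)
    have "(\<Prod>j\<in>A. \<rho> j ^ (K(i := k)) j) = (\<Prod>j\<in>A. \<rho> j ^ K j)"
      using insert.hyps by (intro prod.cong) auto
    then show ?thesis using insert.hyps Pair by (simp add: mult.commute)
  qed
  ultimately have "(\<lambda>x. (\<lambda>K. \<Prod>j\<in>insert i A. \<rho> j ^ K j) ((\<lambda>(K, k). K(i := k)) x)) summable_on (indices_on A \<times> UNIV)"
    by (subst (asm) summable_on_cong)
  then show ?case
    by (subst (asm) summable_on_reindex_bij_betw[OF bij_betw_indices_on_insert[OF insert.hyps(2)]])
qed

lemma several_holomorphic_on_multi_partial: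
  "open_in_Cspace n V \<Longrightarrow> several_holomorphic_on n V f \<Longrightarrow> set is \<subseteq> {..<n} \<Longrightarrow>
    several_holomorphic_on n V (multi_partial is K f)"
  by (induction "is") (auto intro: several_holomorphic_on_funpow_cpartial)

lemma multi_partial_upt_Suc:
  assumes "l < n"
  shows "multi_partial [l..<n] K f w =
    (deriv ^^ K l) (\<lambda>w'. multi_partial [Suc l..<n] K f (w(l := w'))) (w l)"
  using funpow_cpartial[of "K l" l "multi_partial [Suc l..<n] K f" w] assms by (simp add: upt_conv_Cons)

text \<open>A Cauchy estimate with the full radius \<open>r\<close> needs a point that is central in
  the differentiated variable, hence \<open>w i = p i\<close> from \<open>l\<close> on. The earlier
  coordinates stay free because the following induction steps vary them.\<close>

lemma multi_partial_bound_aux: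
  assumes f: "several_holomorphic_on n (polydisc n p r) f" and p: "p \<in> Cspace n" "r > 0"
    and B: "\<And>z. z \<in> polydisc n p r \<Longrightarrow> cmod (f z) \<le> B"
    and "l \<le> n" "w \<in> polydisc n p r" "\<And>i. l \<le> i \<Longrightarrow> i < n \<Longrightarrow> w i = p i"
  shows "cmod (multi_partial [l..<n] K f w) \<le> B * (\<Prod>i\<in>{l..<n}. fact (K i) / r ^ K i)"
  using assms(5-)
proof (induction arbitrary: w rule: inc_induct)
  case base
  then show ?case using B by simp
next
  case (step l)
  let ?h = "multi_partial [Suc l..<n] K f"
  let ?C = "\<lambda>l. B * (\<Prod>i\<in>{l..<n}. fact (K i) / r ^ K i)"
  have h: "several_holomorphic_on n (polydisc n p r) ?h"
    by (intro several_holomorphic_on_multi_partial open_polydisc f) auto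
  have wl: "w l = p l" using step by simp
  have "cmod ((deriv ^^ K l) (\<lambda>w'. ?h (w(l := w'))) (p l)) \<le> fact (K l) * ?C (Suc l) / r ^ K l"
  proof (rule Cauchy_deriv_bound_ball)
    show "(\<lambda>w'. ?h (w(l := w'))) holomorphic_on ball (p l) r"
      by (rule several_holomorphic_on_slice_polydisc[OF h]) (use step in auto)
    fix w' assume "w' \<in> ball (p l) r"
    then have "w(l := w') \<in> polydisc n p r" using fun_upd_in_polydisc_iff step by metis
    then show "cmod (?h (w(l := w'))) \<le> ?C (Suc l)"
      by (rule step.IH) (use step.prems in auto)
  qed fact
  also have "fact (K l) * ?C (Suc l) / r ^ K l = ?C l"
    using step.hyps by (simp add: prod.atLeast_Suc_lessThan)
  finally show ?case using step.hyps wl by (simp add: multi_partial_upt_Suc)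
qed

lemma multi_partial_bound:
  assumes f: "several_holomorphic_on n (polydisc n p r) f" and p: "p \<in> Cspace n" "r > 0"
    and B: "\<And>z. z \<in> polydisc n p r \<Longrightarrow> cmod (f z) \<le> B"
  shows "cmod (multi_partial [0..<n] K f p) \<le> B * (\<Prod>i<n. fact (K i) / r ^ K i)"
  using multi_partial_bound_aux[OF f p B, of 0 p K] centre_in_polydisc[OF p] by (simp add: atLeast0LessThan)

text \<open>Downward induction on \<open>l\<close>: variables from \<open>l\<close> on are expanded,
  earlier ones keep their values in \<open>z\<close>. The Cauchy bound first makes the whole family
  absolutely summable, which permits splitting off the variable \<open>l\<close>.\<close>

lemma taylor_aux:
  assumes f: "several_holomorphic_on n (polydisc n p r) f" and p: "p \<in> Cspace n" "r > 0"
    and B: "\<And>z. z \<in> polydisc n p r \<Longrightarrow> cmod (f z) \<le> B"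
    and z: "z \<in> polydisc n p r" and l: "l \<le> n"
  shows "((\<lambda>K. multi_partial [l..<n] K f (override_on z p {l..<n}) * (\<Prod>i\<in>{l..<n}. (z i - p i) ^ K i / fact (K i)))
    has_sum f z) (indices_on {l..<n})"
  using l
proof (induction rule: inc_induct)
  case base
  have "indices_on {} = {\<lambda>_. 0}" by (auto simp: indices_on_def)
  then show ?case using has_sum_finite[of "{\<lambda>_. 0 :: nat}" "\<lambda>K. f z"] by simp
next
  case (step l)
  let ?t = "\<lambda>l K. multi_partial [l..<n] K f (override_on z p {l..<n}) * (\<Prod>i\<in>{l..<n}. (z i - p i) ^ K i / fact (K i))"
  define \<rho> where "\<rho> i = cmod (z i - p i) / r" for i
  have \<rho>: "0 \<le> \<rho> i \<and> \<rho> i < 1" if "i < n" for i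
    using z that p by (auto simp: \<rho>_def polydisc_def dist_norm norm_minus_commute)
  have tb: "cmod (?t l K) \<le> B * (\<Prod>i\<in>{l..<n}. \<rho> i ^ K i)" for K
  proof -
    have "cmod (multi_partial [l..<n] K f (override_on z p {l..<n})) \<le> B * (\<Prod>i\<in>{l..<n}. fact (K i) / r ^ K i)"
      using step z by (intro multi_partial_bound_aux[OF f p B] override_on_in_polydisc p) auto
    then have "cmod (?t l K) \<le> B * (\<Prod>i\<in>{l..<n}. fact (K i) / r ^ K i) * (\<Prod>i\<in>{l..<n}. cmod (z i - p i) ^ K i / fact (K i))"
      unfolding norm_mult prod_norm[symmetric] norm_divide norm_power norm_fact
      by (intro mult_right_mono prod_nonneg) auto
    also have "\<dots> = B * (\<Prod>i\<in>{l..<n}. \<rho> i ^ K i)"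
      unfolding mult.assoc prod.distrib[symmetric] \<rho>_def by (simp add: power_divide)
    finally show ?thesis .
  qed
  have "(\<lambda>K. B * (\<Prod>i\<in>{l..<n}. \<rho> i ^ K i)) summable_on indices_on {l..<n}"
    using \<rho> by (intro summable_on_cmult_right geometric_summable_on_indices) auto
  then have "(\<lambda>K. cmod (?t l K)) summable_on indices_on {l..<n}"
    by (rule Infinite_Sum.abs_summable_on_comparison_test') (rule tb)
  then have "?t l summable_on indices_on {l..<n}"
    by (rule Infinite_Sum.abs_summable_summable)
  moreover have ins: "insert l {Suc l..<n} = {l..<n}" using step.hyps by auto
  ultimately have sm: "(\<lambda>(K, k). ?t l (K(l := k))) summable_on (indices_on {Suc l..<n} \<times> UNIV)"
    using summable_on_reindex_bij_betw[OF bij_betw_indices_on_insert[of l "{Suc l..<n}"], of "?t l"]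
    by (simp add: case_prod_unfold)
  have "((\<lambda>(K, k). ?t l (K(l := k))) has_sum f z) (indices_on {Suc l..<n} \<times> UNIV)"
  proof (rule has_sum_SigmaI[OF _ step.IH sm])
    fix K assume K: "K \<in> indices_on {Suc l..<n}"
    \<comment> \<open>Unordered convergence is inherited from the double sum; the value
      \<open>S\<close> is then identified with the ordinary power series in the variable
      \<open>l\<close>.\<close>
    have "(\<lambda>k. ?t l (K(l := k))) summable_on UNIV"
      using summable_on_SigmaD1[OF sm K] .
    then obtain S where S: "((\<lambda>k. ?t l (K(l := k))) has_sum S) UNIV" by (auto simp: summable_on_def)
    define c where "c = (\<Prod>i\<in>{Suc l..<n}. (z i - p i) ^ K i / fact (K i))"
    define y where "y = override_on z p {Suc l..<n}"
    let ?h = "multi_partial [Suc l..<n] K f"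
    have "multi_partial [Suc l..<n] (K(l := k)) f = ?h" for k
      by (rule foldr_cong) auto
    moreover have "override_on z p {l..<n} = y(l := p l)"
      using step.hyps by (auto simp: y_def override_on_def fun_eq_iff)
    ultimately have t: "?t l (K(l := k)) = c * ((deriv ^^ k) (\<lambda>w. ?h (y(l := w))) (p l) / fact k * (z l - p l) ^ k)" for k
      using step.hyps by (simp add: multi_partial_upt_Suc prod.atLeast_Suc_lessThan c_def)
    have yD: "y \<in> polydisc n p r" unfolding y_def by (intro override_on_in_polydisc z p)
    have "several_holomorphic_on n (polydisc n p r) ?h"
      by (intro several_holomorphic_on_multi_partial open_polydisc f) auto
    then have "(\<lambda>w. ?h (y(l := w))) holomorphic_on ball (p l) r"
      using yD step.hyps by (intro several_holomorphic_on_slice_polydisc)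
    moreover have "z l \<in> ball (p l) r" using z step.hyps by (auto simp: polydisc_def)
    ultimately have "(\<lambda>k. (deriv ^^ k) (\<lambda>w. ?h (y(l := w))) (p l) / fact k * (z l - p l) ^ k) sums ?h (y(l := z l))"
      by (rule holomorphic_power_series)
    moreover have "y(l := z l) = y" by (auto simp: y_def override_on_def)
    ultimately have "(\<lambda>k. ?t l (K(l := k))) sums (c * ?h y)"
      unfolding t by (intro sums_mult) simp
    moreover have "(\<lambda>k. ?t l (K(l := k))) sums S" using S by (rule has_sum_imp_sums)
    ultimately have "S = ?t (Suc l) K" using sums_unique2 by (auto simp: c_def y_def mult.commute)
    then show "((\<lambda>k. case (K, k) of (K, k) \<Rightarrow> ?t l (K(l := k))) has_sum ?t (Suc l) K) UNIV" using S by simp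
  qed
  then show ?case
    using has_sum_reindex_bij_betw[OF bij_betw_indices_on_insert[of l "{Suc l..<n}"], of "?t l"] ins
    by (simp add: case_prod_unfold)
qed

lemma taylor:
  assumes f: "several_holomorphic_on n (polydisc n p r) f" and p: "p \<in> Cspace n" "r > 0"
    and B: "\<And>z. z \<in> polydisc n p r \<Longrightarrow> cmod (f z) \<le> B"
    and z: "z \<in> polydisc n p r"
  shows "((\<lambda>K. multi_partial [0..<n] K f p * (\<Prod>i<n. (z i - p i) ^ K i / fact (K i))) has_sum f z) (multi_indices n)"
proof -
  have "override_on z p {0..<n} = p"
    using z p by (auto simp: override_on_def polydisc_def Cspace_def fun_eq_iff)
  then show ?thesis
    using taylor_aux[OF f p B z, of 0] by (simp add: multi_indices_eq atLeast0LessThan)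
qed

section \<open>Operators on superdomains\<close>

text \<open>The section \<open>a \<xi>\<^sup>M\<close> over \<open>W\<close>, with the value 0
  elsewhere that \<open>superfuns\<close> demands.\<close>

abbreviation smono :: "(nat \<Rightarrow> complex) set \<Rightarrow> nat set \<Rightarrow> ((nat \<Rightarrow> complex) \<Rightarrow> complex) \<Rightarrow> superfun" where
  "smono W M a \<equiv> superfun_restrict W (superfun_monom M a)"

lemma smono_apply: "smono W M a L z = (if z \<in> W \<and> L = M then a z else 0)"
  by (simp add: superfun_restrict_def superfun_monom_def)

lemma superfunsD:
  assumes "F \<in> superfuns n m W"
  shows "several_holomorphic_on n W (F I)" "\<not> I \<subseteq> {..<m} \<Longrightarrow> F I z = 0" "z \<notin> W \<Longrightarrow> F I z = 0"
  using assms by (auto simp: superfuns_def)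

lemma superfun_eq_0: "F \<in> superfuns n m W \<Longrightarrow> \<not> (L \<subseteq> {..<m} \<and> z \<in> W) \<Longrightarrow> F L z = 0"
  by (auto simp: superfuns_def)

lemma superfuns_eqI:
  assumes "F \<in> superfuns n m W" "G \<in> superfuns n m W"
    "\<And>L z. L \<subseteq> {..<m} \<Longrightarrow> z \<in> W \<Longrightarrow> F L z = G L z"
  shows "F = G"
  using assms superfunsD by (metis ext)

lemma smono_in_superfuns:
  assumes "open_in_Cspace n W" "several_holomorphic_on n W a" "M \<subseteq> {..<m}"
  shows "smono W M a \<in> superfuns n m W"
proof -
  have "several_holomorphic_on n W (smono W M a I)" for I
  proof -
    have "several_holomorphic_on n W (if I = M then a else (\<lambda>_. 0))"
      using assms by (auto intro: several_holomorphic_on_const)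
    moreover have "several_holomorphic_on n W (smono W M a I) \<longleftrightarrow>
        several_holomorphic_on n W (if I = M then a else (\<lambda>_. 0))"
      by (rule several_holomorphic_on_cong[OF assms(1)]) (auto simp: smono_apply)
    ultimately show ?thesis by blast
  qed
  then show ?thesis using assms by (auto simp: superfuns_def smono_apply)
qed

lemma superfuns_add: "F \<in> superfuns n m W \<Longrightarrow> G \<in> superfuns n m W \<Longrightarrow> (\<lambda>I z. F I z + G I z) \<in> superfuns n m W"
  by (auto simp: superfuns_def intro: several_holomorphic_on_add)

lemma superfuns_scale:
  "F \<in> superfuns n m W \<Longrightarrow> several_holomorphic_on n W a \<Longrightarrow> (\<lambda>I z. a z * F I z) \<in> superfuns n m W"
  by (auto simp: superfuns_def intro: several_holomorphic_on_mult)

lemma superfuns_smult: "F \<in> superfuns n m W \<Longrightarrow> (\<lambda>I z. c * F I z) \<in> superfuns n m W"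
  by (rule superfuns_scale) (auto intro: several_holomorphic_on_const)

lemma superfuns_zero: "(\<lambda>_ _. 0) \<in> superfuns n m W"
  by (auto simp: superfuns_def intro: several_holomorphic_on_const)

lemma superfuns_sum:
  "(\<And>k. k \<in> S \<Longrightarrow> G k \<in> superfuns n m W) \<Longrightarrow> (\<lambda>I z. \<Sum>k\<in>S. G k I z) \<in> superfuns n m W"
  by (induction S rule: infinite_finite_induct) (auto intro: superfuns_add superfuns_zero)

lemma superfuns_restrict:
  assumes "F \<in> superfuns n m W" "W' \<subseteq> W" "open_in_Cspace n W'"
  shows "superfun_restrict W' F \<in> superfuns n m W'"
proof -
  have "several_holomorphic_on n W' (superfun_restrict W' F I)" for I
  proof -
    have "several_holomorphic_on n W' (F I)"
      using superfunsD(1)[OF assms(1)] assms(2) by (rule several_holomorphic_on_subset)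
    moreover have "several_holomorphic_on n W' (superfun_restrict W' F I) \<longleftrightarrow> several_holomorphic_on n W' (F I)"
      by (rule several_holomorphic_on_cong[OF assms(3)]) (auto simp: superfun_restrict_def)
    ultimately show ?thesis by blast
  qed
  then show ?thesis using assms(1) by (auto simp: superfuns_def superfun_restrict_def)
qed

lemma finite_odd_index: "L \<subseteq> {..<m} \<Longrightarrow> finite (L :: nat set)"
  by (rule finite_subset) auto

lemma superfuns_mult:
  assumes "F \<in> superfuns n m W" "G \<in> superfuns n m W"
  shows "superfun_mult F G \<in> superfuns n m W"
proof -
  have "superfun_mult F G I z = 0" if "\<not> (I \<subseteq> {..<m} \<and> z \<in> W)" for I z
  proof (cases "finite I")
    case True
    have "shuffle_sign J (I - J) * F J z * G (I - J) z = 0" if "J \<in> Pow I" for J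
    proof (cases "z \<in> W")
      case True
      then have "\<not> J \<subseteq> {..<m} \<or> \<not> (I - J) \<subseteq> {..<m}"
        using \<open>\<not> (I \<subseteq> {..<m} \<and> z \<in> W)\<close> that by blast
      then show ?thesis
        using superfunsD(2)[OF assms(1), of J z] superfunsD(2)[OF assms(2), of "I - J" z] by auto
    qed (use superfunsD(3)[OF assms(1)] in auto)
    then show ?thesis unfolding superfun_mult_def by (rule sum.neutral[OF ballI])
  qed (simp add: superfun_mult_def)
  moreover have "several_holomorphic_on n W (superfun_mult F G I)" for I
    unfolding superfun_mult_def using superfunsD(1)[OF assms(1)] superfunsD(1)[OF assms(2)]
    by (intro several_holomorphic_intros)
  ultimately show ?thesis by (simp add: superfuns_def)
qed

lemma shuffle_sign_empty [simp]: "shuffle_sign {} J = 1" "shuffle_sign J {} = 1"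
  by (simp_all add: shuffle_sign_def)

lemma norm_shuffle_sign [simp]: "norm (shuffle_sign J K) = 1"
  by (simp add: shuffle_sign_def norm_power)

lemma superfun_mult_smono_left:
  assumes "finite L"
  shows "superfun_mult (smono W M a) G L z =
    (if z \<in> W \<and> M \<subseteq> L then shuffle_sign M (L - M) * a z * G (L - M) z else 0)"
proof -
  have "superfun_mult (smono W M a) G L z =
      (\<Sum>J\<in>Pow L. if J = M then (if z \<in> W then shuffle_sign M (L - M) * a z * G (L - M) z else 0) else 0)"
    unfolding superfun_mult_def by (intro sum.cong) (auto simp: smono_apply)
  also have "\<dots> = (if z \<in> W \<and> M \<subseteq> L then shuffle_sign M (L - M) * a z * G (L - M) z else 0)"
    using assms by (subst sum.delta) auto
  finally show ?thesis .
qed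

lemma superfun_mult_smono_right:
  assumes "finite L"
  shows "superfun_mult F (smono W M a) L z =
    (if z \<in> W \<and> M \<subseteq> L then shuffle_sign (L - M) M * F (L - M) z * a z else 0)"
proof -
  have "superfun_mult F (smono W M a) L z =
      (\<Sum>J\<in>Pow L. if J = L - M then (if z \<in> W \<and> M \<subseteq> L then shuffle_sign (L - M) M * F (L - M) z * a z else 0) else 0)"
    unfolding superfun_mult_def
  proof (intro sum.cong refl)
    fix J assume J: "J \<in> Pow L"
    have "L - J = M \<longleftrightarrow> J = L - M \<and> M \<subseteq> L" using J by auto
    then show "shuffle_sign J (L - J) * F J z * smono W M a (L - J) z =
        (if J = L - M then (if z \<in> W \<and> M \<subseteq> L then shuffle_sign (L - M) M * F (L - M) z * a z else 0) else 0)"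
      by (auto simp: smono_apply)
  qed
  also have "\<dots> = (if z \<in> W \<and> M \<subseteq> L then shuffle_sign (L - M) M * F (L - M) z * a z else 0)"
    using assms by (subst sum.delta) auto
  finally show ?thesis .
qed

lemma superfun_mult_scalar:
  assumes F: "F \<in> superfuns n m W"
  shows "superfun_mult (smono W {} a) F = (\<lambda>I z. a z * F I z)"
proof (intro ext)
  fix I z
  show "superfun_mult (smono W {} a) F I z = a z * F I z"
  proof (cases "finite I")
    case True
    then show ?thesis using superfunsD(3)[OF F] by (simp add: superfun_mult_smono_left)
  next
    case False
    then have "\<not> I \<subseteq> {..<m}" using finite_odd_index by blast
    \<comment> \<open>For infinite \<open>I\<close> the sum over \<open>Pow I\<close> defaults to 0,
      in agreement with \<open>F I\<close>.\<close>
    then show ?thesis using False superfunsD(2)[OF F] by (simp add: superfun_mult_def)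
  qed
qed

lemma superfun_decompose:
  assumes F: "F \<in> superfuns n m W"
  shows "F = (\<lambda>I z. \<Sum>M\<in>Pow {..<m}. F M z * smono W M (\<lambda>_. 1) I z)"
proof (intro ext)
  fix I z
  have "(\<Sum>M\<in>Pow {..<m}. F M z * smono W M (\<lambda>_. 1) I z) = (\<Sum>M\<in>Pow {..<m}. if M = I then (if z \<in> W then F I z else 0) else 0)"
    by (intro sum.cong) (auto simp: smono_apply)
  then show "F I z = (\<Sum>M\<in>Pow {..<m}. F M z * smono W M (\<lambda>_. 1) I z)"
    using superfunsD(2,3)[OF F] by (subst (asm) sum.delta) auto
qed

section \<open>Sup bounds and sheaf operators on the model\<close>

definition bounded_on :: "nat \<Rightarrow> (nat \<Rightarrow> complex) set \<Rightarrow> superfun \<Rightarrow> real \<Rightarrow> bool" where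
  "bounded_on m C F B \<longleftrightarrow> (\<forall>L\<subseteq>{..<m}. \<forall>z\<in>C. cmod (F L z) \<le> B)"

text \<open>A bound for the operator norm between sup norms on the radii \<open>s\<close> and
  \<open>r\<close>. The constant is uniform over all domains \<open>W\<close> that contain the
  larger polydisc.\<close>

definition maps_bounded ::
  "nat \<Rightarrow> nat \<Rightarrow> (nat \<Rightarrow> complex) set \<Rightarrow> ((nat \<Rightarrow> complex) set \<Rightarrow> superfun \<Rightarrow> superfun)
    \<Rightarrow> (nat \<Rightarrow> complex) \<Rightarrow> real \<Rightarrow> real \<Rightarrow> real \<Rightarrow> bool" where
  "maps_bounded n m V Q p s r C \<longleftrightarrow>
    (\<forall>W F B. open_in_Cspace n W \<and> W \<subseteq> V \<and> polydisc n p s \<subseteq> W \<and> F \<in> superfuns n m W \<and>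
       bounded_on m (polydisc n p s) F B \<longrightarrow> bounded_on m (polydisc n p r) (Q W F) (C * B))"

lemma maps_boundedI:
  "(\<And>W F B. \<lbrakk>open_in_Cspace n W; W \<subseteq> V; polydisc n p s \<subseteq> W; F \<in> superfuns n m W;
      bounded_on m (polydisc n p s) F B\<rbrakk> \<Longrightarrow> bounded_on m (polydisc n p r) (Q W F) (C * B)) \<Longrightarrow>
    maps_bounded n m V Q p s r C"
  by (simp add: maps_bounded_def)

lemma maps_boundedD:
  "\<lbrakk>maps_bounded n m V Q p s r C; open_in_Cspace n W; W \<subseteq> V; polydisc n p s \<subseteq> W;
    F \<in> superfuns n m W; bounded_on m (polydisc n p s) F B\<rbrakk> \<Longrightarrow>
    bounded_on m (polydisc n p r) (Q W F) (C * B)"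
  by (simp add: maps_bounded_def)

lemma finite_family_locally_bounded:
  assumes "finite S" "open_in_Cspace n V" "p \<in> V" "\<And>k. k \<in> S \<Longrightarrow> several_holomorphic_on n V (f k)"
  shows "\<exists>r>0. \<exists>B>0. polydisc n p r \<subseteq> V \<and> (\<forall>k\<in>S. \<forall>z\<in>polydisc n p r. cmod (f k z) \<le> B)"
  using assms(1,4)
proof (induction S)
  case empty
  obtain r where "r > 0" "polydisc n p r \<subseteq> V" using polydisc_subset_open assms by metis
  then show ?case using zero_less_one by blast
next
  case (insert k S)
  then obtain r1 B1 where 1: "r1 > 0" "B1 > 0" "polydisc n p r1 \<subseteq> V" "\<forall>k\<in>S. \<forall>z\<in>polydisc n p r1. cmod (f k z) \<le> B1"
    by (metis insertCI)
  obtain r2 B2 where 2: "r2 > 0" "B2 > 0" "polydisc n p r2 \<subseteq> V" "\<And>z. z \<in> polydisc n p r2 \<Longrightarrow> cmod (f k z) \<le> B2"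
    using several_holomorphic_on_locally_bounded[of n V "f k" p] insert.prems assms by (metis insertI1)
  have sub: "polydisc n p (min r1 r2) \<subseteq> polydisc n p r1" "polydisc n p (min r1 r2) \<subseteq> polydisc n p r2"
    by (simp_all add: polydisc_mono)
  have "\<forall>j\<in>insert k S. \<forall>z\<in>polydisc n p (min r1 r2). cmod (f j z) \<le> max B1 B2"
    using 1(4) 2(4) sub by (auto simp: le_max_iff_disj)
  moreover have "min r1 r2 > 0" "max B1 B2 > 0" using 1 2 by auto
  moreover have "polydisc n p (min r1 r2) \<subseteq> V" using sub 1(3) by blast
  ultimately show ?case by blast
qed

lemma superfun_locally_bounded:
  assumes "open_in_Cspace n W" "p \<in> W" "F \<in> superfuns n m W"
  obtains r B where "r > 0" "B > 0" "polydisc n p r \<subseteq> W" "bounded_on m (polydisc n p r) F B"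
  using finite_family_locally_bounded[of "Pow {..<m}" n W p F] assms superfunsD(1)[OF assms(3)]
  unfolding bounded_on_def by (auto simp: Pow_def)

text \<open>An endomorphism of the structure sheaf of the model over \<open>V\<close>: the
  conditions are those of \<open>sheaf_endomorphism\<close>, read on coefficient functions.\<close>

locale superdomain_operator =
  fixes n m :: nat and V :: "(nat \<Rightarrow> complex) set" and Q :: "(nat \<Rightarrow> complex) set \<Rightarrow> superfun \<Rightarrow> superfun"
  assumes open_V: "open_in_Cspace n V"
    and closed: "\<lbrakk>open_in_Cspace n W; W \<subseteq> V; F \<in> superfuns n m W\<rbrakk> \<Longrightarrow> Q W F \<in> superfuns n m W"
    and add: "\<lbrakk>open_in_Cspace n W; W \<subseteq> V; F \<in> superfuns n m W; G \<in> superfuns n m W\<rbrakk> \<Longrightarrow>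
      Q W (\<lambda>I z. F I z + G I z) = (\<lambda>I z. Q W F I z + Q W G I z)"
    and smult: "\<lbrakk>open_in_Cspace n W; W \<subseteq> V; F \<in> superfuns n m W\<rbrakk> \<Longrightarrow>
      Q W (\<lambda>I z. c * F I z) = (\<lambda>I z. c * Q W F I z)"
    and restrict: "\<lbrakk>open_in_Cspace n W; open_in_Cspace n W'; W' \<subseteq> W; W \<subseteq> V; F \<in> superfuns n m W\<rbrakk> \<Longrightarrow>
      Q W' (superfun_restrict W' F) = superfun_restrict W' (Q W F)"
begin

lemma zero: "open_in_Cspace n W \<Longrightarrow> W \<subseteq> V \<Longrightarrow> Q W (\<lambda>_ _. 0) = (\<lambda>_ _. 0)"
  using smult[of W "\<lambda>_ _. 0" 0] superfuns_zero by simp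

lemma sum:
  assumes "open_in_Cspace n W" "W \<subseteq> V" "finite S" "\<And>k. k \<in> S \<Longrightarrow> G k \<in> superfuns n m W"
  shows "Q W (\<lambda>I z. \<Sum>k\<in>S. G k I z) = (\<lambda>I z. \<Sum>k\<in>S. Q W (G k) I z)"
  using assms(3,4)
proof (induction S)
  case empty
  then show ?case using zero assms by simp
next
  case (insert k S)
  have "Q W (\<lambda>I z. G k I z + (\<Sum>k\<in>S. G k I z)) = (\<lambda>I z. Q W (G k) I z + Q W (\<lambda>I z. \<Sum>k\<in>S. G k I z) I z)"
    using insert.prems by (intro add assms(1,2) superfuns_sum) auto
  then show ?case using insert by simp
qed

lemma restrict_at:
  assumes "open_in_Cspace n W" "open_in_Cspace n W'" "W' \<subseteq> W" "W \<subseteq> V" "F \<in> superfuns n m W" "z \<in> W'"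
  shows "Q W F L z = Q W' (superfun_restrict W' F) L z"
  using restrict[OF assms(1-5)] assms(6) by (simp add: superfun_restrict_def)

lemma funpow_closed:
  "\<lbrakk>open_in_Cspace n W; W \<subseteq> V; F \<in> superfuns n m W\<rbrakk> \<Longrightarrow> (Q W ^^ k) F \<in> superfuns n m W"
  by (induction k) (auto intro: closed)

lemma funpow: "superdomain_operator n m V (\<lambda>W. Q W ^^ k)"
proof
  show "open_in_Cspace n V" by (rule open_V)
next
  fix W F assume W: "open_in_Cspace n W" "W \<subseteq> V" "F \<in> superfuns n m W"
  then show "(Q W ^^ k) F \<in> superfuns n m W" by (rule funpow_closed)
  show "(Q W ^^ k) (\<lambda>I z. c * F I z) = (\<lambda>I z. c * (Q W ^^ k) F I z)" for c
    using W by (induction k) (auto simp: smult funpow_closed)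
  show "(Q W ^^ k) (\<lambda>I z. F I z + G I z) = (\<lambda>I z. (Q W ^^ k) F I z + (Q W ^^ k) G I z)"
    if "G \<in> superfuns n m W" for G
    using W that by (induction k) (auto simp: add funpow_closed)
next
  fix W W' F assume W: "open_in_Cspace n W" "open_in_Cspace n W'" "W' \<subseteq> W" "W \<subseteq> V" "F \<in> superfuns n m W"
  then show "(Q W' ^^ k) (superfun_restrict W' F) = superfun_restrict W' ((Q W ^^ k) F)"
    by (induction k) (auto simp: restrict funpow_closed)
qed

end

text \<open>
  Only the Leibniz rule for multiplication by ordinary functions is required; these being even,
  no sign occurs, and both an odd vector field and its square satisfy it.
\<close>

locale superdomain_derivation = superdomain_operator +
  assumes leibniz: "\<lbrakk>open_in_Cspace n W; W \<subseteq> V; F \<in> superfuns n m W; several_holomorphic_on n W a\<rbrakk> \<Longrightarrow>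
      Q W (\<lambda>I z. a z * F I z) =
        (\<lambda>I z. superfun_mult (Q W (smono W {} a)) F I z + a z * Q W F I z)"
begin

text \<open>Leibniz for 1 = 1 1 gives Q 1 = (Q 1) 1 + Q 1, so Q 1 = 0.\<close>

lemma const:
  assumes "open_in_Cspace n W" "W \<subseteq> V"
  shows "Q W (smono W {} (\<lambda>_. c)) = (\<lambda>_ _. 0)"
proof -
  let ?e = "smono W {} (\<lambda>_. 1)"
  have e: "?e \<in> superfuns n m W" using assms by (intro smono_in_superfuns several_holomorphic_on_const) auto
  have "Q W ?e = (\<lambda>I z. superfun_mult (Q W ?e) ?e I z + Q W ?e I z)"
    using leibniz[OF assms e, of "\<lambda>_. 1"] by (simp add: several_holomorphic_on_const)
  then have "superfun_mult (Q W ?e) ?e I z + Q W ?e I z = Q W ?e I z" for I z by metis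
  then have *: "superfun_mult (Q W ?e) ?e I z = 0" for I z by simp
  have "Q W ?e I z = 0" for I z
  proof (cases "I \<subseteq> {..<m} \<and> z \<in> W")
    case True
    then have "finite I" using finite_odd_index by blast
    from superfun_mult_smono_right[OF this, of "Q W ?e" W "{}" "\<lambda>_. 1" z]
    show ?thesis using * True by simp
  qed (use superfunsD[OF closed[OF assms e]] in auto)
  moreover have "smono W {} (\<lambda>_. c) = (\<lambda>I z. c * ?e I z)" by (auto simp: smono_apply fun_eq_iff)
  ultimately show ?thesis using smult[OF assms e] by simp
qed

text \<open>At the centre the Hadamard terms with an undifferentiated factor
  \<open>z i - p i\<close> vanish and the constant \<open>f p\<close> is killed. What remains is the
  sum of the images of the coordinates times \<open>g i p\<close>, and \<open>g i p\<close> is at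
  most 2 B / s.\<close>

lemma scalar_bound:
  assumes p: "p \<in> V" and s: "s > 0" "polydisc n p s \<subseteq> V"
    and f: "several_holomorphic_on n (polydisc n p s) f" "\<And>z. z \<in> polydisc n p s \<Longrightarrow> cmod (f z) \<le> B"
    and A: "\<And>i. i < n \<Longrightarrow> cmod (Q V (smono V {} (\<lambda>z. z i)) L p) \<le> A"
  shows "cmod (Q (polydisc n p s) (smono (polydisc n p s) {} f) L p) \<le> real n * (A * (2 * B / s))"
proof -
  let ?D = "polydisc n p s"
  note D = open_polydisc[of n p s] s(2)
  have pC: "p \<in> Cspace n" using p openin_imp_subset[OF open_V] by auto
  have pD: "p \<in> ?D" using pC s centre_in_polydisc by auto
  obtain g where g: "\<And>i. i < n \<Longrightarrow> several_holomorphic_on n ?D (g i)"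
    "\<And>z. z \<in> ?D \<Longrightarrow> f z = f p + (\<Sum>i<n. (z i - p i) * g i z)"
    "\<And>i z B. i < n \<Longrightarrow> z \<in> polydisc n p (s/2) \<Longrightarrow> \<forall>y\<in>?D. cmod (f y) \<le> B \<Longrightarrow> cmod (g i z) \<le> 2 * B / s"
    using hadamard[OF f(1) pC s(1)] by blast
  let ?x = "\<lambda>i z. z i - p i :: complex"
  have x: "several_holomorphic_on n W (?x i)" for i W by (intro several_holomorphic_intros)
  have gi: "smono ?D {} (g i) \<in> superfuns n m ?D" if "i < n" for i
    by (intro smono_in_superfuns D g that) auto
  have coord: "Q ?D (\<lambda>I z. ?x i z * smono ?D {} (g i) I z) L p = Q V (smono V {} (\<lambda>z. z i)) L p * g i p"
    if i: "i < n" for i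
  proof (cases "L \<subseteq> {..<m}")
    case True
    then have fin: "finite L" using finite_odd_index by blast
    have c1: "smono V {} (\<lambda>z. z i) \<in> superfuns n m V" and c2: "smono V {} (\<lambda>_. - p i) \<in> superfuns n m V"
      by (intro smono_in_superfuns open_V several_holomorphic_intros; simp)+
    have "Q ?D (smono ?D {} (?x i)) L p = Q V (smono V {} (?x i)) L p"
    proof -
      have "smono ?D {} (?x i) = superfun_restrict ?D (smono V {} (?x i))"
        using s by (auto simp: superfun_restrict_def superfun_monom_def fun_eq_iff)
      then show ?thesis using restrict_at[OF open_V D(1) D(2) order_refl smono_in_superfuns[OF open_V x] pD] by simp
    qed
    also have "smono V {} (?x i) = (\<lambda>I z. smono V {} (\<lambda>z. z i) I z + smono V {} (\<lambda>_. - p i) I z)"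
      by (auto simp: smono_apply fun_eq_iff)
    also have "Q V \<dots> L p = Q V (smono V {} (\<lambda>z. z i)) L p"
      using add[OF open_V order_refl c1 c2] const[OF open_V order_refl] by simp
    finally have eq: "Q ?D (smono ?D {} (?x i)) L p = Q V (smono V {} (\<lambda>z. z i)) L p" .
    show ?thesis
      using leibniz[OF D gi[OF i] x, of i] pD fin by (simp add: superfun_mult_smono_right eq)
  next
    case False
    have c1: "smono V {} (\<lambda>z. z i) \<in> superfuns n m V"
      by (intro smono_in_superfuns open_V several_holomorphic_intros; simp)
    show ?thesis
      using superfunsD(2)[OF closed[OF D superfuns_scale[OF gi[OF i] x]] False]
        superfunsD(2)[OF closed[OF open_V order_refl c1] False] by simp
  qed
  have "smono ?D {} f = (\<lambda>I z. smono ?D {} (\<lambda>_. f p) I z + (\<Sum>i<n. ?x i z * smono ?D {} (g i) I z))"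
  proof (intro ext)
    fix I z
    show "smono ?D {} f I z = smono ?D {} (\<lambda>_. f p) I z + (\<Sum>i<n. ?x i z * smono ?D {} (g i) I z)"
    proof (cases "z \<in> ?D \<and> I = {}")
      case True
      then show ?thesis using g(2)[of z] by (simp add: smono_apply)
    next
      case False
      then have "smono ?D {} a I z = 0" for a by (auto simp: smono_apply)
      then show ?thesis by simp
    qed
  qed
  moreover have "Q ?D \<dots> = (\<lambda>I z. Q ?D (smono ?D {} (\<lambda>_. f p)) I z + Q ?D (\<lambda>I z. \<Sum>i<n. ?x i z * smono ?D {} (g i) I z) I z)"
    by (intro add D smono_in_superfuns several_holomorphic_on_const superfuns_sum superfuns_scale gi x) auto
  moreover have "Q ?D (\<lambda>I z. \<Sum>i<n. ?x i z * smono ?D {} (g i) I z) = (\<lambda>I z. \<Sum>i<n. Q ?D (\<lambda>I z. ?x i z * smono ?D {} (g i) I z) I z)"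
    by (intro sum D superfuns_scale gi x) auto
  ultimately have "Q ?D (smono ?D {} f) L p = (\<Sum>i<n. Q V (smono V {} (\<lambda>z. z i)) L p * g i p)"
    using const[OF D] coord by simp
  also have "cmod \<dots> \<le> (\<Sum>i<n. A * (2 * B / s))"
  proof (rule sum_norm_le)
    fix i assume "i \<in> {..<n}"
    then have i: "i < n" by simp
    have "p \<in> polydisc n p (s/2)" using pC s centre_in_polydisc by auto
    then have "cmod (g i p) \<le> 2 * B / s" using g(3)[OF i] f(2) by blast
    moreover have "0 \<le> A" using A[OF i] norm_ge_zero order_trans by blast
    ultimately show "cmod (Q V (smono V {} (\<lambda>z. z i)) L p * g i p) \<le> A * (2 * B / s)"
      unfolding norm_mult using A[OF i] by (intro mult_mono) auto
  qed
  finally show ?thesis by simp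
qed

lemma cauchy_estimate:
  assumes p: "p \<in> V"
  obtains R C where "R > 0" "C > 0" "polydisc n p R \<subseteq> V"
    "\<And>r s. \<lbrakk>0 < r; r < s; s \<le> R\<rbrakk> \<Longrightarrow> maps_bounded n m V Q p s r (C / (s - r))"
proof -
  \<comment> \<open>The images of the coordinates and of the monomials \<open>\<xi>\<^sup>M\<close>
    control the whole derivation. They are finitely many, so one radius and one bound
    \<open>A\<close> serve all.\<close>
  define S where "S = (\<lambda>(i, L). Q V (smono V {} (\<lambda>z. z i)) L) ` ({..<n} \<times> Pow {..<m}) \<union>
    (\<lambda>(M, L). Q V (smono V M (\<lambda>_. 1)) L) ` (Pow {..<m} \<times> Pow {..<m})"
  have "finite S" unfolding S_def by auto
  moreover have "several_holomorphic_on n V f" if "f \<in> S" for f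
    using that unfolding S_def
    by (auto intro!: superfunsD(1)[OF closed] open_V smono_in_superfuns several_holomorphic_intros)
  ultimately obtain R A where R: "R > 0" "A > 0" "polydisc n p R \<subseteq> V"
    "\<forall>f\<in>S. \<forall>z\<in>polydisc n p R. cmod (f z) \<le> A"
    using finite_family_locally_bounded[of S n V p "\<lambda>f. f"] open_V p by metis
  have A1: "cmod (Q V (smono V {} (\<lambda>z. z i)) L z) \<le> A"
    if "i < n" "L \<subseteq> {..<m}" "z \<in> polydisc n p R" for i L z
    using R(4) that unfolding S_def by auto
  have A2: "cmod (Q V (smono V M (\<lambda>_. 1)) L z) \<le> A"
    if "M \<subseteq> {..<m}" "L \<subseteq> {..<m}" "z \<in> polydisc n p R" for M L z
    using R(4) that unfolding S_def by auto
  \<comment> \<open>There are 2^m monomials, and 2 n comes from \<open>scalar_bound\<close>. The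
    term without derivative carries no 1 / (s - r); as s - r is at most \<open>R\<close>, it is
    absorbed by a factor R / (s - r).\<close>
  define C where "C = 2 ^ m * (A * (2 * real n + R))"
  show ?thesis
  proof (rule that[of R C])
    show "C > 0" using R unfolding C_def by (intro mult_pos_pos add_nonneg_pos) auto
    fix r s :: real assume rs: "0 < r" "r < s" "s \<le> R"
    show "maps_bounded n m V Q p s r (C / (s - r))"
    proof (rule maps_boundedI, unfold bounded_on_def[of m "polydisc n p r"], intro allI impI ballI)
      fix W F B L z
      assume W: "open_in_Cspace n W" "W \<subseteq> V" "polydisc n p s \<subseteq> W" and F: "F \<in> superfuns n m W"
        and B: "bounded_on m (polydisc n p s) F B"
      assume L: "L \<subseteq> {..<m}" and z: "z \<in> polydisc n p r"
      \<comment> \<open>A polydisc of radius s - r about a point of the smaller polydisc stays in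
        the larger one, so \<open>scalar_bound\<close> applies with centre \<open>z\<close>.\<close>
      define t where "t = s - r"
      have t: "t > 0" "r + t = s" "t \<le> R" using rs by (auto simp: t_def)
      let ?D = "polydisc n z t"
      have Ds: "?D \<subseteq> polydisc n p s" using polydisc_subset_polydisc[OF z, of t] t by simp
      have DW: "?D \<subseteq> W" "?D \<subseteq> V" using Ds W by auto
      note D = open_polydisc[of n z t] DW(2)
      have zD: "z \<in> ?D" using z t by (intro centre_in_polydisc) (auto simp: polydisc_def)
      have zV: "z \<in> V" using zD DW by auto
      have zR: "z \<in> polydisc n p R" using z polydisc_mono[of r R n p] rs by auto
      have fin: "finite L" using L finite_odd_index by blast
      let ?F = "superfun_restrict ?D F"
      have FD: "?F \<in> superfuns n m ?D" by (rule superfuns_restrict[OF F DW(1) D(1)])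
      have FM: "several_holomorphic_on n ?D (?F M)" for M by (rule superfunsD(1)[OF FD])
      have FB: "cmod (?F M y) \<le> B" if "M \<subseteq> {..<m}" "y \<in> ?D" for M y
        using B that Ds by (auto simp: bounded_on_def superfun_restrict_def)
      have B0: "0 \<le> B" using FB[of "{}" z] zD by (metis empty_subsetI norm_ge_zero order_trans)
      have e: "smono ?D M (\<lambda>_. 1) \<in> superfuns n m ?D" if "M \<subseteq> {..<m}" for M
        by (intro smono_in_superfuns D that several_holomorphic_on_const)
      have eV: "smono V M (\<lambda>_. 1) \<in> superfuns n m V" if "M \<subseteq> {..<m}" for M
        by (intro smono_in_superfuns open_V that several_holomorphic_on_const)
      have "Q W F L z = Q ?D ?F L z" by (rule restrict_at[OF W(1) D(1) DW(1) W(2) F zD])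
      also have "\<dots> = Q ?D (\<lambda>I y. \<Sum>M\<in>Pow {..<m}. ?F M y * smono ?D M (\<lambda>_. 1) I y) L z"
        using superfun_decompose[OF FD] by simp
      also have "\<dots> = (\<Sum>M\<in>Pow {..<m}. Q ?D (\<lambda>I y. ?F M y * smono ?D M (\<lambda>_. 1) I y) L z)"
        using sum[OF D, of "Pow {..<m}" "\<lambda>M I y. ?F M y * smono ?D M (\<lambda>_. 1) I y"] e FM
        by (simp add: superfuns_scale)
      finally have eq: "Q W F L z = (\<Sum>M\<in>Pow {..<m}. Q ?D (\<lambda>I y. ?F M y * smono ?D M (\<lambda>_. 1) I y) L z)" .
      have "cmod (Q W F L z) \<le> (\<Sum>M\<in>Pow {..<m}. A * (2 * real n + R) / t * B)"
        unfolding eq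
      proof (rule sum_norm_le)
        fix M assume "M \<in> Pow {..<m}"
        then have M: "M \<subseteq> {..<m}" by simp
        let ?G = "Q ?D (smono ?D {} (?F M))"
        have G: "cmod (?G L' z) \<le> real n * (A * (2 * B / t))" if "L' \<subseteq> {..<m}" for L'
          by (intro scalar_bound zV t D FM FB M A1 that zR)
        have "Q ?D (\<lambda>I y. ?F M y * smono ?D M (\<lambda>_. 1) I y) L z =
            superfun_mult ?G (smono ?D M (\<lambda>_. 1)) L z + ?F M z * Q ?D (smono ?D M (\<lambda>_. 1)) L z"
          using leibniz[OF D e[OF M] FM] by simp
        also have "Q ?D (smono ?D M (\<lambda>_. 1)) L z = Q V (smono V M (\<lambda>_. 1)) L z"
        proof -
          have "smono ?D M (\<lambda>_. 1) = superfun_restrict ?D (smono V M (\<lambda>_. 1))"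
            using DW by (auto simp: superfun_restrict_def superfun_monom_def fun_eq_iff)
          then show ?thesis using restrict_at[OF open_V D(1) D(2) order_refl eV[OF M] zD] by simp
        qed
        also have "cmod (superfun_mult ?G (smono ?D M (\<lambda>_. 1)) L z + ?F M z * Q V (smono V M (\<lambda>_. 1)) L z)
            \<le> real n * (A * (2 * B / t)) + B * A"
        proof (rule order_trans[OF norm_triangle_ineq add_mono])
          show "cmod (superfun_mult ?G (smono ?D M (\<lambda>_. 1)) L z) \<le> real n * (A * (2 * B / t))"
            using G[of "L - M"] L R(2) B0 t by (auto simp: superfun_mult_smono_right[OF fin] norm_mult)
          show "cmod (?F M z * Q V (smono V M (\<lambda>_. 1)) L z) \<le> B * A"
            unfolding norm_mult using FB[OF M zD] A2[OF M L zR] B0 by (intro mult_mono) auto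
        qed
        also have "\<dots> \<le> real n * (A * (2 * B / t)) + B * A * (R / t)"
        proof -
          have "B * A * 1 \<le> B * A * (R / t)" using t R B0 by (intro mult_left_mono) auto
          then show ?thesis by simp
        qed
        also have "\<dots> = A * (2 * real n + R) / t * B"
          using t by (simp add: field_simps)
        finally show "cmod (Q ?D (\<lambda>I y. ?F M y * smono ?D M (\<lambda>_. 1) I y) L z) \<le> A * (2 * real n + R) / t * B" .
      qed
      also have "\<dots> = C / (s - r) * B" by (simp add: C_def t_def card_Pow)
      finally show "cmod (Q W F L z) \<le> C / (s - r) * B" .
    qed
  qed (use R in auto)
qed

end

section \<open>The exponential series on the model\<close>

lemma power_mult_fact_le: "real (k ^ j) * fact k \<le> fact (k + j)"
proof (induction j)
  case (Suc j)
  \<comment> \<open>Raising \<open>j\<close> by one costs a factor \<open>k\<close> on the left and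
    gains k + j + 1 on the right. The case j = k is the estimate for (2k)!.\<close>
  have "real (k ^ Suc j) * fact k = real k * (real (k ^ j) * fact k)" by simp
  also have "\<dots> \<le> real (Suc (k + j)) * fact (k + j)" using Suc by (intro mult_mono) auto
  finally show ?case by (simp only: add_Suc_right fact_Suc of_nat_mult)
qed simp

text \<open>The Leibniz rule for both \<open>D\<close> and its square is all that the oddness of the
  field contributes to the estimates.\<close>

locale odd_superdomain_derivation = superdomain_derivation n m V D +
    square: superdomain_derivation n m V "\<lambda>W F. D W (D W F)"
  for n m V D
begin

text \<open>By \<open>exp_summable\<close>, for sections over open subsets of \<open>V\<close> the
  value of \<open>suminf\<close> is always a true sum and never a default.\<close>

definition exp_op :: "(nat \<Rightarrow> complex) set \<Rightarrow> superfun \<Rightarrow> superfun" where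
  "exp_op W F = (\<lambda>L z. \<Sum>j. (D W ^^ j) F L z / fact j)"

lemma funpow_square_bound:
  assumes est: "\<And>r s. \<lbrakk>0 < r; r < s; s \<le> R\<rbrakk> \<Longrightarrow> maps_bounded n m V (\<lambda>W F. D W (D W F)) p s r (C / (s - r))"
    and W: "open_in_Cspace n W" "W \<subseteq> V" "polydisc n p s \<subseteq> W" and F: "F \<in> superfuns n m W"
    and s: "s \<le> R" "bounded_on m (polydisc n p s) F B" and \<delta>: "\<delta> > 0"
  shows "real k * \<delta> < s \<Longrightarrow> bounded_on m (polydisc n p (s - real k * \<delta>)) ((D W ^^ (2 * k)) F) ((C / \<delta>) ^ k * B)"
proof (induction k)
  case 0
  then show ?case using s by simp
next
  case (Suc k)
  let ?s = "s - real k * \<delta>" and ?r = "s - real (Suc k) * \<delta>"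
  have k: "real k * \<delta> < s" using Suc.prems \<delta> by (simp add: algebra_simps)
  have "bounded_on m (polydisc n p ?r) (D W (D W ((D W ^^ (2 * k)) F))) (C / (?s - ?r) * ((C / \<delta>) ^ k * B))"
  proof (rule maps_boundedD[OF est W(1,2)])
    show "polydisc n p ?s \<subseteq> W" using W(3) polydisc_mono[of ?s s n p] \<delta> by auto
    show "?s \<le> R" using s \<delta> by (simp add: order_trans[of _ s])
  qed (use Suc k \<delta> W F in \<open>auto intro: funpow_closed simp: algebra_simps\<close>)
  moreover have "?s - ?r = \<delta>" by (simp add: algebra_simps)
  ultimately show ?case by (simp add: mult.assoc)
qed

text \<open>
  Two applications of \<open>D\<close> cost only one derivative: this is where the oddness of the field enters.
\<close>

lemma exp_term_bound:
  assumes p: "p \<in> V"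
  obtains R where "R > 0" "polydisc n p R \<subseteq> V"
    "\<And>r s. 0 < r \<Longrightarrow> r < s \<Longrightarrow> s \<le> R \<Longrightarrow> \<exists>\<mu>. summable \<mu> \<and> (\<forall>j. \<mu> j \<ge> 0) \<and>
      (\<forall>j. maps_bounded n m V (\<lambda>W F L z. (D W ^^ j) F L z / fact j) p s r (\<mu> j))"
proof -
  obtain R1 C1 where 1: "R1 > 0" "C1 > 0" "polydisc n p R1 \<subseteq> V"
    "\<And>r s. \<lbrakk>0 < r; r < s; s \<le> R1\<rbrakk> \<Longrightarrow> maps_bounded n m V D p s r (C1 / (s - r))"
    by (rule cauchy_estimate[OF p]) blast
  obtain R2 C2 where 2: "R2 > 0" "C2 > 0" "polydisc n p R2 \<subseteq> V"
    "\<And>r s. \<lbrakk>0 < r; r < s; s \<le> R2\<rbrakk> \<Longrightarrow> maps_bounded n m V (\<lambda>W F. D W (D W F)) p s r (C2 / (s - r))"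
    by (rule square.cauchy_estimate[OF p]) blast
  define R where "R = min R1 R2"
  show ?thesis
  proof (rule that[of R])
    show "R > 0" using 1 2 by (simp add: R_def)
    show "polydisc n p R \<subseteq> V" using 1(3) polydisc_mono[of R R1 n p] by (auto simp: R_def)
    fix r s :: real assume rs: "0 < r" "r < s" "s \<le> R"
    \<comment> \<open>The midpoint splits the loss of radius: from \<open>s\<close> to
      \<open>t\<close> for the powers of \<open>D\<^sup>2\<close>, from \<open>t\<close> to
      \<open>r\<close> for the single \<open>D\<close> left over when the exponent is odd.\<close>
    define t where "t = (r + s) / 2"
    have t: "r < t" "t < s" "0 < t" using rs by (auto simp: t_def)
    define q where "q = C2 / (s - t)"
    define b where "b = 1 + C1 / (t - r)"
    have q: "q > 0" and b: "b \<ge> 1" using 1 2 t by (auto simp: q_def b_def)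
    \<comment> \<open>Here \<open>j div 2\<close> counts the factors \<open>D\<^sup>2\<close>, and
      \<open>b\<close> dominates both 1 and the cost of the extra \<open>D\<close>, so one formula
      covers both parities.\<close>
    define \<mu> where "\<mu> j = b * (q ^ (j div 2) / fact (j div 2))" for j
    have \<mu>0: "\<mu> j \<ge> 0" for j using q b by (simp add: \<mu>_def)
    have "summable \<mu>"
    proof (rule bounded_imp_summable[OF \<mu>0])
      fix N
      \<comment> \<open>Exponents 2 k and 2 k + 1 share a bound, so the partial sums are 2 b times
        those of an exponential series.\<close>
      have "(\<Sum>j<2 * k. \<mu> j) = 2 * b * (\<Sum>j<k. q ^ j / fact j)" for k
        by (induction k) (auto simp: \<mu>_def algebra_simps)
      moreover have "(\<Sum>j\<le>N. \<mu> j) \<le> (\<Sum>j<2 * Suc N. \<mu> j)"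
        using \<mu>0 by (intro sum_mono2) auto
      moreover have "(\<Sum>j<Suc N. q ^ j / fact j) \<le> exp q"
      proof -
        have "(\<lambda>j. q ^ j / fact j) sums exp q" using exp_converges[of q] by (simp add: divide_inverse mult.commute)
        then show ?thesis using q by (metis (no_types, lifting) divide_nonneg_pos fact_gt_zero sum_le_suminf
              finite_lessThan less_imp_le sums_iff zero_le_power)
      qed
      ultimately show "(\<Sum>j\<le>N. \<mu> j) \<le> 2 * b * exp q" using b by (smt (verit) mult_left_mono)
    qed
    moreover have "maps_bounded n m V (\<lambda>W F L z. (D W ^^ j) F L z / fact j) p s r (\<mu> j)" for j
    proof (rule maps_boundedI)
      fix W F B
      assume W: "open_in_Cspace n W" "W \<subseteq> V" "polydisc n p s \<subseteq> W" and F: "F \<in> superfuns n m W"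
        and B: "bounded_on m (polydisc n p s) F B"
      define k where "k = j div 2"
      have pC: "p \<in> Cspace n" using p openin_imp_subset[OF open_V] by auto
      have B0: "B \<ge> 0"
        using B centre_in_polydisc[OF pC, of s] rs unfolding bounded_on_def
        by (metis empty_subsetI norm_ge_zero order_trans order.strict_trans)
      have k1: "bounded_on m (polydisc n p t) ((D W ^^ (2 * k)) F) (q ^ k * real (k ^ k) * B)"
      proof (cases "k = 0")
        case True
        then show ?thesis using B polydisc_mono[of t s n p] t by (auto simp: bounded_on_def)
      next
        case False
        \<comment> \<open>The \<open>k\<close> equal steps use up s - t exactly; their width is the
          source of the factor k^k.\<close>
        define \<delta> where "\<delta> = (s - t) / real k"
        have \<delta>: "\<delta> > 0" "real k * \<delta> = s - t" using False t by (auto simp: \<delta>_def)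
        have "bounded_on m (polydisc n p (s - real k * \<delta>)) ((D W ^^ (2 * k)) F) ((C2 / \<delta>) ^ k * B)"
          by (rule funpow_square_bound[OF 2(4) W F _ B \<delta>(1)]) (use rs t \<delta> in \<open>auto simp: R_def\<close>)
        moreover have "(C2 / \<delta>) ^ k = q ^ k * real (k ^ k)"
          by (simp add: \<delta>_def q_def power_mult_distrib[symmetric])
        ultimately show ?thesis by (simp add: \<delta>(2))
      qed
      have k2: "bounded_on m (polydisc n p r) (D W ((D W ^^ (2 * k)) F)) (C1 / (t - r) * (q ^ k * real (k ^ k) * B))"
      proof (rule maps_boundedD[OF 1(4) W(1,2)])
        show "polydisc n p t \<subseteq> W" using W(3) polydisc_mono[of t s n p] t by auto
        show "t \<le> R1" using rs t by (simp add: R_def)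
      qed (use rs t W F k1 in \<open>auto intro: funpow_closed\<close>)
      have fk: "real (k ^ k) / fact j \<le> 1 / fact k"
      proof -
        have "real (k ^ k) * fact k \<le> fact (k + k)" by (rule power_mult_fact_le)
        also have "\<dots> \<le> fact j" by (intro fact_mono) (simp add: k_def)
        finally show ?thesis by (simp add: divide_simps)
      qed
      have main: "cmod ((D W ^^ j) F L z) \<le> b * (q ^ k * real (k ^ k) * B)"
        if L: "L \<subseteq> {..<m}" and z: "z \<in> polydisc n p r" for L z
      proof (cases "even j")
        case True
        then have "2 * k = j" by (simp add: k_def)
        then have "cmod ((D W ^^ j) F L z) \<le> 1 * (q ^ k * real (k ^ k) * B)"
          using k1 L z polydisc_mono[of r t n p] t by (auto simp: bounded_on_def)
        also have "\<dots> \<le> b * (q ^ k * real (k ^ k) * B)" using b q B0 by (intro mult_right_mono) auto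
        finally show ?thesis .
      next
        case False
        then have "j = Suc (2 * k)" by (simp add: k_def)
        then have "cmod ((D W ^^ j) F L z) \<le> C1 / (t - r) * (q ^ k * real (k ^ k) * B)"
          using k2 L z by (auto simp: bounded_on_def)
        also have "\<dots> \<le> b * (q ^ k * real (k ^ k) * B)" using q B0 by (intro mult_right_mono) (auto simp: b_def)
        finally show ?thesis .
      qed
      show "bounded_on m (polydisc n p r) (\<lambda>L z. (D W ^^ j) F L z / fact j) (\<mu> j * B)"
        unfolding bounded_on_def
      proof (intro allI impI ballI)
        fix L z assume Lz: "L \<subseteq> {..<m}" "z \<in> polydisc n p r"
        have "cmod ((D W ^^ j) F L z / fact j) \<le> b * (q ^ k * real (k ^ k) * B) / fact j"
          unfolding norm_divide norm_fact using main[OF Lz] by (intro divide_right_mono) auto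
        also have "\<dots> = b * q ^ k * B * (real (k ^ k) / fact j)" by simp
        also have "\<dots> \<le> b * q ^ k * B * (1 / fact k)" using fk b q B0 by (intro mult_left_mono) auto
        also have "\<dots> = \<mu> j * B" by (simp add: \<mu>_def k_def)
        finally show "cmod ((D W ^^ j) F L z / fact j) \<le> \<mu> j * B" .
      qed
    qed
    ultimately show "\<exists>\<mu>. summable \<mu> \<and> (\<forall>j. \<mu> j \<ge> 0) \<and>
      (\<forall>j. maps_bounded n m V (\<lambda>W F L z. (D W ^^ j) F L z / fact j) p s r (\<mu> j))"
      using \<mu>0 by blast
  qed
qed

end

locale bounded_superdomain_operator = superdomain_operator n m V P for n m V P +
  assumes bounded: "p \<in> V \<Longrightarrow> \<exists>R>0. polydisc n p R \<subseteq> V \<and>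
    (\<forall>r s. 0 < r \<and> r < s \<and> s \<le> R \<longrightarrow> (\<exists>C\<ge>0. maps_bounded n m V P p s r C))"

context odd_superdomain_derivation
begin

text \<open>The radius shrinks to where \<open>F\<close> itself is bounded by some \<open>B\<close>;
  there the M-test applies with the majorant \<open>\<mu> j * B\<close>.\<close>

lemma exp_partial_sums:
  assumes W: "open_in_Cspace n W" "W \<subseteq> V" and F: "F \<in> superfuns n m W" and p: "p \<in> W"
  shows "\<exists>r>0. polydisc n p r \<subseteq> W \<and> (\<forall>L\<subseteq>{..<m}.
    uniform_limit (polydisc n p r) (\<lambda>N z. \<Sum>j<N. (D W ^^ j) F L z / fact j) (exp_op W F L) sequentially \<and>
    (\<forall>z\<in>polydisc n p r. summable (\<lambda>j. (D W ^^ j) F L z / fact j)))"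
proof -
  obtain r0 B where B: "r0 > 0" "B > 0" "polydisc n p r0 \<subseteq> W" "bounded_on m (polydisc n p r0) F B"
    using superfun_locally_bounded[OF W(1) p F] by metis
  have "p \<in> V" using p W by auto
  then obtain R where R: "R > 0" "polydisc n p R \<subseteq> V"
    "\<And>r s. 0 < r \<Longrightarrow> r < s \<Longrightarrow> s \<le> R \<Longrightarrow> \<exists>\<mu>. summable \<mu> \<and> (\<forall>j. \<mu> j \<ge> 0) \<and>
      (\<forall>j. maps_bounded n m V (\<lambda>W F L z. (D W ^^ j) F L z / fact j) p s r (\<mu> j))"
    by (rule exp_term_bound) blast
  define s where "s = min r0 R"
  have s: "s > 0" "s \<le> r0" "s \<le> R" "0 < s/2" "s/2 < s" using B(1) R(1) by (auto simp: s_def)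
  obtain \<mu> where \<mu>: "summable \<mu>" "\<And>j. maps_bounded n m V (\<lambda>W F L z. (D W ^^ j) F L z / fact j) p s (s/2) (\<mu> j)"
    using R(3)[OF s(4,5,3)] by blast
  have sub: "polydisc n p s \<subseteq> polydisc n p r0" "polydisc n p (s/2) \<subseteq> polydisc n p s"
    using s by (simp_all add: polydisc_mono)
  have FB: "bounded_on m (polydisc n p s) F B" using B(4) sub(1) by (auto simp: bounded_on_def)
  have sW: "polydisc n p s \<subseteq> W" using B(3) sub(1) by blast
  have bd: "cmod ((D W ^^ j) F L z / fact j) \<le> \<mu> j * B" if "L \<subseteq> {..<m}" "z \<in> polydisc n p (s/2)" for L z j
    using maps_boundedD[OF \<mu>(2) W sW F FB] that by (simp add: bounded_on_def)
  have sm: "summable (\<lambda>j. \<mu> j * B)" using \<mu>(1) by (rule summable_mult2)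
  have "uniform_limit (polydisc n p (s/2)) (\<lambda>N z. \<Sum>j<N. (D W ^^ j) F L z / fact j) (exp_op W F L) sequentially"
    if "L \<subseteq> {..<m}" for L
    unfolding exp_op_def using bd[OF that] sm by (rule Weierstrass_m_test)
  moreover have "summable (\<lambda>j. (D W ^^ j) F L z / fact j)" if "L \<subseteq> {..<m}" "z \<in> polydisc n p (s/2)" for L z
    using sm bd[OF that] by (rule summable_comparison_test'[where N = 0])
  moreover have "polydisc n p (s/2) \<subseteq> W" using sub B(3) by blast
  ultimately show ?thesis using s(4) by blast
qed

lemma exp_summable:
  assumes W: "open_in_Cspace n W" "W \<subseteq> V" and F: "F \<in> superfuns n m W"
  shows "summable (\<lambda>j. (D W ^^ j) F L z / fact j)"
proof (cases "L \<subseteq> {..<m} \<and> z \<in> W")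
  case True
  then have "z \<in> W" by simp
  from exp_partial_sums[OF W F this] obtain r where r: "r > 0"
    "\<forall>L\<subseteq>{..<m}. uniform_limit (polydisc n z r) (\<lambda>N z. \<Sum>j<N. (D W ^^ j) F L z / fact j) (exp_op W F L) sequentially \<and>
    (\<forall>y\<in>polydisc n z r. summable (\<lambda>j. (D W ^^ j) F L y / fact j))"
    by (elim exE conjE)
  have "z \<in> polydisc n z r" using True r(1) openin_imp_subset[OF W(1)] by (intro centre_in_polydisc) auto
  then show ?thesis using r(2)[rule_format, of L] True by blast
next
  case False
  then show ?thesis using superfun_eq_0[OF funpow_closed[OF W F]] by simp
qed

lemma exp_op_superdomain_operator: "superdomain_operator n m V exp_op"
proof
  show "open_in_Cspace n V" by (rule open_V)
next
  fix W F assume W: "open_in_Cspace n W" "W \<subseteq> V" "F \<in> superfuns n m W"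
  have "several_holomorphic_on n W (exp_op W F L)" for L
  proof (cases "L \<subseteq> {..<m}")
    case True
    show ?thesis
    proof (rule several_holomorphic_on_uniform_limit[OF W(1) sequentially_bot])
      fix p assume "p \<in> W"
      from exp_partial_sums[OF W this] obtain r where r: "r > 0" "polydisc n p r \<subseteq> W"
        "\<forall>L\<subseteq>{..<m}. uniform_limit (polydisc n p r) (\<lambda>N z. \<Sum>j<N. (D W ^^ j) F L z / fact j) (exp_op W F L) sequentially \<and>
        (\<forall>z\<in>polydisc n p r. summable (\<lambda>j. (D W ^^ j) F L z / fact j))"
        by (elim exE conjE)
      have "several_holomorphic_on n (polydisc n p r) (\<lambda>z. \<Sum>j<N. (D W ^^ j) F L z / fact j)" for N
        by (rule several_holomorphic_on_subset[OF _ r(2)],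
            intro several_holomorphic_on_sum several_holomorphic_on_divide several_holomorphic_on_const
              superfunsD(1)[OF funpow_closed[OF W]]) auto
      then show "\<exists>r>0. polydisc n p r \<subseteq> W \<and> (\<exists>f. (\<forall>\<^sub>F k in sequentially. several_holomorphic_on n (polydisc n p r) (f k)) \<and>
          uniform_limit (polydisc n p r) f (exp_op W F L) sequentially)"
        using r(1,2) r(3)[rule_format, OF True]
        by (intro exI[of _ r] conjI exI[of _ "\<lambda>N z. \<Sum>j<N. (D W ^^ j) F L z / fact j"] always_eventually allI) auto
    qed
  next
    case False
    then have "exp_op W F L = (\<lambda>_. 0)"
      using superfunsD(2)[OF funpow_closed[OF W] False] by (simp add: exp_op_def fun_eq_iff)
    then show ?thesis using several_holomorphic_on_const by simp
  qed
  moreover have "exp_op W F L z = 0" if "\<not> (L \<subseteq> {..<m} \<and> z \<in> W)" for L z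
    using superfun_eq_0[OF funpow_closed[OF W] that] by (simp add: exp_op_def)
  ultimately show "exp_op W F \<in> superfuns n m W" by (simp add: superfuns_def)
  show "exp_op W (\<lambda>I z. c * F I z) = (\<lambda>I z. c * exp_op W F I z)" for c
  proof (intro ext)
    fix I z
    have "(D W ^^ j) (\<lambda>I z. c * F I z) I z / fact j = c * ((D W ^^ j) F I z / fact j)" for j
      by (simp add: superdomain_operator.smult[OF funpow W])
    then show "exp_op W (\<lambda>I z. c * F I z) I z = c * exp_op W F I z"
      unfolding exp_op_def using suminf_mult[OF exp_summable[OF W]] by simp
  qed
  show "exp_op W (\<lambda>I z. F I z + G I z) = (\<lambda>I z. exp_op W F I z + exp_op W G I z)"
    if G: "G \<in> superfuns n m W" for G
  proof (intro ext)
    fix I z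
    have "(D W ^^ j) (\<lambda>I z. F I z + G I z) I z / fact j = (D W ^^ j) F I z / fact j + (D W ^^ j) G I z / fact j" for j
      by (simp add: superdomain_operator.add[OF funpow W G] add_divide_distrib)
    then show "exp_op W (\<lambda>I z. F I z + G I z) I z = exp_op W F I z + exp_op W G I z"
      unfolding exp_op_def using suminf_add[OF exp_summable[OF W] exp_summable[OF W(1,2) G]] by simp
  qed
next
  fix W W' F assume W: "open_in_Cspace n W" "open_in_Cspace n W'" "W' \<subseteq> W" "W \<subseteq> V" "F \<in> superfuns n m W"
  show "exp_op W' (superfun_restrict W' F) = superfun_restrict W' (exp_op W F)"
    unfolding exp_op_def superdomain_operator.restrict[OF funpow W]
    by (auto simp: superfun_restrict_def fun_eq_iff)
qed

lemma exp_op_bounded: "bounded_superdomain_operator n m V exp_op"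
proof (intro bounded_superdomain_operator.intro exp_op_superdomain_operator bounded_superdomain_operator_axioms.intro)
  fix p assume "p \<in> V"
  then obtain R where R: "R > 0" "polydisc n p R \<subseteq> V"
    "\<And>r s. 0 < r \<Longrightarrow> r < s \<Longrightarrow> s \<le> R \<Longrightarrow> \<exists>\<mu>. summable \<mu> \<and> (\<forall>j. \<mu> j \<ge> 0) \<and>
      (\<forall>j. maps_bounded n m V (\<lambda>W F L z. (D W ^^ j) F L z / fact j) p s r (\<mu> j))"
    by (rule exp_term_bound) blast
  have "\<exists>C\<ge>0. maps_bounded n m V exp_op p s r C" if rs: "0 < r" "r < s" "s \<le> R" for r s
  proof -
    obtain \<mu> where \<mu>: "summable \<mu>" "\<And>j. \<mu> j \<ge> 0"
      "\<And>j. maps_bounded n m V (\<lambda>W F L z. (D W ^^ j) F L z / fact j) p s r (\<mu> j)"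
      using R(3)[OF rs] by blast
    have "maps_bounded n m V exp_op p s r (suminf \<mu>)"
    proof (rule maps_boundedI, unfold bounded_on_def[of m "polydisc n p r"], intro allI impI ballI)
      fix W F B L z
      assume *: "open_in_Cspace n W" "W \<subseteq> V" "polydisc n p s \<subseteq> W" "F \<in> superfuns n m W"
        "bounded_on m (polydisc n p s) F B"
      assume Lz: "L \<subseteq> {..<m}" "z \<in> polydisc n p r"
      have "cmod ((D W ^^ j) F L z / fact j) \<le> \<mu> j * B" for j
        using maps_boundedD[OF \<mu>(3) *] Lz by (simp add: bounded_on_def)
      then have "cmod (exp_op W F L z) \<le> (\<Sum>j. \<mu> j * B)"
        unfolding exp_op_def by (intro norm_suminf_le summable_mult2 \<mu>(1)) auto
      then show "cmod (exp_op W F L z) \<le> suminf \<mu> * B" using suminf_mult2[OF \<mu>(1)] by simp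
    qed
    then show ?thesis using suminf_nonneg[OF \<mu>(1,2)] by blast
  qed
  then show "\<exists>R>0. polydisc n p R \<subseteq> V \<and>
    (\<forall>r s. 0 < r \<and> r < s \<and> s \<le> R \<longrightarrow> (\<exists>C\<ge>0. maps_bounded n m V exp_op p s r C))"
    using R(1,2) by (intro exI[of _ R]) blast
qed

end

section \<open>Coefficient families and overconvergence\<close>

text \<open>Decay of \<open>K! a\<^sub>K\<close> faster than any geometric series, locally uniformly
  in \<open>z\<close>: overconvergence in the form of Cauchy estimates. As an inequality it passes
  to finite linear combinations without any sum over \<open>K\<close>.\<close>

definition overconvergent_family ::
  "nat \<Rightarrow> (nat \<Rightarrow> complex) set \<Rightarrow> ((nat \<Rightarrow> nat) \<Rightarrow> (nat \<Rightarrow> complex) \<Rightarrow> complex) \<Rightarrow> bool" where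
  "overconvergent_family n V a \<longleftrightarrow>
    (\<forall>K. several_holomorphic_on n V (a K)) \<and>
    (\<forall>p\<in>V. \<forall>\<epsilon>>0. \<exists>r>0. polydisc n p r \<subseteq> V \<and> (\<exists>C\<ge>0. \<forall>K. \<forall>z\<in>polydisc n p r.
       cmod (a K z) * (\<Prod>i<n. fact (K i)) \<le> C * (\<Prod>i<n. \<epsilon> ^ K i)))"

lemma overconvergent_family_zero:
  assumes "open_in_Cspace n V" shows "overconvergent_family n V (\<lambda>_ _. 0)"
  unfolding overconvergent_family_def
proof (intro conjI allI ballI impI several_holomorphic_on_const)
  fix p and \<epsilon> :: real assume "p \<in> V"
  then obtain r where "r > 0" "polydisc n p r \<subseteq> V" using polydisc_subset_open assms by metis
  then show "\<exists>r>0. polydisc n p r \<subseteq> V \<and> (\<exists>C\<ge>0. \<forall>K. \<forall>z\<in>polydisc n p r.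
       cmod 0 * (\<Prod>i<n. fact (K i)) \<le> C * (\<Prod>i<n. \<epsilon> ^ K i))"
    by (intro exI[of _ r] conjI exI[of _ 0]) auto
qed

lemma overconvergent_family_lincomb:
  assumes a: "overconvergent_family n V a" and b: "overconvergent_family n V b"
  shows "overconvergent_family n V (\<lambda>K z. c * a K z + d * b K z)"
  unfolding overconvergent_family_def
proof (intro conjI allI ballI impI)
  show "several_holomorphic_on n V (\<lambda>z. c * a K z + d * b K z)" for K
    using a b by (intro several_holomorphic_intros) (auto simp: overconvergent_family_def)
  fix p and \<epsilon> :: real assume p: "p \<in> V" "\<epsilon> > 0"
  obtain r1 C1 where 1: "r1 > 0" "polydisc n p r1 \<subseteq> V" "C1 \<ge> 0"
    "\<And>K z. z \<in> polydisc n p r1 \<Longrightarrow> cmod (a K z) * (\<Prod>i<n. fact (K i)) \<le> C1 * (\<Prod>i<n. \<epsilon> ^ K i)"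
    using a p unfolding overconvergent_family_def by metis
  obtain r2 C2 where 2: "r2 > 0" "polydisc n p r2 \<subseteq> V" "C2 \<ge> 0"
    "\<And>K z. z \<in> polydisc n p r2 \<Longrightarrow> cmod (b K z) * (\<Prod>i<n. fact (K i)) \<le> C2 * (\<Prod>i<n. \<epsilon> ^ K i)"
    using b p unfolding overconvergent_family_def by metis
  let ?r = "min r1 r2"
  have sub: "polydisc n p ?r \<subseteq> polydisc n p r1" "polydisc n p ?r \<subseteq> polydisc n p r2" by (simp_all add: polydisc_mono)
  have "cmod (c * a K z + d * b K z) * (\<Prod>i<n. fact (K i)) \<le> (cmod c * C1 + cmod d * C2) * (\<Prod>i<n. \<epsilon> ^ K i)"
    if z: "z \<in> polydisc n p ?r" for K z
  proof -
    let ?f = "(\<Prod>i<n. fact (K i)) :: real" and ?e = "\<Prod>i<n. \<epsilon> ^ K i"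
    have "cmod (c * a K z + d * b K z) * ?f \<le> (cmod c * cmod (a K z) + cmod d * cmod (b K z)) * ?f"
      using norm_triangle_ineq[of "c * a K z" "d * b K z"] by (intro mult_right_mono prod_nonneg) (auto simp: norm_mult)
    also have "\<dots> = cmod c * (cmod (a K z) * ?f) + cmod d * (cmod (b K z) * ?f)" by (simp add: algebra_simps)
    also have "\<dots> \<le> cmod c * (C1 * ?e) + cmod d * (C2 * ?e)"
      using 1(4) 2(4) z sub by (intro add_mono mult_left_mono) auto
    finally show ?thesis by (simp add: algebra_simps)
  qed
  moreover have "cmod c * C1 + cmod d * C2 \<ge> 0" using 1 2 by simp
  ultimately show "\<exists>r>0. polydisc n p r \<subseteq> V \<and> (\<exists>C\<ge>0. \<forall>K. \<forall>z\<in>polydisc n p r.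
       cmod (c * a K z + d * b K z) * (\<Prod>i<n. fact (K i)) \<le> C * (\<Prod>i<n. \<epsilon> ^ K i))"
    using 1(1,2) 2(1) sub(1) by (intro exI[of _ ?r]) auto
qed

lemma overconvergent_family_sum:
  assumes "open_in_Cspace n V" "\<And>k. k \<in> S \<Longrightarrow> overconvergent_family n V (a k)"
  shows "overconvergent_family n V (\<lambda>K z. \<Sum>k\<in>S. c k * a k K z)"
  using assms(2)
proof (induction S rule: infinite_finite_induct)
  case (insert k S)
  have "overconvergent_family n V (\<lambda>K z. c k * a k K z + 1 * (\<Sum>k\<in>S. c k * a k K z))"
    using insert by (intro overconvergent_family_lincomb) auto
  then show ?case using insert by simp
qed (auto intro: overconvergent_family_zero assms)

text \<open>For arguments bounded by \<open>B\<close> the choice \<epsilon> = 1 / (2 B) leaves terms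
  of size at most C 2^(-|K|). Summability and, by the M-test on polydiscs in the doubled space,
  holomorphy of the sum follow.\<close>

lemma overconvergent_family_imp_overconvergent:
  assumes V: "open_in_Cspace n V" and a: "overconvergent_family n V a"
  shows "overconvergent n V a"
proof -
  define zp :: "(nat \<Rightarrow> complex) \<Rightarrow> nat \<Rightarrow> complex" where "zp x = (\<lambda>i. if i < n then x i else 0)" for x
  define pp :: "(nat \<Rightarrow> complex) \<Rightarrow> nat \<Rightarrow> complex" where "pp x = (\<lambda>i. if i < n then x (n + i) else 0)" for x
  define U where "U = {x \<in> Cspace (2 * n). zp x \<in> V}"
  let ?t = "overconvergence_term n a"
  have key: "\<exists>r>0. polydisc n z r \<subseteq> V \<and> (\<exists>C\<ge>0. \<forall>K y q. y \<in> polydisc n z r \<and> (\<forall>i<n. cmod (q i) \<le> B) \<longrightarrow>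
      cmod (?t y q K) \<le> C * (\<Prod>i<n. (1/2) ^ K i))" if z: "z \<in> V" and B: "B > 0" for z B
  proof -
    have "1 / (2 * B) > 0" using B by simp
    then obtain r C where r: "r > 0" "polydisc n z r \<subseteq> V" "C \<ge> 0"
      "\<And>K y. y \<in> polydisc n z r \<Longrightarrow> cmod (a K y) * (\<Prod>i<n. fact (K i)) \<le> C * (\<Prod>i<n. (1 / (2 * B)) ^ K i)"
      using a z unfolding overconvergent_family_def by metis
    have "cmod (?t y q K) \<le> C * (\<Prod>i<n. (1/2) ^ K i)"
      if y: "y \<in> polydisc n z r" and q: "\<forall>i<n. cmod (q i) \<le> B" for y q K
    proof -
      have "cmod (?t y q K) = cmod (a K y) * (\<Prod>i<n. fact (K i)) * (\<Prod>i<n. cmod (q i) ^ K i)"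
        by (simp add: overconvergence_term_def norm_mult prod_norm[symmetric] norm_power)
      also have "\<dots> \<le> (C * (\<Prod>i<n. (1 / (2 * B)) ^ K i)) * (\<Prod>i<n. B ^ K i)"
      proof (rule mult_mono)
        show "(\<Prod>i<n. cmod (q i) ^ K i) \<le> (\<Prod>i<n. B ^ K i)"
          using q by (intro prod_mono conjI power_mono) auto
        show "0 \<le> C * (\<Prod>i<n. (1 / (2 * B)) ^ K i)"
          using r(3) B by (intro mult_nonneg_nonneg prod_nonneg) auto
      qed (use r(4)[OF y] in \<open>auto intro: prod_nonneg\<close>)
      also have "\<dots> = C * (\<Prod>i<n. (1/2) ^ K i)"
        using B by (simp add: mult.assoc prod.distrib[symmetric] power_mult_distrib[symmetric])
      finally show ?thesis .
    qed
    then show ?thesis using r by blast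
  qed
  have geo: "(\<lambda>K. C * (\<Prod>i<n. (1/2) ^ K i)) summable_on multi_indices n" for C :: real
    unfolding multi_indices_eq by (intro summable_on_cmult_right geometric_summable_on_indices) auto
  have "?t z q summable_on multi_indices n" if z: "z \<in> V" and q: "q \<in> Cspace n" for z q
  proof -
    define B where "B = 1 + (\<Sum>i<n. cmod (q i))"
    have B: "B > 0" unfolding B_def by (intro add_pos_nonneg sum_nonneg) auto
    have qB: "\<forall>i<n. cmod (q i) \<le> B"
    proof (intro allI impI)
      fix i assume "i < n"
      then have "cmod (q i) \<le> (\<Sum>i<n. cmod (q i))" by (intro member_le_sum) auto
      then show "cmod (q i) \<le> B" by (simp add: B_def)
    qed
    obtain r C where r: "r > 0" "\<forall>K y q. y \<in> polydisc n z r \<and> (\<forall>i<n. cmod (q i) \<le> B) \<longrightarrow>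
      cmod (?t y q K) \<le> C * (\<Prod>i<n. (1/2) ^ K i)" using key[OF z B] by blast
    have "z \<in> polydisc n z r" using z r(1) openin_imp_subset[OF V] by (intro centre_in_polydisc) auto
    then have "cmod (?t z q K) \<le> C * (\<Prod>i<n. (1/2) ^ K i)" for K using r(2) qB by blast
    then have "(\<lambda>K. cmod (?t z q K)) summable_on multi_indices n"
      by (intro Infinite_Sum.abs_summable_on_comparison_test'[OF geo]) auto
    then show ?thesis by (rule Infinite_Sum.abs_summable_summable)
  qed
  moreover have "several_holomorphic_on (2 * n) U (\<lambda>x. \<Sum>\<^sub>\<infinity>K\<in>multi_indices n. ?t (zp x) (pp x) K)"
  proof -
    have zp_cont: "continuous_on A zp" for A
    proof (rule continuous_on_coordinatewise_then_product)
      show "continuous_on A (\<lambda>x. zp x i)" for i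
        by (cases "i < n") (auto simp: zp_def intro: continuous_on_subset[OF continuous_on_product_coordinates])
    qed
    have zpC: "zp x \<in> Cspace n" for x by (simp add: zp_def Cspace_def)
    have U: "open_in_Cspace (2 * n) U"
    proof -
      obtain T where T: "open T" "V = Cspace n \<inter> T" using V unfolding openin_open by blast
      have "open (zp -` T)" using T(1) zp_cont by (rule open_vimage)
      moreover have "U = Cspace (2 * n) \<inter> zp -` T" using T zpC by (auto simp: U_def)
      ultimately show ?thesis by (simp add: openin_open_Int)
    qed
    have aK: "several_holomorphic_on (2 * n) U (\<lambda>x. a K (zp x))" for K
      unfolding several_holomorphic_on_def
    proof (intro conjI ballI allI impI)
      have aKV: "several_holomorphic_on n V (a K)" using a by (simp add: overconvergent_family_def)
      show "continuous_on U (\<lambda>x. a K (zp x))"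
        by (rule continuous_on_compose2[of V "a K", OF _ zp_cont])
          (use aKV in \<open>auto simp: several_holomorphic_on_def U_def\<close>)
      fix x i assume x: "x \<in> U" "i < 2 * n"
      show "(\<lambda>w. a K (zp (x(i := w)))) field_differentiable at (x i)"
      proof (cases "i < n")
        case True
        have "(\<lambda>w. a K ((zp x)(i := w))) field_differentiable at (zp x i)"
          using aKV x True unfolding several_holomorphic_on_def U_def by blast
        moreover have "zp (x(i := w)) = (zp x)(i := w)" for w using True by (auto simp: zp_def)
        ultimately show ?thesis using True by (simp add: zp_def)
      next
        case False
        then have "zp (x(i := w)) = zp x" for w by (auto simp: zp_def)
        then show ?thesis by simp
      qed
    qed
    have pp_hol: "several_holomorphic_on (2 * n) A (\<lambda>x. pp x i)" for A i
      by (cases "i < n") (auto simp: pp_def intro: several_holomorphic_on_coordinate several_holomorphic_on_const)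
    have term_hol: "several_holomorphic_on (2 * n) U (\<lambda>x. ?t (zp x) (pp x) K)" for K
      unfolding overconvergence_term_def by (intro several_holomorphic_intros aK pp_hol)
    show ?thesis
    proof (rule several_holomorphic_on_uniform_limit[OF U finite_subsets_at_top_neq_bot[of "multi_indices n"]])
      fix x assume x: "x \<in> U"
      \<comment> \<open>The sum dominates every coordinate, and the added 1 leaves room for points
        at distance below 1 from \<open>x\<close>.\<close>
      define B where "B = 1 + (\<Sum>i<n. cmod (pp x i))"
      have B: "B > 0" unfolding B_def by (intro add_pos_nonneg sum_nonneg) auto
      have zx: "zp x \<in> V" using x by (simp add: U_def)
      obtain r C where r: "r > 0" "\<And>K y q. y \<in> polydisc n (zp x) r \<and> (\<forall>i<n. cmod (q i) \<le> B) \<Longrightarrow>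
        cmod (?t y q K) \<le> C * (\<Prod>i<n. (1/2) ^ K i)" using key[OF zx B] by blast
      obtain \<delta>' where \<delta>': "\<delta>' > 0" "polydisc (2 * n) x \<delta>' \<subseteq> U" using polydisc_subset_open[OF U x] .
      define \<delta> where "\<delta> = min \<delta>' (min r 1)"
      have \<delta>: "\<delta> > 0" "\<delta> \<le> r" "\<delta> \<le> 1" using \<delta>' r by (auto simp: \<delta>_def)
      have \<delta>U: "polydisc (2 * n) x \<delta> \<subseteq> U" using \<delta>'(2) polydisc_mono[of \<delta> \<delta>' "2 * n" x] by (auto simp: \<delta>_def)
      have bd: "cmod (?t (zp y) (pp y) K) \<le> C * (\<Prod>i<n. (1/2) ^ K i)" if y: "y \<in> polydisc (2 * n) x \<delta>" for y K
      proof (rule r(2), intro conjI allI impI)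
        have "dist (x i) (y i) < r" if "i < n" for i
        proof -
          have "dist (x i) (y i) < \<delta>" using y that by (simp add: polydisc_def)
          then show ?thesis using \<delta>(2) by linarith
        qed
        then show "zp y \<in> polydisc n (zp x) r" by (auto simp: polydisc_def zp_def Cspace_def)
        fix i assume i: "i < n"
        then have "dist (x (n + i)) (y (n + i)) < \<delta>" using y by (simp add: polydisc_def)
        then have "dist (x (n + i)) (y (n + i)) < 1" using \<delta>(3) by linarith
        then have "cmod (pp y i) \<le> cmod (pp x i) + 1"
          using i norm_triangle_ineq3[of "y (n + i)" "x (n + i)"] by (auto simp: pp_def dist_norm norm_minus_commute)
        also have "cmod (pp x i) \<le> (\<Sum>i<n. cmod (pp x i))" using i by (intro member_le_sum) auto
        finally show "cmod (pp y i) \<le> B" by (simp add: B_def)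
      qed
      have "uniform_limit (polydisc (2 * n) x \<delta>) (\<lambda>S y. \<Sum>K\<in>S. ?t (zp y) (pp y) K)
          (\<lambda>y. \<Sum>\<^sub>\<infinity>K\<in>multi_indices n. ?t (zp y) (pp y) K) (finite_subsets_at_top (multi_indices n))"
        by (rule Weierstrass_m_test_general[OF bd geo])
      moreover have "several_holomorphic_on (2 * n) (polydisc (2 * n) x \<delta>) (\<lambda>y. \<Sum>K\<in>S. ?t (zp y) (pp y) K)" for S
        by (intro several_holomorphic_on_sum several_holomorphic_on_subset[OF term_hol \<delta>U])
      ultimately show "\<exists>r>0. polydisc (2 * n) x r \<subseteq> U \<and>
          (\<exists>f. (\<forall>\<^sub>F S in finite_subsets_at_top (multi_indices n). several_holomorphic_on (2 * n) (polydisc (2 * n) x r) (f S)) \<and>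
          uniform_limit (polydisc (2 * n) x r) f (\<lambda>x. \<Sum>\<^sub>\<infinity>K\<in>multi_indices n. ?t (zp x) (pp x) K) (finite_subsets_at_top (multi_indices n)))"
        using \<delta>(1) \<delta>U
        by (intro exI[of _ \<delta>] conjI exI[of _ "\<lambda>S y. \<Sum>K\<in>S. ?t (zp y) (pp y) K"] always_eventually allI)
    qed
  qed
  ultimately show ?thesis
    unfolding overconvergent_def Let_def U_def zp_def pp_def by blast
qed

section \<open>The symbol of a bounded operator\<close>

context bounded_superdomain_operator
begin

text \<open>The coefficient of \<open>\<partial>\<^sub>z\<^sup>K\<close> in the matrix entry from
  \<open>\<xi>\<^sup>M\<close> to \<open>\<xi>\<^sup>L\<close>: applying a differential operator to
  \<open>(y - z)\<^sup>K / K!\<close> and evaluating at \<open>y = z\<close> retains exactly this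
  coefficient.\<close>

definition unit_coeff :: "nat set \<Rightarrow> nat set \<Rightarrow> (nat \<Rightarrow> nat) \<Rightarrow> (nat \<Rightarrow> complex) \<Rightarrow> complex" where
  "unit_coeff L M K z = P V (smono V M (\<lambda>y. \<Prod>i<n. (y i - z i) ^ K i)) L z / (\<Prod>i<n. fact (K i))"

text \<open>The test function moves with the point of evaluation, so holomorphy of a single image
  under \<open>P\<close> is not enough. One factor \<open>y j - z j\<close> is split:
  \<open>y j\<close> goes into \<open>a\<close>, \<open>z j\<close> comes out by linearity, and the
  degree drops.\<close>

lemma holomorphic_at_moving_centre:
  assumes M: "M \<subseteq> {..<m}"
  shows "several_holomorphic_on n V a \<Longrightarrow>
    several_holomorphic_on n V (\<lambda>z. P V (smono V M (\<lambda>y. a y * (\<Prod>i<n. (y i - z i) ^ K i))) L z)"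
proof (induction "\<Sum>i<n. K i" arbitrary: K a)
  case 0
  then have "(\<lambda>y. a y * (\<Prod>i<n. (y i - z i) ^ K i)) = a" for z by (simp add: fun_eq_iff)
  then show ?case
    using superfunsD(1)[OF closed[OF open_V order_refl smono_in_superfuns[OF open_V 0(2) M]]] by simp
next
  case (Suc d)
  from Suc.hyps(2) have "(\<Sum>i<n. K i) \<noteq> 0" by linarith
  then have "\<exists>j\<in>{..<n}. K j \<noteq> 0" by (metis sum.neutral)
  then obtain j where j: "j < n" "K j \<noteq> 0" by blast
  define K' where "K' = K(j := K j - 1)"
  have split: "(\<Sum>i<n. h i) = h j + (\<Sum>i\<in>{..<n} - {j}. h i)" for h :: "nat \<Rightarrow> nat"
    using j by (subst sum.remove[of _ j]) auto
  have "(\<Sum>i<n. K' i) = (K j - 1) + (\<Sum>i\<in>{..<n} - {j}. K i)"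
    unfolding split[of K'] by (simp add: K'_def)
  then have d: "d = (\<Sum>i<n. K' i)" using Suc.hyps(2) split[of K] j by simp
  have pr: "(\<Prod>i<n. (y i - z i) ^ K i) = (y j - z j) * (\<Prod>i<n. (y i - z i) ^ K' i)" for y z :: "nat \<Rightarrow> complex"
  proof -
    have "(\<Prod>i<n. (y i - z i) ^ k i) = (y j - z j) ^ k j * (\<Prod>i\<in>{..<n} - {j}. (y i - z i) ^ k i)" for k
      using j by (subst prod.remove[of _ j]) auto
    from this[of K] this[of K'] show ?thesis using j by (simp add: K'_def power_eq_if[of _ "K j"])
  qed
  have s: "smono V M (\<lambda>y. b y * (\<Prod>i<n. (y i - z i) ^ K' i)) \<in> superfuns n m V"
    if "several_holomorphic_on n V b" for b z
    using that by (intro smono_in_superfuns open_V M several_holomorphic_intros)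
  have aj: "several_holomorphic_on n V (\<lambda>y. a y * y j)" using Suc.prems by (intro several_holomorphic_intros)
  have "P V (smono V M (\<lambda>y. a y * (\<Prod>i<n. (y i - z i) ^ K i))) L z =
      P V (smono V M (\<lambda>y. (a y * y j) * (\<Prod>i<n. (y i - z i) ^ K' i))) L z -
      z j * P V (smono V M (\<lambda>y. a y * (\<Prod>i<n. (y i - z i) ^ K' i))) L z" for z
  proof -
    let ?A = "smono V M (\<lambda>y. (a y * y j) * (\<Prod>i<n. (y i - z i) ^ K' i))"
    let ?B = "smono V M (\<lambda>y. a y * (\<Prod>i<n. (y i - z i) ^ K' i))"
    have 1: "smono V M (\<lambda>y. a y * (\<Prod>i<n. (y i - z i) ^ K i)) = (\<lambda>I y. ?A I y + (- z j) * ?B I y)"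
      unfolding pr by (auto simp: smono_apply fun_eq_iff algebra_simps)
    have 2: "P V (\<lambda>I y. ?A I y + (- z j) * ?B I y) = (\<lambda>I y. P V ?A I y + P V (\<lambda>I y. (- z j) * ?B I y) I y)"
      by (rule add[OF open_V order_refl s[OF aj] superfuns_smult[OF s[OF Suc.prems]]])
    have 3: "P V (\<lambda>I y. (- z j) * ?B I y) = (\<lambda>I y. (- z j) * P V ?B I y)"
      by (rule smult[OF open_V order_refl s[OF Suc.prems]])
    show ?thesis unfolding 1 2 3 by simp
  qed
  then show ?case
    using Suc.hyps(1)[OF d Suc.prems] Suc.hyps(1)[OF d aj]
    by (simp only:) (intro several_holomorphic_intros)
qed

lemma overconvergent_family_unit_coeff:
  assumes M: "M \<subseteq> {..<m}" and L: "L \<subseteq> {..<m}"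
  shows "overconvergent_family n V (unit_coeff L M)"
  unfolding overconvergent_family_def
proof (intro conjI allI ballI impI)
  show "several_holomorphic_on n V (unit_coeff L M K)" for K
    using holomorphic_at_moving_centre[OF M several_holomorphic_on_const[of n V 1], of K L]
    unfolding unit_coeff_def by (intro several_holomorphic_on_divide several_holomorphic_on_const) auto
  fix p and \<epsilon> :: real assume p: "p \<in> V" and \<epsilon>: "\<epsilon> > 0"
  obtain R where R: "R > 0" "polydisc n p R \<subseteq> V"
    "\<And>r s. 0 < r \<and> r < s \<and> s \<le> R \<Longrightarrow> (\<exists>C\<ge>0. maps_bounded n m V P p s r C)"
    using bounded[OF p] by blast
  \<comment> \<open>For \<open>y\<close> in radius \<open>s\<close> and \<open>z\<close> in radius
    s/2 the coordinates differ by less than 3 s / 2, hence by at most \<epsilon>.\<close>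
  define s where "s = min R (\<epsilon> / 2)"
  have s: "s > 0" "s \<le> R" "s \<le> \<epsilon> / 2" "0 < s/2 \<and> s/2 < s \<and> s \<le> R" using R(1) \<epsilon> by (auto simp: s_def)
  obtain C where C: "C \<ge> 0" "maps_bounded n m V P p s (s/2) C"
    using R(3)[OF s(4)] by blast
  have sV: "polydisc n p s \<subseteq> V" using R(2) polydisc_mono[OF s(2), of n p] by blast
  have "cmod (unit_coeff L M K z) * (\<Prod>i<n. fact (K i)) \<le> C * (\<Prod>i<n. \<epsilon> ^ K i)"
    if z: "z \<in> polydisc n p (s/2)" for K z
  proof -
    let ?F = "smono V M (\<lambda>y. \<Prod>i<n. (y i - z i) ^ K i)"
    have "bounded_on m (polydisc n p s) ?F (\<Prod>i<n. \<epsilon> ^ K i)"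
      unfolding bounded_on_def
    proof (intro allI impI ballI)
      fix I y assume y: "y \<in> polydisc n p s"
      have "cmod (y i - z i) \<le> \<epsilon>" if "i < n" for i
      proof -
        have "dist (p i) (y i) < s" "dist (p i) (z i) < s/2" using y z that by (auto simp: polydisc_def)
        then have "dist (y i) (z i) < s + s/2" using dist_triangle[of "y i" "z i" "p i"] by (simp add: dist_commute)
        then show ?thesis using s by (simp add: dist_norm)
      qed
      then have "(\<Prod>i<n. cmod (y i - z i) ^ K i) \<le> (\<Prod>i<n. \<epsilon> ^ K i)"
        by (intro prod_mono conjI power_mono) auto
      moreover have "0 \<le> (\<Prod>i<n. \<epsilon> ^ K i)" using \<epsilon> by (intro prod_nonneg) auto
      ultimately show "cmod (?F I y) \<le> (\<Prod>i<n. \<epsilon> ^ K i)"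
        by (auto simp: smono_apply prod_norm[symmetric] norm_power)
    qed
    moreover have "?F \<in> superfuns n m V" by (intro smono_in_superfuns open_V M several_holomorphic_intros)
    ultimately have "cmod (P V ?F L z) \<le> C * (\<Prod>i<n. \<epsilon> ^ K i)"
      using maps_boundedD[OF C(2) open_V order_refl sV] L z unfolding bounded_on_def[of m "polydisc n p (s/2)"] by blast
    then show ?thesis by (simp add: unit_coeff_def norm_divide prod_norm[symmetric])
  qed
  moreover have "polydisc n p (s/2) \<subseteq> V" using sV polydisc_mono[of "s/2" s n p] s by auto
  ultimately show "\<exists>r>0. polydisc n p r \<subseteq> V \<and> (\<exists>C\<ge>0. \<forall>K. \<forall>z\<in>polydisc n p r.
       cmod (unit_coeff L M K z) * (\<Prod>i<n. fact (K i)) \<le> C * (\<Prod>i<n. \<epsilon> ^ K i))"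
    using s(4) C(1) by (intro exI[of _ "s/2"]) blast
qed

text \<open>Linearity gives the identity for Taylor polynomials only. The remainder tends to 0
  uniformly on radius \<open>s\<close>, and boundedness of \<open>P\<close> from \<open>s\<close> to
  s/2 carries this to the value at \<open>z\<close>.\<close>

lemma has_sum_smono:
  assumes W: "open_in_Cspace n W" "W \<subseteq> V" and f: "several_holomorphic_on n W f"
    and M: "M \<subseteq> {..<m}" and L: "L \<subseteq> {..<m}" and z: "z \<in> W"
  shows "((\<lambda>K. unit_coeff L M K z * multi_partial [0..<n] K f z) has_sum P W (smono W M f) L z) (multi_indices n)"
proof -
  have zC: "z \<in> Cspace n" using z openin_imp_subset[OF W(1)] by auto
  have zV: "z \<in> V" using z W by auto
  obtain \<rho> B where \<rho>: "\<rho> > 0" "polydisc n z \<rho> \<subseteq> W" "B > 0" "\<And>y. y \<in> polydisc n z \<rho> \<Longrightarrow> cmod (f y) \<le> B"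
    using several_holomorphic_on_locally_bounded[OF f W(1) z] by metis
  have f\<rho>: "several_holomorphic_on n (polydisc n z \<rho>) f" by (rule several_holomorphic_on_subset[OF f \<rho>(2)])
  obtain R where R: "R > 0" "polydisc n z R \<subseteq> V"
    "\<And>r s. 0 < r \<and> r < s \<and> s \<le> R \<Longrightarrow> (\<exists>C\<ge>0. maps_bounded n m V P z s r C)"
    using bounded[OF zV] by blast
  \<comment> \<open>At most half of \<rho>, so the Taylor terms are dominated by a geometric series
    of ratio 1/2.\<close>
  define s where "s = min R (\<rho> / 2)"
  have s: "s > 0" "s \<le> R" "s \<le> \<rho> / 2" "0 < s/2 \<and> s/2 < s \<and> s \<le> R" using R(1) \<rho>(1) by (auto simp: s_def)
  obtain C where C: "C \<ge> 0" "maps_bounded n m V P z s (s/2) C"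
    using R(3)[OF s(4)] by blast
  have s\<rho>: "polydisc n z s \<subseteq> polydisc n z \<rho>" using s(3) \<rho>(1) by (intro polydisc_mono) auto
  define c where "c K = multi_partial [0..<n] K f z / (\<Prod>i<n. fact (K i))" for K
  let ?x = "\<lambda>K y. \<Prod>i<n. (y i - z i) ^ K i"
  have tay: "((\<lambda>K. c K * ?x K y) has_sum f y) (multi_indices n)" if "y \<in> polydisc n z \<rho>" for y
    using taylor[OF f\<rho> zC \<rho>(1,4) that] by (simp add: c_def prod_dividef)
  have tb: "cmod (c K * ?x K y) \<le> B * (\<Prod>i<n. (1/2) ^ K i)" if y: "y \<in> polydisc n z s" for K y
  proof -
    have "cmod (multi_partial [0..<n] K f z) \<le> B * (\<Prod>i<n. fact (K i) / \<rho> ^ K i)"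
      by (rule multi_partial_bound[OF f\<rho> zC \<rho>(1,4)])
    moreover have pos: "(\<Prod>i<n. fact (K i) :: real) > 0" by (intro prod_pos) auto
    moreover have "(\<Prod>i<n. \<rho> ^ K i) > 0" using \<rho>(1) by (intro prod_pos) auto
    ultimately have "cmod (c K) \<le> B * (\<Prod>i<n. 1 / \<rho> ^ K i)"
      by (simp add: c_def norm_divide prod_norm[symmetric] prod_dividef pos_divide_le_eq pos_le_divide_eq mult_ac)
    moreover have "cmod (?x K y) \<le> (\<Prod>i<n. (\<rho> / 2) ^ K i)"
      unfolding prod_norm[symmetric] norm_power
    proof (intro prod_mono conjI power_mono)
      fix i assume "i \<in> {..<n}"
      then have "dist (z i) (y i) < s" using y by (auto simp: polydisc_def)
      then show "cmod (y i - z i) \<le> \<rho> / 2" using s(3) by (simp add: dist_norm norm_minus_commute)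
    qed auto
    ultimately have "cmod (c K * ?x K y) \<le> (B * (\<Prod>i<n. 1 / \<rho> ^ K i)) * (\<Prod>i<n. (\<rho> / 2) ^ K i)"
      unfolding norm_mult using \<rho> by (intro mult_mono mult_nonneg_nonneg prod_nonneg) auto
    also have "\<dots> = B * (\<Prod>i<n. (1/2) ^ K i)"
      using \<rho>(1) by (simp add: mult.assoc prod.distrib[symmetric] power_divide)
    finally show ?thesis .
  qed
  have lim: "uniform_limit (polydisc n z s) (\<lambda>S y. \<Sum>K\<in>S. c K * ?x K y) f (finite_subsets_at_top (multi_indices n))"
  proof (rule Weierstrass_m_test_general'[where M = "\<lambda>K. B * (\<Prod>i<n. (1/2) ^ K i)"])
    show "(\<lambda>K. B * (\<Prod>i<n. (1/2) ^ K i)) summable_on multi_indices n"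
      unfolding multi_indices_eq by (intro summable_on_cmult_right geometric_summable_on_indices) auto
  qed (use tb tay s\<rho> in auto)
  have mf: "smono W M f \<in> superfuns n m W" by (intro smono_in_superfuns W f M)
  have mx: "smono U M (?x K) \<in> superfuns n m U" if "open_in_Cspace n U" for K U
    by (intro smono_in_superfuns that M several_holomorphic_intros)
  have uc: "unit_coeff L M K z * multi_partial [0..<n] K f z = c K * P W (smono W M (?x K)) L z" for K
  proof -
    have "smono W M (?x K) = superfun_restrict W (smono V M (?x K))"
      using W by (auto simp: superfun_restrict_def superfun_monom_def fun_eq_iff)
    then have "P V (smono V M (?x K)) L z = P W (smono W M (?x K)) L z"
      using restrict_at[OF open_V W(1) W(2) order_refl mx[OF open_V] z] by simp
    then show ?thesis by (simp add: unit_coeff_def c_def)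
  qed
  have "((\<lambda>S. \<Sum>K\<in>S. unit_coeff L M K z * multi_partial [0..<n] K f z) \<longlongrightarrow> P W (smono W M f) L z)
      (finite_subsets_at_top (multi_indices n))"
  proof (rule tendstoI)
    fix e :: real assume e: "e > 0"
    \<comment> \<open>\<open>C\<close> may be 0, hence the denominator C + 1.\<close>
    define e' where "e' = e / (C + 1)"
    have e': "e' > 0" using e C(1) by (simp add: e'_def)
    have Ce: "C * e' < e" using e C(1) by (simp add: e'_def divide_simps)
    have ev: "\<forall>\<^sub>F S in finite_subsets_at_top (multi_indices n). \<forall>y\<in>polydisc n z s. dist (\<Sum>K\<in>S. c K * ?x K y) (f y) < e'"
      using lim e' by (simp add: uniform_limit_iff)
    have fin: "\<forall>\<^sub>F S in finite_subsets_at_top (multi_indices n). finite S"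
      by (rule eventually_finite_subsets_at_top_weakI) auto
    show "\<forall>\<^sub>F S in finite_subsets_at_top (multi_indices n).
        dist (\<Sum>K\<in>S. unit_coeff L M K z * multi_partial [0..<n] K f z) (P W (smono W M f) L z) < e"
      using ev fin
    proof eventually_elim
      case (elim S)
      let ?T = "\<lambda>I y. \<Sum>K\<in>S. c K * smono W M (?x K) I y"
      let ?G = "\<lambda>I y. ?T I y + (- 1) * smono W M f I y"
      have T: "?T \<in> superfuns n m W" by (intro superfuns_sum superfuns_smult mx W)
      have G: "?G \<in> superfuns n m W" by (intro superfuns_add T superfuns_smult mf)
      have "bounded_on m (polydisc n z s) ?G e'"
        unfolding bounded_on_def
      proof (intro allI impI ballI)
        fix I y assume y: "y \<in> polydisc n z s"
        have yW: "y \<in> W" using y s\<rho> \<rho>(2) by blast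
        show "cmod (?G I y) \<le> e'"
        proof (cases "I = M")
          case True
          then show ?thesis using elim(1) y yW by (auto simp: smono_apply dist_norm less_imp_le)
        next
          case False
          then show ?thesis using e' by (simp add: smono_apply)
        qed
      qed
      then have "bounded_on m (polydisc n z (s/2)) (P W ?G) (C * e')"
        using s\<rho> \<rho>(2) by (intro maps_boundedD[OF C(2) W _ G]) auto
      moreover have "z \<in> polydisc n z (s/2)" using zC s(1) by (intro centre_in_polydisc) auto
      ultimately have "cmod (P W ?G L z) \<le> C * e'"
        using L unfolding bounded_on_def by blast
      moreover have "P W ?G = (\<lambda>I y. P W ?T I y + P W (\<lambda>I y. (- 1) * smono W M f I y) I y)"
        by (intro add W T superfuns_smult mf)
      moreover have "P W (\<lambda>I y. (- 1) * smono W M f I y) = (\<lambda>I y. (- 1) * P W (smono W M f) I y)"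
        by (intro smult W mf)
      moreover have "P W ?T = (\<lambda>I y. \<Sum>K\<in>S. P W (\<lambda>I y. c K * smono W M (?x K) I y) I y)"
        by (intro sum W elim superfuns_smult mx)
      moreover have "P W (\<lambda>I y. c K * smono W M (?x K) I y) = (\<lambda>I y. c K * P W (smono W M (?x K)) I y)" for K
        by (intro smult W mx)
      ultimately have "cmod ((\<Sum>K\<in>S. c K * P W (smono W M (?x K)) L z) - P W (smono W M f) L z) \<le> C * e'"
        by simp
      then show ?case using Ce by (simp add: uc dist_norm)
    qed
  qed
  then show ?thesis by (simp add: has_sum_def)
qed

end

section \<open>From matrix units to \<open>\<xi>\<^sup>I \<partial>\<^sub>\<xi>\<^sup>J\<close>\<close>

lemma foldr_even_partial:
  "foldr (\<lambda>i. even_partial i ^^ K i) is F I = multi_partial is K (F I)"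
proof -
  have pow: "(even_partial i ^^ k) G I = (cpartial i ^^ k) (G I)" for i k G
    by (induction k) (simp_all add: even_partial_def cpartial_def)
  show ?thesis by (induction "is") (simp_all add: pow)
qed

text \<open>The sign is recorded only as a constant of modulus 1: solving the linear system for the
  coefficients needs no more than that it is nonzero.\<close>

lemma foldr_odd_partial:
  "distinct js \<Longrightarrow> \<exists>c. cmod c = 1 \<and>
    (\<forall>G z. foldr odd_partial js G S z = (if set js \<inter> S = {} then c * G (set js \<union> S) z else 0))"
proof (induction js arbitrary: S)
  case Nil
  then show ?case by (intro exI[of _ 1]) simp
next
  case (Cons j js)
  then have "distinct js" by simp
  from Cons.IH[OF this, of "insert j S"] obtain c where c: "cmod c = 1"
    "\<forall>G z. foldr odd_partial js G (insert j S) z =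
      (if set js \<inter> insert j S = {} then c * G (set js \<union> insert j S) z else 0)" by (elim exE conjE)
  let ?e = "(- 1) ^ card {i \<in> S. i < j} :: complex"
  show ?case
  proof (intro exI[of _ "?e * c"] conjI allI)
    show "cmod (?e * c) = 1" using c(1) by (simp add: norm_mult norm_power)
    fix G z
    have "foldr odd_partial (j # js) G S z = (if j \<in> S then 0 else ?e * foldr odd_partial js G (insert j S) z)"
      by (simp add: odd_partial_def)
    then show "foldr odd_partial (j # js) G S z =
        (if set (j # js) \<inter> S = {} then ?e * c * G (set (j # js) \<union> S) z else 0)"
      using Cons.prems by (auto simp: c(2))
  qed
qed

text \<open>With \<open>S = L - I\<close>, the operator moves the component of index
  \<open>J \<union> S\<close> to the index \<open>L = I \<union> S\<close>, up to sign. The constant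
  is nonzero for indices out of range too, so that it can be chosen for all \<open>I\<close>,
  \<open>J\<close>, \<open>L\<close> at once.\<close>

lemma diff_op_term_sign:
  "\<exists>c. c \<noteq> 0 \<and> (L \<subseteq> {..<m} \<longrightarrow> J \<subseteq> {..<m} \<longrightarrow> (\<forall>a K F z. diff_op_term n a I J K F L z =
    (if I \<subseteq> L \<and> J \<inter> (L - I) = {} then c * a z * multi_partial [0..<n] K (F (J \<union> (L - I))) z else 0)))"
proof (cases "L \<subseteq> {..<m} \<and> J \<subseteq> {..<m}")
  case True
  then have fin: "finite L" "finite J" using finite_odd_index by auto
  from foldr_odd_partial[OF distinct_sorted_list_of_set[of J], of "L - I"]
  obtain c where c: "cmod c = 1" "\<forall>G z. foldr odd_partial (sorted_list_of_set J) G (L - I) z =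
      (if J \<inter> (L - I) = {} then c * G (J \<union> (L - I)) z else 0)"
    unfolding set_sorted_list_of_set[OF fin(2)] by (elim exE conjE)
  have "diff_op_term n a I J K F L z =
      (if I \<subseteq> L \<and> J \<inter> (L - I) = {} then (shuffle_sign I (L - I) * c) * a z * multi_partial [0..<n] K (F (J \<union> (L - I))) z else 0)"
    for a K F z
  proof -
    have "superfun_mult (superfun_monom I a) G L z = superfun_mult (smono UNIV I a) G L z" for G
      by (simp add: superfun_restrict_def)
    then show ?thesis
      unfolding diff_op_term_def by (simp add: superfun_mult_smono_left[OF fin(1)] c(2) foldr_even_partial)
  qed
  moreover have "cmod (shuffle_sign I (L - I) * c) = 1" using c(1) by (simp add: norm_mult)
  then have "shuffle_sign I (L - I) * c \<noteq> 0" by (metis norm_zero zero_neq_one)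
  ultimately show ?thesis by (intro exI[of _ "shuffle_sign I (L - I) * c"]) simp
qed (auto intro!: exI[of _ 1])

text \<open>
  The operators \<open>\<xi>\<^sup>I \<partial>\<^sub>\<xi>\<^sup>J\<close> are, up to signs, unitriangular combinations of the matrix units
  \<open>\<xi>\<^sup>M \<mapsto> \<xi>\<^sup>L\<close>: the one for \<open>(I, J)\<close> involves the units \<open>(I \<union> S, J \<union> S)\<close>.  The system is
  solved by recursion on the cardinality of \<open>I\<close>.
\<close>

lemma triangular_system:
  fixes \<sigma> :: "nat set \<Rightarrow> nat set \<Rightarrow> nat set \<Rightarrow> complex"
  assumes V: "open_in_Cspace n V"
    and \<sigma>: "\<And>I J L. \<sigma> I J L \<noteq> 0"
    and c: "\<And>L M. L \<subseteq> {..<m} \<Longrightarrow> M \<subseteq> {..<m} \<Longrightarrow> overconvergent_family n V (c L M)"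
  shows "\<exists>a. (\<forall>I J. I \<subseteq> {..<m} \<longrightarrow> J \<subseteq> {..<m} \<longrightarrow> overconvergent_family n V (a I J)) \<and>
    (\<forall>L M K z. L \<subseteq> {..<m} \<longrightarrow> M \<subseteq> {..<m} \<longrightarrow>
      (\<Sum>S\<in>Pow (L \<inter> M). \<sigma> (L - S) (M - S) L * a (L - S) (M - S) K z) = c L M K z)"
proof -
  have "\<exists>a. (\<forall>I J. I \<subseteq> {..<m} \<longrightarrow> J \<subseteq> {..<m} \<longrightarrow> overconvergent_family n V (a I J)) \<and>
    (\<forall>L M K z. L \<subseteq> {..<m} \<longrightarrow> M \<subseteq> {..<m} \<longrightarrow> card L < d \<longrightarrow>
      (\<Sum>S\<in>Pow (L \<inter> M). \<sigma> (L - S) (M - S) L * a (L - S) (M - S) K z) = c L M K z)" for d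
  proof (induction d)
    case 0
    then show ?case using overconvergent_family_zero[OF V] by (intro exI[of _ "\<lambda>_ _ _ _. 0"]) auto
  next
    case (Suc d)
    then obtain a where a': "\<forall>I J. I \<subseteq> {..<m} \<longrightarrow> J \<subseteq> {..<m} \<longrightarrow> overconvergent_family n V (a I J)"
      "\<forall>L M K z. L \<subseteq> {..<m} \<longrightarrow> M \<subseteq> {..<m} \<longrightarrow> card L < d \<longrightarrow>
        (\<Sum>S\<in>Pow (L \<inter> M). \<sigma> (L - S) (M - S) L * a (L - S) (M - S) K z) = c L M K z"
      by (elim exE conjE)
    note a = a'[rule_format]
    let ?r = "\<lambda>L M K z. \<Sum>S\<in>Pow (L \<inter> M) - {{}}. \<sigma> (L - S) (M - S) L * a (L - S) (M - S) K z"
    \<comment> \<open>The summand of \<open>S = {}\<close> contains the unknown itself. In all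
      others the first index has smaller cardinality, so they are already known and the equation is
      solved for that one summand.\<close>
    define b where "b L M = (if card L = d then (\<lambda>K z. (1 / \<sigma> L M L) * c L M K z + (- 1 / \<sigma> L M L) * ?r L M K z) else a L M)" for L M
    have "overconvergent_family n V (b I J)" if IJ: "I \<subseteq> {..<m}" "J \<subseteq> {..<m}" for I J
    proof (cases "card I = d")
      case True
      have "overconvergent_family n V (?r I J)"
        by (intro overconvergent_family_sum V a(1)) (use IJ in auto)
      then have "overconvergent_family n V (\<lambda>K z. (1 / \<sigma> I J I) * c I J K z + (- 1 / \<sigma> I J I) * ?r I J K z)"
        by (intro overconvergent_family_lincomb c IJ)
      moreover have "b I J = (\<lambda>K z. (1 / \<sigma> I J I) * c I J K z + (- 1 / \<sigma> I J I) * ?r I J K z)"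
        using True by (simp only: b_def if_True refl)
      ultimately show ?thesis by (simp only:)
    qed (use a IJ in \<open>simp add: b_def\<close>)
    moreover have "(\<Sum>S\<in>Pow (L \<inter> M). \<sigma> (L - S) (M - S) L * b (L - S) (M - S) K z) = c L M K z"
      if LM: "L \<subseteq> {..<m}" "M \<subseteq> {..<m}" "card L < Suc d" for L M K z
    proof -
      have fin: "finite L" by (rule finite_odd_index[OF LM(1)])
      have cl: "card (L - S) < card L" if S: "S \<in> Pow (L \<inter> M) - {{}}" for S
        using S fin by (intro psubset_card_mono) auto
      have "(\<Sum>S\<in>Pow (L \<inter> M). h S) = h {} + (\<Sum>S\<in>Pow (L \<inter> M) - {{}}. h S)" for h :: "nat set \<Rightarrow> complex"
        using fin by (subst sum.remove[of _ "{}"]) auto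
      note split = this
      have b': "b (L - S) (M - S) = a (L - S) (M - S)" if "S \<in> Pow (L \<inter> M) - {{}}" for S
        using cl[OF that] LM(3) by (simp add: b_def)
      have "(\<Sum>S\<in>Pow (L \<inter> M). \<sigma> (L - S) (M - S) L * b (L - S) (M - S) K z) = \<sigma> L M L * b L M K z + ?r L M K z"
        unfolding split using b' by simp
      also have "\<dots> = c L M K z"
      proof (cases "card L = d")
        case True
        then show ?thesis using \<sigma>[of L M L] by (simp add: b_def field_simps)
      next
        case False
        then show ?thesis using a(2)[of L M K z] LM unfolding split by (simp add: b_def)
      qed
      finally show ?thesis .
    qed
    ultimately show ?case by (intro exI[of _ b]) blast
  qed
  \<comment> \<open>No subset of \<open>{..<m}\<close> has more than \<open>m\<close> elements, so
    stage \<open>Suc m\<close> reaches every equation.\<close>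
  from this[of "Suc m"] obtain a where
    a: "\<forall>I J. I \<subseteq> {..<m} \<longrightarrow> J \<subseteq> {..<m} \<longrightarrow> overconvergent_family n V (a I J)"
    "\<forall>L M K z. L \<subseteq> {..<m} \<longrightarrow> M \<subseteq> {..<m} \<longrightarrow> card L < Suc m \<longrightarrow>
      (\<Sum>S\<in>Pow (L \<inter> M). \<sigma> (L - S) (M - S) L * a (L - S) (M - S) K z) = c L M K z"
    by (elim exE conjE)
  have "card L < Suc m" if "L \<subseteq> {..<m}" for L using card_mono[OF _ that] by simp
  then have "(\<Sum>S\<in>Pow (L \<inter> M). \<sigma> (L - S) (M - S) L * a (L - S) (M - S) K z) = c L M K z"
    if "L \<subseteq> {..<m}" "M \<subseteq> {..<m}" for L M K z
    using a(2)[rule_format, OF that] that(1) by simp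
  then show ?thesis using a(1) by (intro exI[of _ a] conjI) simp_all
qed

section \<open>Unordered sums and the complete symbol\<close>

lemma has_sum_finite_Times:
  fixes f :: "'a \<Rightarrow> 'b \<Rightarrow> 'c::{topological_comm_monoid_add, t2_space}"
  assumes "finite A" "\<And>x. x \<in> A \<Longrightarrow> (f x has_sum g x) B"
  shows "((\<lambda>(x, y). f x y) has_sum (\<Sum>x\<in>A. g x)) (A \<times> B)"
  using assms
proof (induction A)
  case (insert x A)
  have "((\<lambda>(x, y). f x y) has_sum g x) ({x} \<times> B)"
  proof -
    have "Pair x ` B = {x} \<times> B" by auto
    then show ?thesis
      using has_sum_reindex[of "Pair x" B "\<lambda>(x, y). f x y" "g x"] insert.prems
      by (simp add: inj_on_def o_def)
  qed
  then have "((\<lambda>(x, y). f x y) has_sum (g x + (\<Sum>x\<in>A. g x))) ({x} \<times> B \<union> A \<times> B)"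
    using insert by (intro has_sum_Un_disjoint) auto
  moreover have "{x} \<times> B \<union> A \<times> B = insert x A \<times> B" by auto
  ultimately show ?case using insert.hyps by simp
qed simp

lemma has_sum_finite_sum:
  fixes f :: "'a \<Rightarrow> 'b \<Rightarrow> 'c::topological_comm_monoid_add"
  assumes "finite A" "\<And>x. x \<in> A \<Longrightarrow> (f x has_sum g x) B"
  shows "((\<lambda>y. \<Sum>x\<in>A. f x y) has_sum (\<Sum>x\<in>A. g x)) B"
  using assms by (induction A) (auto intro: has_sum_add)

context bounded_superdomain_operator
begin

lemma has_sum_unit_coeff:
  assumes W: "open_in_Cspace n W" "W \<subseteq> V" and F: "F \<in> superfuns n m W"
    and L: "L \<subseteq> {..<m}" and z: "z \<in> W"
  shows "((\<lambda>K. \<Sum>M\<in>Pow {..<m}. unit_coeff L M K z * multi_partial [0..<n] K (F M) z) has_sum P W F L z) (multi_indices n)"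
proof -
  have s: "smono W M (F M) \<in> superfuns n m W" if "M \<in> Pow {..<m}" for M
    using that by (intro smono_in_superfuns W superfunsD(1)[OF F]) auto
  have "F = (\<lambda>I y. \<Sum>M\<in>Pow {..<m}. smono W M (F M) I y)"
    using superfun_decompose[OF F] by (simp add: smono_apply if_distrib cong: if_cong)
  then have "P W F L z = P W (\<lambda>I y. \<Sum>M\<in>Pow {..<m}. smono W M (F M) I y) L z" by (rule arg_cong)
  also have "P W (\<lambda>I y. \<Sum>M\<in>Pow {..<m}. smono W M (F M) I y) = (\<lambda>I y. \<Sum>M\<in>Pow {..<m}. P W (smono W M (F M)) I y)"
    by (rule sum[OF W _ s]) auto
  finally have eq: "P W F L z = (\<Sum>M\<in>Pow {..<m}. P W (smono W M (F M)) L z)" .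
  show ?thesis unfolding eq
    by (intro has_sum_finite_sum has_sum_smono W superfunsD(1)[OF F] L z) auto
qed

text \<open>The coefficients of the matrix units are converted by \<open>triangular_system\<close>.
  Summability over all triples is shown for each pair \<open>(I, J)\<close> separately; the value of
  the total comes from regrouping by \<open>K\<close>, where the sum over matrix units is
  known.\<close>

lemma symbol_exists:
  "\<exists>a. (\<forall>I J. I \<subseteq> {..<m} \<and> J \<subseteq> {..<m} \<longrightarrow>
        (\<forall>K\<in>multi_indices n. several_holomorphic_on n V (a I J K)) \<and> overconvergent n V (a I J)) \<and>
     (\<forall>W F L z. open_in_Cspace n W \<and> W \<subseteq> V \<and> F \<in> superfuns n m W \<and> L \<subseteq> {..<m} \<and> z \<in> W \<longrightarrow>
        ((\<lambda>(I, J, K). diff_op_term n (a I J K) I J K F L z) has_sum P W F L z)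
          (Pow {..<m} \<times> Pow {..<m} \<times> multi_indices n))"
proof -
  define sign where "sign I J L s \<longleftrightarrow> s \<noteq> 0 \<and> (L \<subseteq> {..<m} \<longrightarrow> J \<subseteq> {..<m} \<longrightarrow>
    (\<forall>a K F z. diff_op_term n a I J K F L z =
      (if I \<subseteq> L \<and> J \<inter> (L - I) = {} then s * a z * multi_partial [0..<n] K (F (J \<union> (L - I))) z else 0)))"
    for I J L s
  have "\<forall>I J L. \<exists>s. sign I J L s" unfolding sign_def using diff_op_term_sign by (intro allI)
  then obtain \<sigma> where sg: "\<And>I J L. sign I J L (\<sigma> I J L)" by metis
  have "\<sigma> I J L \<noteq> 0" for I J L using sg[of I J L] unfolding sign_def by (rule conjunct1)
  moreover have "\<lbrakk>L \<subseteq> {..<m}; J \<subseteq> {..<m}\<rbrakk> \<Longrightarrow> diff_op_term n a I J K F L z =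
    (if I \<subseteq> L \<and> J \<inter> (L - I) = {} then \<sigma> I J L * a z * multi_partial [0..<n] K (F (J \<union> (L - I))) z else 0)"
    for I J L a K F z
    using sg[of I J L] unfolding sign_def by simp
  ultimately have \<sigma>: "\<And>I J L. \<sigma> I J L \<noteq> 0" "\<And>I J L a K F z. \<lbrakk>L \<subseteq> {..<m}; J \<subseteq> {..<m}\<rbrakk> \<Longrightarrow> diff_op_term n a I J K F L z =
    (if I \<subseteq> L \<and> J \<inter> (L - I) = {} then \<sigma> I J L * a z * multi_partial [0..<n] K (F (J \<union> (L - I))) z else 0)"
    by simp_all
  have "\<exists>a. (\<forall>I J. I \<subseteq> {..<m} \<longrightarrow> J \<subseteq> {..<m} \<longrightarrow> overconvergent_family n V (a I J)) \<and>
    (\<forall>L M K z. L \<subseteq> {..<m} \<longrightarrow> M \<subseteq> {..<m} \<longrightarrow>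
      (\<Sum>S\<in>Pow (L \<inter> M). \<sigma> (L - S) (M - S) L * a (L - S) (M - S) K z) = unit_coeff L M K z)"
    by (rule triangular_system[OF open_V \<sigma>(1)]) (rule overconvergent_family_unit_coeff)
  then obtain a where a: "\<forall>I J. I \<subseteq> {..<m} \<longrightarrow> J \<subseteq> {..<m} \<longrightarrow> overconvergent_family n V (a I J)"
    "\<forall>L M K z. L \<subseteq> {..<m} \<longrightarrow> M \<subseteq> {..<m} \<longrightarrow>
      (\<Sum>S\<in>Pow (L \<inter> M). \<sigma> (L - S) (M - S) L * a (L - S) (M - S) K z) = unit_coeff L M K z"
    by (elim exE conjE)
  have main: "((\<lambda>(I, J, K). diff_op_term n (a I J K) I J K F L z) has_sum P W F L z)
      (Pow {..<m} \<times> Pow {..<m} \<times> multi_indices n)"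
    if W: "open_in_Cspace n W" "W \<subseteq> V" and F: "F \<in> superfuns n m W" and L: "L \<subseteq> {..<m}" and z: "z \<in> W" for W F L z
  proof -
    let ?t = "\<lambda>I J K. diff_op_term n (a I J K) I J K F L z"
    have fin: "finite L" using L finite_odd_index by auto
    have zC: "z \<in> Cspace n" using z openin_imp_subset[OF W(1)] by auto
    have zV: "z \<in> V" using z W by auto
    obtain \<rho> B where \<rho>: "\<rho> > 0" "B > 0" "polydisc n z \<rho> \<subseteq> W" "bounded_on m (polydisc n z \<rho>) F B"
      using superfun_locally_bounded[OF W(1) z F] by metis
    have sm: "(?t I J) summable_on multi_indices n" if IJ: "I \<subseteq> {..<m}" "J \<subseteq> {..<m}" for I J
    proof (cases "I \<subseteq> L \<and> J \<inter> (L - I) = {}")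
      case True
      let ?M = "J \<union> (L - I)"
      have M: "?M \<subseteq> {..<m}" using IJ L by auto
      have fm: "several_holomorphic_on n (polydisc n z \<rho>) (F ?M)"
        by (rule several_holomorphic_on_subset[OF superfunsD(1)[OF F] \<rho>(3)])
      have FB: "cmod (F ?M y) \<le> B" if "y \<in> polydisc n z \<rho>" for y
        using \<rho>(4) M that by (auto simp: bounded_on_def)
      \<comment> \<open>Coefficient decay with \<epsilon> = \<rho>/2, against derivatives bounded by
        a multiple of K! / \<rho>^|K|, leaves the ratio 1/2.\<close>
      have "\<rho> / 2 > 0" using \<rho> by simp
      then obtain r C where r: "r > 0" "C \<ge> 0" "\<And>K y. y \<in> polydisc n z r \<Longrightarrow>
          cmod (a I J K y) * (\<Prod>i<n. fact (K i)) \<le> C * (\<Prod>i<n. (\<rho> / 2) ^ K i)"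
        using a(1) IJ zV unfolding overconvergent_family_def by meson
      have zr: "z \<in> polydisc n z r" using zC r(1) by (rule centre_in_polydisc)
      have bd: "cmod (?t I J K) \<le> cmod (\<sigma> I J L) * C * B * (\<Prod>i<n. (1/2) ^ K i)" for K
      proof -
        let ?f = "(\<Prod>i<n. fact (K i)) :: real"
        have fp: "?f > 0" by (intro prod_pos) auto
        have "cmod (multi_partial [0..<n] K (F ?M) z) \<le> B * (\<Prod>i<n. fact (K i) / \<rho> ^ K i)"
          by (rule multi_partial_bound[OF fm zC \<rho>(1) FB])
        also have "\<dots> = ?f * (B * (\<Prod>i<n. 1 / \<rho> ^ K i))" by (simp add: prod_dividef)
        finally have 1: "cmod (multi_partial [0..<n] K (F ?M) z) \<le> ?f * (B * (\<Prod>i<n. 1 / \<rho> ^ K i))" .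
        have "cmod (?t I J K) = cmod (\<sigma> I J L) * cmod (a I J K z) * cmod (multi_partial [0..<n] K (F ?M) z)"
          using \<sigma>(2)[OF L IJ(2)] True by (simp add: norm_mult)
        also have "\<dots> \<le> cmod (\<sigma> I J L) * cmod (a I J K z) * (?f * (B * (\<Prod>i<n. 1 / \<rho> ^ K i)))"
          using 1 by (intro mult_left_mono) auto
        also have "\<dots> = cmod (\<sigma> I J L) * (cmod (a I J K z) * ?f) * (B * (\<Prod>i<n. 1 / \<rho> ^ K i))" by simp
        also have "\<dots> \<le> cmod (\<sigma> I J L) * (C * (\<Prod>i<n. (\<rho> / 2) ^ K i)) * (B * (\<Prod>i<n. 1 / \<rho> ^ K i))"
          using r(3)[OF zr] \<rho> by (intro mult_right_mono mult_left_mono mult_nonneg_nonneg prod_nonneg) auto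
        also have "\<dots> = cmod (\<sigma> I J L) * C * B * ((\<Prod>i<n. (\<rho> / 2) ^ K i) * (\<Prod>i<n. 1 / \<rho> ^ K i))" by simp
        also have "(\<Prod>i<n. (\<rho> / 2) ^ K i) * (\<Prod>i<n. 1 / \<rho> ^ K i) = (\<Prod>i<n. (1/2) ^ K i)"
          using \<rho>(1) by (simp add: prod.distrib[symmetric] power_divide)
        finally show ?thesis .
      qed
      have "(\<lambda>K. cmod (\<sigma> I J L) * C * B * (\<Prod>i<n. (1/2) ^ K i)) summable_on multi_indices n"
        unfolding multi_indices_eq by (intro summable_on_cmult_right geometric_summable_on_indices) auto
      then have "(\<lambda>K. cmod (?t I J K)) summable_on multi_indices n"
        by (rule Infinite_Sum.abs_summable_on_comparison_test') (rule bd)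
      then show ?thesis by (rule Infinite_Sum.abs_summable_summable)
    next
      case False
      then have "?t I J K = 0" for K unfolding \<sigma>(2)[OF L IJ(2)] by (rule if_not_P)
      then show ?thesis by simp
    qed
    define v where "v I J = infsum (?t I J) (multi_indices n)" for I J
    have v: "(?t I J has_sum v I J) (multi_indices n)" if "I \<in> Pow {..<m}" "J \<in> Pow {..<m}" for I J
      using sm that by (simp add: v_def)
    have total: "((\<lambda>(I, J, K). ?t I J K) has_sum (\<Sum>I\<in>Pow {..<m}. \<Sum>J\<in>Pow {..<m}. v I J))
        (Pow {..<m} \<times> Pow {..<m} \<times> multi_indices n)"
      using v by (intro has_sum_finite_Times[where f = "\<lambda>I (J, K). ?t I J K"] has_sum_finite_Times) auto
    have resum: "(\<Sum>I\<in>Pow {..<m}. \<Sum>J\<in>Pow {..<m}. ?t I J K) =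
        (\<Sum>M\<in>Pow {..<m}. unit_coeff L M K z * multi_partial [0..<n] K (F M) z)" for K
    proof -
      let ?g = "\<lambda>M. multi_partial [0..<n] K (F M) z"
      let ?X = "{(I, J). I \<subseteq> L \<and> J \<subseteq> {..<m} \<and> J \<inter> (L - I) = {}}"
      \<comment> \<open>The pair \<open>(I, J)\<close> acts through the unit from
        \<open>M = J \<union> S\<close> to \<open>L\<close>, where \<open>S = L - I\<close>; the
        pairs \<open>(M, S)\<close> are the same data sorted by unit.\<close>
      let ?Y = "SIGMA M:Pow {..<m}. Pow (L \<inter> M)"
      have "(\<Sum>I\<in>Pow {..<m}. \<Sum>J\<in>Pow {..<m}. ?t I J K) = (\<Sum>(I, J)\<in>Pow {..<m} \<times> Pow {..<m}. ?t I J K)"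
        by (rule sum.cartesian_product)
      also have "\<dots> = (\<Sum>(I, J)\<in>?X. \<sigma> I J L * a I J K z * ?g (J \<union> (L - I)))"
        using L by (intro sum.mono_neutral_cong_right) (auto simp: \<sigma>(2)[OF L] split: if_splits)
      also have "\<dots> = (\<Sum>(M, S)\<in>?Y. \<sigma> (L - S) (M - S) L * a (L - S) (M - S) K z * ?g M)"
      proof (rule sum.reindex_bij_witness[where j = "\<lambda>(I, J). (J \<union> (L - I), L - I)" and i = "\<lambda>(M, S). (L - S, M - S)"])
        fix x assume x: "x \<in> ?X"
        obtain I J where [simp]: "x = (I, J)" by (cases x)
        have e: "L - (L - I) = I" "J \<union> (L - I) - (L - I) = J" using x by auto
        show "(\<lambda>(M, S). (L - S, M - S)) ((\<lambda>(I, J). (J \<union> (L - I), L - I)) x) = x" by (simp only: \<open>x = (I, J)\<close> prod.case e)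
        show "(\<lambda>(I, J). (J \<union> (L - I), L - I)) x \<in> ?Y" using x L by auto
        show "(case (\<lambda>(I, J). (J \<union> (L - I), L - I)) x of (M, S) \<Rightarrow> \<sigma> (L - S) (M - S) L * a (L - S) (M - S) K z * ?g M) =
            (case x of (I, J) \<Rightarrow> \<sigma> I J L * a I J K z * ?g (J \<union> (L - I)))"
          by (simp only: \<open>x = (I, J)\<close> prod.case e)
      next
        fix y assume y: "y \<in> ?Y"
        obtain M S where [simp]: "y = (M, S)" by (cases y)
        have e: "M - S \<union> S = M" "L - (L - S) = S" using y by auto
        show "(\<lambda>(I, J). (J \<union> (L - I), L - I)) ((\<lambda>(M, S). (L - S, M - S)) y) = y" by (simp only: \<open>y = (M, S)\<close> prod.case e)
        show "(\<lambda>(M, S). (L - S, M - S)) y \<in> ?X" using y L by auto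
      qed
      also have "\<dots> = (\<Sum>M\<in>Pow {..<m}. \<Sum>S\<in>Pow (L \<inter> M). \<sigma> (L - S) (M - S) L * a (L - S) (M - S) K z * ?g M)"
        using fin by (intro sum.Sigma[symmetric]) auto
      also have "\<dots> = (\<Sum>M\<in>Pow {..<m}. unit_coeff L M K z * ?g M)"
        by (intro sum.cong refl) (use a(2) L in \<open>simp add: sum_distrib_right[symmetric]\<close>)
      finally show ?thesis .
    qed
    have "((\<lambda>K. \<Sum>I\<in>Pow {..<m}. \<Sum>J\<in>Pow {..<m}. ?t I J K) has_sum (\<Sum>I\<in>Pow {..<m}. \<Sum>J\<in>Pow {..<m}. v I J)) (multi_indices n)"
      by (intro has_sum_finite_sum v) auto
    then have "(\<Sum>I\<in>Pow {..<m}. \<Sum>J\<in>Pow {..<m}. v I J) = P W F L z"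
      unfolding resum using has_sum_unit_coeff[OF W F L z] by (rule has_sum_unique)
    then show ?thesis using total by simp
  qed
  have hol: "several_holomorphic_on n V (a I J K) \<and> overconvergent n V (a I J)"
    if "I \<subseteq> {..<m}" "J \<subseteq> {..<m}" for I J K
    using a(1) that overconvergent_family_imp_overconvergent[OF open_V] by (auto simp: overconvergent_family_def)
  show ?thesis
    by (intro exI[of _ a] conjI allI impI ballI; (elim conjE)?) (simp_all add: hol main)
qed

end

section \<open>Continuity of germ homomorphisms\<close>

text \<open>
  \<open>\<tau> s\<close> sends a superfunction on the polydisc of radius \<open>s\<close> to its image under a homomorphism from
  the superalgebra of germs at \<open>p\<close> to the exterior algebra.
\<close>

locale germ_hom =
  fixes n m :: nat and p :: "nat \<Rightarrow> complex" and R :: real and \<tau> :: "real \<Rightarrow> superfun \<Rightarrow> nat set \<Rightarrow> complex"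
  assumes p: "p \<in> Cspace n"
    and add: "\<lbrakk>0 < s; s \<le> R; F \<in> superfuns n m (polydisc n p s); G \<in> superfuns n m (polydisc n p s)\<rbrakk> \<Longrightarrow>
      \<tau> s (\<lambda>I z. F I z + G I z) L = \<tau> s F L + \<tau> s G L"
    and smult: "\<lbrakk>0 < s; s \<le> R; F \<in> superfuns n m (polydisc n p s)\<rbrakk> \<Longrightarrow> \<tau> s (\<lambda>I z. c * F I z) L = c * \<tau> s F L"
    and mult: "\<lbrakk>0 < s; s \<le> R; F \<in> superfuns n m (polydisc n p s); G \<in> superfuns n m (polydisc n p s)\<rbrakk> \<Longrightarrow>
      \<tau> s (superfun_mult F G) L = (\<Sum>J\<in>Pow L. shuffle_sign J (L - J) * \<tau> s F J * \<tau> s G (L - J))"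
    and one: "\<lbrakk>0 < s; s \<le> R\<rbrakk> \<Longrightarrow> \<tau> s (smono (polydisc n p s) {} (\<lambda>_. 1)) L = (if L = {} then 1 else 0)"
    and restrict: "\<lbrakk>0 < s; s \<le> t; t \<le> R; F \<in> superfuns n m (polydisc n p t)\<rbrakk> \<Longrightarrow>
      \<tau> s (superfun_restrict (polydisc n p s) F) L = \<tau> t F L"
begin

lemma sum:
  assumes "0 < s" "s \<le> R" "finite S" "\<And>k. k \<in> S \<Longrightarrow> G k \<in> superfuns n m (polydisc n p s)"
  shows "\<tau> s (\<lambda>I z. \<Sum>k\<in>S. G k I z) L = (\<Sum>k\<in>S. \<tau> s (G k) L)"
  using assms(3,4)
proof (induction S)
  case empty
  show ?case using smult[OF assms(1,2) superfuns_zero, of 0] by simp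
next
  case (insert k S)
  have "\<tau> s (\<lambda>I z. G k I z + (\<Sum>k\<in>S. G k I z)) L = \<tau> s (G k) L + \<tau> s (\<lambda>I z. \<Sum>k\<in>S. G k I z) L"
    using insert.prems by (intro add assms(1,2) superfuns_sum) auto
  then show ?case using insert by simp
qed

lemma const:
  assumes "0 < s" "s \<le> R"
  shows "\<tau> s (smono (polydisc n p s) {} (\<lambda>_. c)) L = (if L = {} then c else 0)"
proof -
  let ?D = "polydisc n p s"
  have "smono ?D {} (\<lambda>_. 1) \<in> superfuns n m ?D"
    by (intro smono_in_superfuns open_polydisc several_holomorphic_on_const) auto
  moreover have "smono ?D {} (\<lambda>_. c) = (\<lambda>I z. c * smono ?D {} (\<lambda>_. 1) I z)" by (auto simp: smono_apply fun_eq_iff)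
  ultimately show ?thesis using smult[OF assms] one[OF assms] by simp
qed

text \<open>
  Otherwise \<open>z\<^sub>i - p\<^sub>i - \<lambda>\<close>, with \<open>\<lambda>\<close> the value below, would be a unit near \<open>p\<close>
  with an image that is not invertible.
\<close>

lemma coordinate_body:
  assumes s: "0 < s" "s \<le> R" and i: "i < n"
  shows "\<tau> s (smono (polydisc n p s) {} (\<lambda>z. z i - p i)) {} = 0"
proof (rule ccontr)
  define l where "l = \<tau> s (smono (polydisc n p s) {} (\<lambda>z. z i - p i)) {}"
  assume "\<tau> s (smono (polydisc n p s) {} (\<lambda>z. z i - p i)) {} \<noteq> 0"
  then have l: "l \<noteq> 0" by (simp add: l_def)
  \<comment> \<open>On this polydisc |z i - p i| is below |l|, so \<open>z i - p i - l\<close> has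
    no zero and can be inverted.\<close>
  define t where "t = min s (cmod l)"
  have t: "0 < t" "t \<le> s" "t \<le> R" "t \<le> cmod l" using s l by (auto simp: t_def)
  let ?D = "polydisc n p t"
  have nz: "z i - p i - l \<noteq> 0" if "z \<in> ?D" for z
  proof
    assume "z i - p i - l = 0"
    then have "z i - p i = l" by simp
    then have "dist (z i) (p i) = cmod l" unfolding dist_norm by (rule arg_cong)
    then have "dist (p i) (z i) = cmod l" by (simp add: dist_commute)
    moreover have "dist (p i) (z i) < t" using that i by (simp add: polydisc_def)
    ultimately show False using t by simp
  qed
  have h: "several_holomorphic_on n W (\<lambda>z. z i - p i)" for W by (intro several_holomorphic_intros)
  have h1: "several_holomorphic_on n ?D (\<lambda>z. z i - p i - l)" by (intro several_holomorphic_intros)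
  have h2: "several_holomorphic_on n ?D (\<lambda>z. 1 / (z i - p i - l))"
    using nz by (intro several_holomorphic_on_divide several_holomorphic_intros) auto
  have s1: "smono ?D {} (\<lambda>z. z i - p i) \<in> superfuns n m ?D"
    and s2: "smono ?D {} (\<lambda>_. - l) \<in> superfuns n m ?D"
    and s3: "smono ?D {} (\<lambda>z. z i - p i - l) \<in> superfuns n m ?D"
    and s4: "smono ?D {} (\<lambda>z. 1 / (z i - p i - l)) \<in> superfuns n m ?D"
    by (intro smono_in_superfuns open_polydisc h h1 h2 several_holomorphic_on_const empty_subsetI)+
  have "\<tau> t (smono ?D {} (\<lambda>z. z i - p i)) {} = l"
  proof -
    have "smono (polydisc n p s) {} (\<lambda>z. z i - p i) \<in> superfuns n m (polydisc n p s)"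
      by (intro smono_in_superfuns open_polydisc h) auto
    from restrict[OF t(1,2) s(2) this]
    have "\<tau> t (superfun_restrict ?D (smono (polydisc n p s) {} (\<lambda>z. z i - p i))) {} = l" by (simp add: l_def)
    moreover have "superfun_restrict ?D (smono (polydisc n p s) {} (\<lambda>z. z i - p i)) = smono ?D {} (\<lambda>z. z i - p i)"
      using polydisc_mono[OF t(2), of n p] by (auto simp: superfun_restrict_def superfun_monom_def fun_eq_iff)
    ultimately show ?thesis by simp
  qed
  moreover have "smono ?D {} (\<lambda>z. z i - p i - l) = (\<lambda>I z. smono ?D {} (\<lambda>z. z i - p i) I z + smono ?D {} (\<lambda>_. - l) I z)"
    by (auto simp: smono_apply fun_eq_iff)
  ultimately have "\<tau> t (smono ?D {} (\<lambda>z. z i - p i - l)) {} = 0"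
    using add[OF t(1,3) s1 s2, of "{}"] const[OF t(1,3), of "- l" "{}"] by simp
  then have "\<tau> t (superfun_mult (smono ?D {} (\<lambda>z. z i - p i - l)) (smono ?D {} (\<lambda>z. 1 / (z i - p i - l)))) {} = 0"
    using mult[OF t(1,3) s3 s4, of "{}"] by simp
  moreover have "superfun_mult (smono ?D {} (\<lambda>z. z i - p i - l)) (smono ?D {} (\<lambda>z. 1 / (z i - p i - l))) = smono ?D {} (\<lambda>_. 1)"
    unfolding superfun_mult_scalar[OF s4] using nz by (auto simp: smono_apply fun_eq_iff)
  ultimately show False using one[OF t(1,3), of "{}"] by simp
qed

text \<open>Induction on the number of odd generators in \<open>L\<close>. By Hadamard's lemma the
  image of \<open>f\<close> is built from products of the images of \<open>z i - p i\<close> and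
  \<open>g i\<close>. The former have no body, so component \<open>L\<close> only meets components
  of the latter with fewer generators. Each step halves the radius, since \<open>g i\<close> is
  bounded only on half of the polydisc.\<close>

lemma scalar_continuous:
  "finite L \<Longrightarrow> 0 < s \<Longrightarrow> s \<le> R \<Longrightarrow> \<exists>C\<ge>0. \<forall>f B. several_holomorphic_on n (polydisc n p s) f \<and>
    (\<forall>z\<in>polydisc n p s. cmod (f z) \<le> B) \<longrightarrow> cmod (\<tau> s (smono (polydisc n p s) {} f) L) \<le> C * B"
proof (induction "card L" arbitrary: L s rule: less_induct)
  case less
  note s = less.prems(2,3) and fin = less.prems(1)
  let ?D = "polydisc n p s" and ?E = "polydisc n p (s/2)"
  have s2: "0 < s/2" "s/2 \<le> R" "s/2 \<le> s" using s by auto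
  have sub: "?E \<subseteq> ?D" by (rule polydisc_mono) (use s in simp)
  have pD: "p \<in> ?D" by (rule centre_in_polydisc) (use p s in auto)
  have "\<forall>J\<in>Pow L - {{}}. \<exists>C\<ge>0. \<forall>f B. several_holomorphic_on n ?E f \<and>
    (\<forall>z\<in>?E. cmod (f z) \<le> B) \<longrightarrow> cmod (\<tau> (s/2) (smono ?E {} f) (L - J)) \<le> C * B"
  proof
    fix J assume J: "J \<in> Pow L - {{}}"
    have "card (L - J) < card L" using J fin by (intro psubset_card_mono) auto
    then show "\<exists>C\<ge>0. \<forall>f B. several_holomorphic_on n ?E f \<and>
      (\<forall>z\<in>?E. cmod (f z) \<le> B) \<longrightarrow> cmod (\<tau> (s/2) (smono ?E {} f) (L - J)) \<le> C * B"
      by (rule less.hyps) (use fin s2 in auto)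
  qed
  then obtain c where c: "\<And>J. J \<in> Pow L - {{}} \<Longrightarrow> c J \<ge> 0"
    "\<And>J f B. \<lbrakk>J \<in> Pow L - {{}}; several_holomorphic_on n ?E f; \<forall>z\<in>?E. cmod (f z) \<le> B\<rbrakk> \<Longrightarrow>
      cmod (\<tau> (s/2) (smono ?E {} f) (L - J)) \<le> c J * B"
    unfolding bchoice_iff by (elim exE) blast
  let ?x = "\<lambda>i. smono ?D {} (\<lambda>z. z i - p i)"
  \<comment> \<open>Collects the Hadamard factor 2 / s and the constants of the smaller components;
    the 1 in the final constant 1 + A accounts for \<open>f p\<close>.\<close>
  define A where "A = (\<Sum>i<n. \<Sum>J\<in>Pow L - {{}}. cmod (\<tau> s (?x i) J) * (c J * (2 / s)))"
  have A: "A \<ge> 0" unfolding A_def using c(1) s by (intro sum_nonneg mult_nonneg_nonneg) auto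
  have "cmod (\<tau> s (smono ?D {} f) L) \<le> (1 + A) * B"
    if f: "several_holomorphic_on n ?D f" and B: "\<forall>z\<in>?D. cmod (f z) \<le> B" for f B
  proof -
    obtain g where g: "\<And>i. i < n \<Longrightarrow> several_holomorphic_on n ?D (g i)"
      "\<And>z. z \<in> ?D \<Longrightarrow> f z = f p + (\<Sum>i<n. (z i - p i) * g i z)"
      "\<And>i z B. i < n \<Longrightarrow> z \<in> ?E \<Longrightarrow> \<forall>y\<in>?D. cmod (f y) \<le> B \<Longrightarrow> cmod (g i z) \<le> 2 * B / s"
      using hadamard[OF f p s(1)] by blast
    have B0: "0 \<le> B" using B pD norm_ge_zero order_trans by metis
    have xs: "?x i \<in> superfuns n m ?D" for i
      by (intro smono_in_superfuns open_polydisc several_holomorphic_intros) auto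
    have gs: "smono ?D {} (g i) \<in> superfuns n m ?D" if "i < n" for i
      by (intro smono_in_superfuns open_polydisc g(1) that) auto
    have cs: "smono ?D {} (\<lambda>_. f p) \<in> superfuns n m ?D"
      by (intro smono_in_superfuns open_polydisc several_holomorphic_on_const) auto
    have dec: "smono ?D {} f = (\<lambda>I z. smono ?D {} (\<lambda>_. f p) I z + (\<Sum>i<n. superfun_mult (?x i) (smono ?D {} (g i)) I z))"
    proof (intro ext)
      fix I z
      have "(\<Sum>i<n. superfun_mult (?x i) (smono ?D {} (g i)) I z) = (\<Sum>i<n. (z i - p i) * smono ?D {} (g i) I z)"
        by (intro sum.cong refl) (simp add: superfun_mult_scalar[OF gs])
      then show "smono ?D {} f I z = smono ?D {} (\<lambda>_. f p) I z + (\<Sum>i<n. superfun_mult (?x i) (smono ?D {} (g i)) I z)"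
        using g(2)[of z] by (cases "z \<in> ?D \<and> I = {}") (auto simp: smono_apply)
    qed
    have eq: "\<tau> s (smono ?D {} f) L = (if L = {} then f p else 0) +
        (\<Sum>i<n. \<Sum>J\<in>Pow L - {{}}. shuffle_sign J (L - J) * \<tau> s (?x i) J * \<tau> s (smono ?D {} (g i)) (L - J))"
    proof -
      have "\<tau> s (smono ?D {} f) L = \<tau> s (smono ?D {} (\<lambda>_. f p)) L + (\<Sum>i<n. \<tau> s (superfun_mult (?x i) (smono ?D {} (g i))) L)"
        unfolding dec
        using add[OF s cs superfuns_sum, of "{..<n}" "\<lambda>i. superfun_mult (?x i) (smono ?D {} (g i))" L]
          sum[OF s, of "{..<n}" "\<lambda>i. superfun_mult (?x i) (smono ?D {} (g i))" L] superfuns_mult[OF xs gs]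
        by simp
      moreover have "\<tau> s (superfun_mult (?x i) (smono ?D {} (g i))) L =
          (\<Sum>J\<in>Pow L - {{}}. shuffle_sign J (L - J) * \<tau> s (?x i) J * \<tau> s (smono ?D {} (g i)) (L - J))" if "i < n" for i
      proof -
        have "(\<Sum>J\<in>Pow L. h J) = h {} + (\<Sum>J\<in>Pow L - {{}}. h J)" for h :: "nat set \<Rightarrow> complex"
          using fin by (subst sum.remove[of _ "{}"]) auto
        then show ?thesis using mult[OF s xs gs[OF that], of i L] coordinate_body[OF s that] by simp
      qed
      ultimately show ?thesis using const[OF s] by simp
    qed
    have gb: "cmod (\<tau> s (smono ?D {} (g i)) (L - J)) \<le> c J * (2 * B / s)" if i: "i < n" and J: "J \<in> Pow L - {{}}" for i J
    proof -
      have "smono ?E {} (g i) = superfun_restrict ?E (smono ?D {} (g i))"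
        using sub by (auto simp: superfun_restrict_def superfun_monom_def fun_eq_iff)
      then have "\<tau> (s/2) (smono ?E {} (g i)) (L - J) = \<tau> s (smono ?D {} (g i)) (L - J)"
        using restrict[OF s2(1) s2(3) s(2) gs[OF i]] by simp
      moreover have "cmod (\<tau> (s/2) (smono ?E {} (g i)) (L - J)) \<le> c J * (2 * B / s)"
        using g(3)[OF i _ B] several_holomorphic_on_subset[OF g(1)[OF i] sub] by (intro c(2)[OF J]) auto
      ultimately show ?thesis by simp
    qed
    have "cmod (\<tau> s (smono ?D {} f) L) \<le> B + (\<Sum>i<n. \<Sum>J\<in>Pow L - {{}}. cmod (\<tau> s (?x i) J) * (c J * (2 * B / s)))"
      unfolding eq
    proof (rule order_trans[OF norm_triangle_ineq add_mono])
      show "cmod (if L = {} then f p else 0) \<le> B" using B pD B0 by auto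
      show "cmod (\<Sum>i<n. \<Sum>J\<in>Pow L - {{}}. shuffle_sign J (L - J) * \<tau> s (?x i) J * \<tau> s (smono ?D {} (g i)) (L - J))
          \<le> (\<Sum>i<n. \<Sum>J\<in>Pow L - {{}}. cmod (\<tau> s (?x i) J) * (c J * (2 * B / s)))"
      proof (intro sum_norm_le)
        fix i J assume "i \<in> {..<n}" and J: "J \<in> Pow L - {{}}"
        then have "cmod (\<tau> s (smono ?D {} (g i)) (L - J)) \<le> c J * (2 * B / s)" by (intro gb) auto
        then show "cmod (shuffle_sign J (L - J) * \<tau> s (?x i) J * \<tau> s (smono ?D {} (g i)) (L - J))
            \<le> cmod (\<tau> s (?x i) J) * (c J * (2 * B / s))"
          unfolding norm_mult norm_shuffle_sign mult_1 by (rule mult_left_mono) simp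
      qed
    qed
    also have "(\<Sum>i<n. \<Sum>J\<in>Pow L - {{}}. cmod (\<tau> s (?x i) J) * (c J * (2 * B / s))) = A * B"
      unfolding A_def sum_distrib_right by (intro sum.cong refl) simp
    finally show ?thesis by (simp add: algebra_simps)
  qed
  then show ?case using A by (intro exI[of _ "1 + A"]) auto
qed

text \<open>Writing \<open>F\<close> as a sum of scalars times \<open>\<xi>\<^sup>M\<close> reduces
  this to \<open>scalar_continuous\<close>; the images of the finitely many
  \<open>\<xi>\<^sup>M\<close> enter the constant.\<close>

lemma continuous:
  assumes s: "0 < s" "s \<le> R" and L: "L \<subseteq> {..<m}"
  shows "\<exists>C\<ge>0. \<forall>F B. F \<in> superfuns n m (polydisc n p s) \<and> bounded_on m (polydisc n p s) F B \<longrightarrow>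
    cmod (\<tau> s F L) \<le> C * B"
proof -
  let ?D = "polydisc n p s"
  have fin: "finite L" using L finite_odd_index by auto
  have "\<forall>J\<in>Pow L. \<exists>C\<ge>0. \<forall>f B. several_holomorphic_on n ?D f \<and>
    (\<forall>z\<in>?D. cmod (f z) \<le> B) \<longrightarrow> cmod (\<tau> s (smono ?D {} f) J) \<le> C * B"
  proof
    fix J assume "J \<in> Pow L"
    then have "finite J" using fin finite_subset by auto
    then show "\<exists>C\<ge>0. \<forall>f B. several_holomorphic_on n ?D f \<and>
        (\<forall>z\<in>?D. cmod (f z) \<le> B) \<longrightarrow> cmod (\<tau> s (smono ?D {} f) J) \<le> C * B"
      using s by (rule scalar_continuous)
  qed
  then obtain c where c: "\<And>J. J \<in> Pow L \<Longrightarrow> c J \<ge> 0"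
    "\<And>J f B. \<lbrakk>J \<in> Pow L; several_holomorphic_on n ?D f; \<forall>z\<in>?D. cmod (f z) \<le> B\<rbrakk> \<Longrightarrow>
      cmod (\<tau> s (smono ?D {} f) J) \<le> c J * B"
    unfolding bchoice_iff by (elim exE) blast
  let ?e = "\<lambda>M. smono ?D M (\<lambda>_. 1)"
  define A where "A = (\<Sum>M\<in>Pow {..<m}. \<Sum>J\<in>Pow L. c J * cmod (\<tau> s (?e M) (L - J)))"
  have "A \<ge> 0" unfolding A_def using c(1) by (intro sum_nonneg mult_nonneg_nonneg) auto
  moreover have "cmod (\<tau> s F L) \<le> A * B" if F: "F \<in> superfuns n m ?D" and B: "bounded_on m ?D F B" for F B
  proof -
    have fs: "smono ?D {} (F M) \<in> superfuns n m ?D" for M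
      by (intro smono_in_superfuns open_polydisc superfunsD(1)[OF F]) auto
    have es: "?e M \<in> superfuns n m ?D" if "M \<in> Pow {..<m}" for M
      using that by (intro smono_in_superfuns open_polydisc several_holomorphic_on_const) auto
    have dec: "(\<lambda>I z. \<Sum>M\<in>Pow {..<m}. superfun_mult (smono ?D {} (F M)) (?e M) I z) = F"
    proof (intro ext)
      fix I z
      have "(\<Sum>M\<in>Pow {..<m}. superfun_mult (smono ?D {} (F M)) (?e M) I z) = (\<Sum>M\<in>Pow {..<m}. F M z * ?e M I z)"
        by (intro sum.cong refl) (simp add: superfun_mult_scalar[OF es])
      then show "(\<Sum>M\<in>Pow {..<m}. superfun_mult (smono ?D {} (F M)) (?e M) I z) = F I z"
        using superfun_decompose[OF F] by metis
    qed
    have eq: "\<tau> s F L = (\<Sum>M\<in>Pow {..<m}. \<Sum>J\<in>Pow L. shuffle_sign J (L - J) * \<tau> s (smono ?D {} (F M)) J * \<tau> s (?e M) (L - J))"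
      using sum[OF s, of "Pow {..<m}" "\<lambda>M. superfun_mult (smono ?D {} (F M)) (?e M)" L]
        superfuns_mult[OF fs es] mult[OF s fs es] unfolding dec by simp
    have "cmod (\<tau> s F L) \<le> (\<Sum>M\<in>Pow {..<m}. \<Sum>J\<in>Pow L. c J * B * cmod (\<tau> s (?e M) (L - J)))"
      unfolding eq
    proof (intro sum_norm_le)
      fix M J assume M: "M \<in> Pow {..<m}" and J: "J \<in> Pow L"
      have "\<forall>z\<in>?D. cmod (F M z) \<le> B" using B M by (simp add: bounded_on_def)
      then have "cmod (\<tau> s (smono ?D {} (F M)) J) \<le> c J * B"
        by (intro c(2) J superfunsD(1)[OF F])
      then show "cmod (shuffle_sign J (L - J) * \<tau> s (smono ?D {} (F M)) J * \<tau> s (?e M) (L - J)) \<le> c J * B * cmod (\<tau> s (?e M) (L - J))"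
        by (simp add: norm_mult mult_right_mono)
    qed
    also have "\<dots> = A * B" unfolding A_def sum_distrib_right by (intro sum.cong refl) simp
    finally show ?thesis .
  qed
  ultimately show ?thesis by blast
qed

end

section \<open>Charts\<close>

lemma superdomain_simps [simp]:
  "carrier (superdomain n m V) = superfuns n m V"
  "F \<otimes>\<^bsub>superdomain n m V\<^esub> G = superfun_mult F G"
  "\<one>\<^bsub>superdomain n m V\<^esub> = smono V {} (\<lambda>_. 1)"
  "F \<oplus>\<^bsub>superdomain n m V\<^esub> G = (\<lambda>I z. F I z + G I z)"
  "c \<odot>\<^bsub>superdomain n m V\<^esub> F = (\<lambda>I z. c * F I z)"
  "grade (superdomain n m V) p = {F \<in> superfuns n m V. \<forall>I z. card I mod 2 \<noteq> p \<longrightarrow> F I z = 0}"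
  by (simp_all add: superdomain_def)

lemma (in superalgebra) superalgebra_closed:
  "x \<in> carrier A \<Longrightarrow> y \<in> carrier A \<Longrightarrow> x \<oplus> y \<in> carrier A"
  "x \<in> carrier A \<Longrightarrow> y \<in> carrier A \<Longrightarrow> x \<otimes> y \<in> carrier A"
  "\<one> \<in> carrier A"
  "x \<in> carrier A \<Longrightarrow> c \<odot> x \<in> carrier A"
  "p < 2 \<Longrightarrow> grade A p \<subseteq> carrier A"
proof -
  show "c \<odot> x \<in> carrier A" if "x \<in> carrier A"
    using that by (intro M.smult_closed) (simp_all add: ring_of_type_algebra_def)
  show "grade A p \<subseteq> carrier A" if "p < 2"
    using grade_submodule[OF that] subgroup.subset unfolding submodule_def by fastforce
qed auto

context superalgebra_sheaf
begin

lemma sect_closed: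
  assumes "openin (body \<X>) W"
  shows "f \<in> carrier (sect \<X> W) \<Longrightarrow> g \<in> carrier (sect \<X> W) \<Longrightarrow> f \<oplus>\<^bsub>sect \<X> W\<^esub> g \<in> carrier (sect \<X> W)"
    "f \<in> carrier (sect \<X> W) \<Longrightarrow> g \<in> carrier (sect \<X> W) \<Longrightarrow> f \<otimes>\<^bsub>sect \<X> W\<^esub> g \<in> carrier (sect \<X> W)"
    "\<one>\<^bsub>sect \<X> W\<^esub> \<in> carrier (sect \<X> W)"
    "f \<in> carrier (sect \<X> W) \<Longrightarrow> c \<odot>\<^bsub>sect \<X> W\<^esub> f \<in> carrier (sect \<X> W)"
    "p < 2 \<Longrightarrow> f \<in> grade (sect \<X> W) p \<Longrightarrow> f \<in> carrier (sect \<X> W)"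
  using superalgebra.superalgebra_closed[OF sect_superalgebra[OF assms]] by blast+

lemma restr_simps:
  assumes "openin (body \<X>) U" "openin (body \<X>) W" "W \<subseteq> U"
  shows "f \<in> carrier (sect \<X> U) \<Longrightarrow> restr \<X> U W f \<in> carrier (sect \<X> W)"
    "f \<in> carrier (sect \<X> U) \<Longrightarrow> g \<in> carrier (sect \<X> U) \<Longrightarrow>
      restr \<X> U W (f \<oplus>\<^bsub>sect \<X> U\<^esub> g) = restr \<X> U W f \<oplus>\<^bsub>sect \<X> W\<^esub> restr \<X> U W g"
    "f \<in> carrier (sect \<X> U) \<Longrightarrow> restr \<X> U W (c \<odot>\<^bsub>sect \<X> U\<^esub> f) = c \<odot>\<^bsub>sect \<X> W\<^esub> restr \<X> U W f"
  using restr_hom[OF assms] by (auto simp: superalg_hom_def ring_hom_closed ring_hom_add)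

end

locale chart = superalgebra_sheaf \<X> for \<X> :: "('x, 's) superspace" +
  fixes n m :: nat and U :: "'x set" and \<phi> :: "'x \<Rightarrow> nat \<Rightarrow> complex" and \<Phi> :: "'x set \<Rightarrow> 's \<Rightarrow> superfun"
  assumes super_chart: "super_chart n m \<X> U \<phi> \<Phi>"
begin

lemma open_U: "openin (body \<X>) U" and open_image_U: "open_in_Cspace n (\<phi> ` U)"
  and homeo: "homeomorphic_map (subtopology (body \<X>) U) (top_of_set (\<phi> ` U)) \<phi>"
  using super_chart by (auto simp: super_chart_def)

lemma topspace_U: "topspace (subtopology (body \<X>) U) = U"
  using openin_subset[OF open_U] by (simp add: inf.absorb2)

lemma inj: "inj_on \<phi> U"
  using homeo homeomorphic_imp_injective_map topspace_U by metis

lemma open_image: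
  assumes "openin (body \<X>) W" "W \<subseteq> U" shows "open_in_Cspace n (\<phi> ` W)"
proof -
  have "openin (subtopology (body \<X>) U) W" using assms open_U by (simp add: openin_open_subtopology)
  then have "openin (top_of_set (\<phi> ` U)) (\<phi> ` W)"
    using homeomorphic_imp_open_map[OF homeo] by (simp add: open_map_def)
  then show ?thesis using open_image_U openin_trans by blast
qed

definition pull :: "(nat \<Rightarrow> complex) set \<Rightarrow> 'x set" where "pull Y = {x \<in> U. \<phi> x \<in> Y}"

lemma pull_subset: "pull Y \<subseteq> U"
  by (auto simp: pull_def)

lemma open_pull:
  assumes "open_in_Cspace n Y" "Y \<subseteq> \<phi> ` U" shows "openin (body \<X>) (pull Y)"
proof -
  have "openin (top_of_set (\<phi> ` U)) Y"
    using assms open_image_U by (meson openin_subset_trans openin_imp_subset)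
  then have "openin (subtopology (body \<X>) U) {x \<in> topspace (subtopology (body \<X>) U). \<phi> x \<in> Y}"
    by (rule openin_continuous_map_preimage[OF homeomorphic_imp_continuous_map[OF homeo]])
  then show ?thesis unfolding topspace_U pull_def[symmetric] using open_U by (simp add: openin_open_subtopology)
qed

lemma image_pull: "Y \<subseteq> \<phi> ` U \<Longrightarrow> \<phi> ` pull Y = Y"
  by (auto simp: pull_def)

lemma pull_image: "W \<subseteq> U \<Longrightarrow> pull (\<phi> ` W) = W"
  using inj by (auto simp: pull_def inj_on_def)

context
  fixes W assumes W: "openin (body \<X>) W" "W \<subseteq> U"
begin

lemma Phi_iso: "\<Phi> W \<in> superalg_iso (sect \<X> W) (superdomain n m (\<phi> ` W))"
  using super_chart W by (simp add: super_chart_def)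

lemma Phi_hom: "\<Phi> W \<in> superalg_hom (sect \<X> W) (superdomain n m (\<phi> ` W))"
  and Phi_ring_hom: "\<Phi> W \<in> ring_hom (sect \<X> W) (superdomain n m (\<phi> ` W))"
  and Phi_bij: "bij_betw (\<Phi> W) (carrier (sect \<X> W)) (superfuns n m (\<phi> ` W))"
  using Phi_iso by (auto simp: superalg_iso_def superalg_hom_def)

lemma Phi_closed: "f \<in> carrier (sect \<X> W) \<Longrightarrow> \<Phi> W f \<in> superfuns n m (\<phi> ` W)"
  using Phi_bij bij_betwE by blast

lemma Phi_add: "f \<in> carrier (sect \<X> W) \<Longrightarrow> g \<in> carrier (sect \<X> W) \<Longrightarrow>
    \<Phi> W (f \<oplus>\<^bsub>sect \<X> W\<^esub> g) = (\<lambda>I z. \<Phi> W f I z + \<Phi> W g I z)"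
  using ring_hom_add[OF Phi_ring_hom] by simp

lemma Phi_mult: "f \<in> carrier (sect \<X> W) \<Longrightarrow> g \<in> carrier (sect \<X> W) \<Longrightarrow>
    \<Phi> W (f \<otimes>\<^bsub>sect \<X> W\<^esub> g) = superfun_mult (\<Phi> W f) (\<Phi> W g)"
  using ring_hom_mult[OF Phi_ring_hom] by simp

lemma Phi_one: "\<Phi> W \<one>\<^bsub>sect \<X> W\<^esub> = smono (\<phi> ` W) {} (\<lambda>_. 1)"
  using ring_hom_one[OF Phi_ring_hom] by simp

lemma Phi_smult: "f \<in> carrier (sect \<X> W) \<Longrightarrow> \<Phi> W (c \<odot>\<^bsub>sect \<X> W\<^esub> f) = (\<lambda>I z. c * \<Phi> W f I z)"
  using Phi_hom by (simp add: superalg_hom_def)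

lemma Phi_grade: "p < 2 \<Longrightarrow> f \<in> grade (sect \<X> W) p \<Longrightarrow> card I mod 2 \<noteq> p \<Longrightarrow> \<Phi> W f I z = 0"
proof -
  assume p: "p < 2" "f \<in> grade (sect \<X> W) p" "card I mod 2 \<noteq> p"
  have "\<Phi> W ` grade (sect \<X> W) p \<subseteq> grade (superdomain n m (\<phi> ` W)) p"
    using Phi_hom p(1) unfolding superalg_hom_def by blast
  then have "\<Phi> W f \<in> grade (superdomain n m (\<phi> ` W)) p" using p(2) by blast
  then show ?thesis using p(3) by simp
qed

lemma Phi_inject: "f \<in> carrier (sect \<X> W) \<Longrightarrow> g \<in> carrier (sect \<X> W) \<Longrightarrow> \<Phi> W f = \<Phi> W g \<longleftrightarrow> f = g"
  using Phi_bij by (auto simp: bij_betw_def inj_on_def)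

lemma Phi_restr: "openin (body \<X>) W' \<Longrightarrow> W' \<subseteq> W \<Longrightarrow> f \<in> carrier (sect \<X> W) \<Longrightarrow>
    \<Phi> W' (restr \<X> W W' f) = superfun_restrict (\<phi> ` W') (\<Phi> W f)"
  using super_chart W unfolding super_chart_def by blast

text \<open>A chart map is only known to send each grade into the corresponding one. Evenness of a
  preimage follows by splitting it: its odd part contributes nothing to the image, and
  \<open>\<Phi> W\<close> is injective.\<close>

lemma even_preimage:
  assumes b: "b \<in> carrier (sect \<X> W)" "\<Phi> W b = smono (\<phi> ` W) {} a"
  shows "b \<in> grade (sect \<X> W) 0"
proof -
  obtain x0 x1 where x: "x0 \<in> grade (sect \<X> W) 0" "x1 \<in> grade (sect \<X> W) 1" "b = x0 \<oplus>\<^bsub>sect \<X> W\<^esub> x1"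
    using superalgebra.grade_sum[OF sect_superalgebra[OF W(1)] b(1)] by blast
  have xc: "x0 \<in> carrier (sect \<X> W)" "x1 \<in> carrier (sect \<X> W)"
    using sect_closed(5)[OF W(1) _ x(1)] sect_closed(5)[OF W(1) _ x(2)] by simp_all
  have eq: "\<Phi> W b I z = \<Phi> W x0 I z + \<Phi> W x1 I z" for I z using Phi_add[OF xc] x(3) by simp
  have "\<Phi> W b I z = \<Phi> W x0 I z" for I z
  proof (cases "card I mod 2 = 0")
    case True
    then show ?thesis using eq Phi_grade[OF _ x(2), of I z] by simp
  next
    case False
    then have "\<Phi> W b I z = 0" using b(2) by (auto simp: smono_apply)
    then show ?thesis using Phi_grade[OF _ x(1), of I z] False by simp
  qed
  then have "b = x0" using Phi_inject[OF b(1) xc(1)] by (simp add: fun_eq_iff)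
  then show ?thesis using x by simp
qed

end

definition Psi :: "(nat \<Rightarrow> complex) set \<Rightarrow> superfun \<Rightarrow> 's" where
  "Psi Y F = inv_into (carrier (sect \<X> (pull Y))) (\<Phi> (pull Y)) F"

lemma Psi:
  assumes "open_in_Cspace n Y" "Y \<subseteq> \<phi> ` U" "F \<in> superfuns n m Y"
  shows "Psi Y F \<in> carrier (sect \<X> (pull Y))" "\<Phi> (pull Y) (Psi Y F) = F"
proof -
  have "bij_betw (\<Phi> (pull Y)) (carrier (sect \<X> (pull Y))) (superfuns n m Y)"
    using Phi_bij[OF open_pull[OF assms(1,2)] pull_subset] image_pull[OF assms(2)] by simp
  then show "Psi Y F \<in> carrier (sect \<X> (pull Y))" "\<Phi> (pull Y) (Psi Y F) = F"
    using assms(3) unfolding Psi_def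
    by (metis bij_betw_def inv_into_into, metis bij_betw_def f_inv_into_f)
qed

lemma Psi_Phi:
  assumes "openin (body \<X>) W" "W \<subseteq> U" "f \<in> carrier (sect \<X> W)"
  shows "Psi (\<phi> ` W) (\<Phi> W f) = f"
  using Phi_bij[OF assms(1,2)] assms(3) unfolding Psi_def pull_image[OF assms(2)]
  by (simp add: bij_betw_def)

lemma Psi_eqI:
  assumes "open_in_Cspace n Y" "Y \<subseteq> \<phi> ` U" "f \<in> carrier (sect \<X> (pull Y))" "\<Phi> (pull Y) f = F"
  shows "Psi Y F = f"
  using Psi_Phi[OF open_pull[OF assms(1,2)] pull_subset assms(3)] assms(4) image_pull[OF assms(2)] by simp

lemma subchart:
  assumes "openin (body \<X>) W" "W \<subseteq> U"
  shows "super_chart n m \<X> W \<phi> \<Phi>"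
proof -
  have "homeomorphic_map (subtopology (subtopology (body \<X>) U) W) (subtopology (top_of_set (\<phi> ` U)) (\<phi> ` W)) \<phi>"
    by (rule homeomorphic_map_subtopologies[OF homeo]) (use assms(2) in \<open>auto simp: topspace_U simp del: topspace_subtopology\<close>)
  moreover have "subtopology (subtopology (body \<X>) U) W = subtopology (body \<X>) W"
    using assms(2) by (simp add: subtopology_subtopology inf.absorb2)
  moreover have "subtopology (top_of_set (\<phi> ` U)) (\<phi> ` W) = top_of_set (\<phi> ` W)"
    using assms(2) by (simp add: subtopology_subtopology inf.absorb2 image_mono)
  ultimately have h1: "homeomorphic_map (subtopology (body \<X>) W) (top_of_set (\<phi> ` W)) \<phi>" by simp
  have h2: "\<forall>Y. openin (body \<X>) Y \<and> Y \<subseteq> W \<longrightarrow> \<Phi> Y \<in> superalg_iso (sect \<X> Y) (superdomain n m (\<phi> ` Y))"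
    using Phi_iso assms(2) by blast
  have h3: "\<forall>Y Y'. openin (body \<X>) Y \<and> openin (body \<X>) Y' \<and> Y' \<subseteq> Y \<and> Y \<subseteq> W \<longrightarrow>
      (\<forall>f\<in>carrier (sect \<X> Y). \<Phi> Y' (restr \<X> Y Y' f) = superfun_restrict (\<phi> ` Y') (\<Phi> Y f))"
    using Phi_restr assms(2) by (meson order_trans)
  show ?thesis
    unfolding super_chart_def by (intro conjI assms(1) open_image[OF assms] h1 h2 h3)
qed

end

text \<open>The change of charts followed by evaluation at \<open>\<phi>' x\<close>. It inherits the
  algebra operations and the restrictions from the two charts, and so becomes subject to
  \<open>germ_hom.continuous\<close>.\<close>

lemma (in superalgebra_sheaf) transition_germ_hom:
  assumes "super_chart n m \<X> U \<phi> \<Phi>" "super_chart n m \<X> U \<phi>' \<Phi>'"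
    and x: "x \<in> U" and R: "polydisc n (\<phi> x) R \<subseteq> \<phi> ` U"
  shows "germ_hom n m (\<phi> x) R (\<lambda>s F L. \<Phi>' (chart.pull U \<phi> (polydisc n (\<phi> x) s))
    (chart.Psi \<X> U \<phi> \<Phi> (polydisc n (\<phi> x) s) F) L (\<phi>' x))"
proof -
  interpret A: chart \<X> n m U \<phi> \<Phi> by unfold_locales (rule assms)
  interpret B: chart \<X> n m U \<phi>' \<Phi>' by unfold_locales (rule assms)
  let ?D = "polydisc n (\<phi> x)"
  have p: "\<phi> x \<in> Cspace n" using x openin_imp_subset[OF A.open_image_U] by auto
  have D: "open_in_Cspace n (?D s)" "?D s \<subseteq> \<phi> ` U" if "s \<le> R" for s
    using open_polydisc R polydisc_mono[OF that, of n "\<phi> x"] by auto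
  have W: "openin (body \<X>) (A.pull (?D s))" "A.pull (?D s) \<subseteq> U" if "s \<le> R" for s
    using A.open_pull[OF D[OF that]] A.pull_subset by auto
  have q: "\<phi>' x \<in> \<phi>' ` A.pull (?D s)" if "0 < s" for s
    using x centre_in_polydisc[OF p that] by (auto simp: A.pull_def)
  have Psi: "A.Psi (?D s) F \<in> carrier (sect \<X> (A.pull (?D s)))" "\<Phi> (A.pull (?D s)) (A.Psi (?D s) F) = F"
    if "s \<le> R" "F \<in> superfuns n m (?D s)" for s F
    using A.Psi[OF D[OF that(1)] that(2)] by auto
  show ?thesis
  proof
    show "\<phi> x \<in> Cspace n" by (rule p)
  next
    fix s F G L assume s: "0 < s" "s \<le> R" and F: "F \<in> superfuns n m (?D s)" and G: "G \<in> superfuns n m (?D s)"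
    note [simp] = Psi[OF s(2) F] Psi[OF s(2) G]
    have "A.Psi (?D s) (\<lambda>I z. F I z + G I z) = A.Psi (?D s) F \<oplus>\<^bsub>sect \<X> (A.pull (?D s))\<^esub> A.Psi (?D s) G"
      by (rule A.Psi_eqI[OF D[OF s(2)]]) (simp_all add: sect_closed W[OF s(2)] A.Phi_add)
    then show "\<Phi>' (A.pull (?D s)) (A.Psi (?D s) (\<lambda>I z. F I z + G I z)) L (\<phi>' x) =
        \<Phi>' (A.pull (?D s)) (A.Psi (?D s) F) L (\<phi>' x) + \<Phi>' (A.pull (?D s)) (A.Psi (?D s) G) L (\<phi>' x)"
      by (simp add: B.Phi_add W[OF s(2)])
    have "A.Psi (?D s) (superfun_mult F G) = A.Psi (?D s) F \<otimes>\<^bsub>sect \<X> (A.pull (?D s))\<^esub> A.Psi (?D s) G"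
      by (rule A.Psi_eqI[OF D[OF s(2)]]) (simp_all add: sect_closed W[OF s(2)] A.Phi_mult)
    then show "\<Phi>' (A.pull (?D s)) (A.Psi (?D s) (superfun_mult F G)) L (\<phi>' x) =
        (\<Sum>J\<in>Pow L. shuffle_sign J (L - J) * \<Phi>' (A.pull (?D s)) (A.Psi (?D s) F) J (\<phi>' x) *
          \<Phi>' (A.pull (?D s)) (A.Psi (?D s) G) (L - J) (\<phi>' x))"
      by (simp add: B.Phi_mult W[OF s(2)] superfun_mult_def)
  next
    fix s F c L assume s: "0 < s" "s \<le> R" and F: "F \<in> superfuns n m (?D s)"
    note [simp] = Psi[OF s(2) F]
    have "A.Psi (?D s) (\<lambda>I z. c * F I z) = c \<odot>\<^bsub>sect \<X> (A.pull (?D s))\<^esub> A.Psi (?D s) F"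
      by (rule A.Psi_eqI[OF D[OF s(2)]]) (simp_all add: sect_closed W[OF s(2)] A.Phi_smult)
    then show "\<Phi>' (A.pull (?D s)) (A.Psi (?D s) (\<lambda>I z. c * F I z)) L (\<phi>' x) = c * \<Phi>' (A.pull (?D s)) (A.Psi (?D s) F) L (\<phi>' x)"
      by (simp add: B.Phi_smult W[OF s(2)])
  next
    fix s L assume s: "0 < s" "s \<le> R"
    have "A.Psi (?D s) (smono (?D s) {} (\<lambda>_. 1)) = \<one>\<^bsub>sect \<X> (A.pull (?D s))\<^esub>"
      by (rule A.Psi_eqI[OF D[OF s(2)]]) (simp_all add: sect_closed W[OF s(2)] A.Phi_one A.image_pull D[OF s(2)])
    then show "\<Phi>' (A.pull (?D s)) (A.Psi (?D s) (smono (?D s) {} (\<lambda>_. 1))) L (\<phi>' x) = (if L = {} then 1 else 0)"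
      using q[OF s(1)] by (simp add: B.Phi_one W[OF s(2)] smono_apply)
  next
    fix s t F L assume s: "0 < s" "s \<le> t" "t \<le> R" and F: "F \<in> superfuns n m (?D t)"
    have sR: "s \<le> R" using s by simp
    note [simp] = Psi[OF s(3) F]
    have sub: "A.pull (?D s) \<subseteq> A.pull (?D t)" using polydisc_mono[OF s(2), of n "\<phi> x"] by (auto simp: A.pull_def)
    have "A.Psi (?D s) (superfun_restrict (?D s) F) = restr \<X> (A.pull (?D t)) (A.pull (?D s)) (A.Psi (?D t) F)"
      using A.Phi_restr[OF W[OF s(3)] W(1)[OF sR] sub, of "A.Psi (?D t) F"] restr_simps(1)[OF W(1)[OF s(3)] W(1)[OF sR] sub]
      by (intro A.Psi_eqI[OF D[OF sR]]) (simp_all add: A.image_pull D[OF sR])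
    then show "\<Phi>' (A.pull (?D s)) (A.Psi (?D s) (superfun_restrict (?D s) F)) L (\<phi>' x) =
        \<Phi>' (A.pull (?D t)) (A.Psi (?D t) F) L (\<phi>' x)"
      using B.Phi_restr[OF W[OF s(3)] W(1)[OF sR] sub, of "A.Psi (?D t) F"] q[OF s(1)]
      by (simp add: superfun_restrict_def)
  qed
qed

section \<open>Odd vector fields in a chart\<close>

locale odd_vector_field_sheaf = superalgebra_sheaf \<X> for \<X> :: "('x, 's) superspace" +
  fixes v :: "('x, 's) sheaf_operator"
  assumes odd_v: "odd_vector_field \<X> v"
begin

lemma v_simps:
  assumes "openin (body \<X>) W"
  shows "f \<in> carrier (sect \<X> W) \<Longrightarrow> v W f \<in> carrier (sect \<X> W)"
    "f \<in> carrier (sect \<X> W) \<Longrightarrow> g \<in> carrier (sect \<X> W) \<Longrightarrow>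
      v W (f \<oplus>\<^bsub>sect \<X> W\<^esub> g) = v W f \<oplus>\<^bsub>sect \<X> W\<^esub> v W g"
    "f \<in> carrier (sect \<X> W) \<Longrightarrow> v W (c \<odot>\<^bsub>sect \<X> W\<^esub> f) = c \<odot>\<^bsub>sect \<X> W\<^esub> v W f"
    "q < 2 \<Longrightarrow> f \<in> grade (sect \<X> W) q \<Longrightarrow> v W f \<in> grade (sect \<X> W) ((1 + q) mod 2)"
    "q < 2 \<Longrightarrow> f \<in> grade (sect \<X> W) q \<Longrightarrow> g \<in> carrier (sect \<X> W) \<Longrightarrow>
      v W (f \<otimes>\<^bsub>sect \<X> W\<^esub> g) = (v W f \<otimes>\<^bsub>sect \<X> W\<^esub> g) \<oplus>\<^bsub>sect \<X> W\<^esub>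
         ((- 1) ^ q \<odot>\<^bsub>sect \<X> W\<^esub> (f \<otimes>\<^bsub>sect \<X> W\<^esub> v W g))"
  using odd_v[unfolded odd_vector_field_def sheaf_endomorphism_def] assms
  by (simp_all add: image_subset_iff)

lemma v_restr:
  "\<lbrakk>openin (body \<X>) U; openin (body \<X>) W; W \<subseteq> U; f \<in> carrier (sect \<X> U)\<rbrakk> \<Longrightarrow>
    v W (restr \<X> U W f) = restr \<X> U W (v U f)"
  using odd_v[unfolded odd_vector_field_def sheaf_endomorphism_def] by simp

lemma funpow_v_simps:
  assumes "openin (body \<X>) W" "f \<in> carrier (sect \<X> W)"
  shows "(v W ^^ k) f \<in> carrier (sect \<X> W)"
    "g \<in> carrier (sect \<X> W) \<Longrightarrow> (v W ^^ k) (f \<oplus>\<^bsub>sect \<X> W\<^esub> g) = (v W ^^ k) f \<oplus>\<^bsub>sect \<X> W\<^esub> (v W ^^ k) g"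
    "(v W ^^ k) (c \<odot>\<^bsub>sect \<X> W\<^esub> f) = c \<odot>\<^bsub>sect \<X> W\<^esub> (v W ^^ k) f"
proof -
  have cl: "(v W ^^ k) h \<in> carrier (sect \<X> W)" if "h \<in> carrier (sect \<X> W)" for k h
    using that by (induction k) (auto simp: v_simps assms)
  then show "(v W ^^ k) f \<in> carrier (sect \<X> W)" using assms by blast
  show "(v W ^^ k) (f \<oplus>\<^bsub>sect \<X> W\<^esub> g) = (v W ^^ k) f \<oplus>\<^bsub>sect \<X> W\<^esub> (v W ^^ k) g" if "g \<in> carrier (sect \<X> W)"
    using that assms by (induction k) (auto simp: v_simps cl)
  show "(v W ^^ k) (c \<odot>\<^bsub>sect \<X> W\<^esub> f) = c \<odot>\<^bsub>sect \<X> W\<^esub> (v W ^^ k) f"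
    using assms by (induction k) (auto simp: v_simps cl)
qed

lemma funpow_v_restr:
  assumes "openin (body \<X>) U" "openin (body \<X>) W" "W \<subseteq> U" "f \<in> carrier (sect \<X> U)"
  shows "(v W ^^ k) (restr \<X> U W f) = restr \<X> U W ((v U ^^ k) f)"
  using assms by (induction k) (auto simp: v_restr funpow_v_simps)

end

locale odd_vector_field_chart = odd_vector_field_sheaf \<X> v + chart \<X> n m U \<phi> \<Phi>
  for \<X> :: "('x, 's) superspace" and v n m U \<phi> \<Phi>
begin

definition Dop :: "(nat \<Rightarrow> complex) set \<Rightarrow> superfun \<Rightarrow> superfun" where
  "Dop Y F = \<Phi> (pull Y) (v (pull Y) (Psi Y F))"

lemma Dop_Phi:
  assumes "openin (body \<X>) W" "W \<subseteq> U" "f \<in> carrier (sect \<X> W)"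
  shows "Dop (\<phi> ` W) (\<Phi> W f) = \<Phi> W (v W f)"
  using assms by (simp add: Dop_def Psi_Phi pull_image)

lemma funpow_Dop_Phi:
  assumes "openin (body \<X>) W" "W \<subseteq> U" "f \<in> carrier (sect \<X> W)"
  shows "(Dop (\<phi> ` W) ^^ k) (\<Phi> W f) = \<Phi> W ((v W ^^ k) f)"
  using assms by (induction k) (auto simp: Dop_Phi funpow_v_simps)

lemma section_of:
  assumes "open_in_Cspace n Y" "Y \<subseteq> \<phi> ` U"
  obtains W where "openin (body \<X>) W" "W \<subseteq> U" "Y = \<phi> ` W"
    "\<And>F. F \<in> superfuns n m Y \<Longrightarrow> \<exists>f\<in>carrier (sect \<X> W). F = \<Phi> W f"
  using that[OF open_pull[OF assms] pull_subset] image_pull[OF assms(2)] Psi[OF assms] by metis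

lemma Dop_superdomain_operator: "superdomain_operator n m (\<phi> ` U) Dop"
proof
  show "open_in_Cspace n (\<phi> ` U)" by (rule open_image_U)
next
  fix Y F assume Y: "open_in_Cspace n Y" "Y \<subseteq> \<phi> ` U" and F: "F \<in> superfuns n m Y"
  obtain W where W: "openin (body \<X>) W" "W \<subseteq> U" "Y = \<phi> ` W"
    "\<And>F. F \<in> superfuns n m Y \<Longrightarrow> \<exists>f\<in>carrier (sect \<X> W). F = \<Phi> W f" using section_of[OF Y] by blast
  obtain f where f: "f \<in> carrier (sect \<X> W)" "F = \<Phi> W f" using W(4)[OF F] by blast
  show "Dop Y F \<in> superfuns n m Y"
    using f W by (simp add: Dop_Phi Phi_closed v_simps)
  show "Dop Y (\<lambda>I z. c * F I z) = (\<lambda>I z. c * Dop Y F I z)" for c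
  proof -
    have "Dop (\<phi> ` W) (\<Phi> W (c \<odot>\<^bsub>sect \<X> W\<^esub> f)) = \<Phi> W (c \<odot>\<^bsub>sect \<X> W\<^esub> v W f)"
      using Dop_Phi[OF W(1,2) sect_closed(4)[OF W(1) f(1)]] v_simps(3)[OF W(1) f(1)] by simp
    then show ?thesis
      using Phi_smult[OF W(1,2)] f v_simps(1)[OF W(1)] Dop_Phi[OF W(1,2) f(1)] W(3) by simp
  qed
  show "Dop Y (\<lambda>I z. F I z + G I z) = (\<lambda>I z. Dop Y F I z + Dop Y G I z)" if G: "G \<in> superfuns n m Y" for G
  proof -
    obtain g where g: "g \<in> carrier (sect \<X> W)" "G = \<Phi> W g" using W(4)[OF G] by blast
    have "Dop (\<phi> ` W) (\<Phi> W (f \<oplus>\<^bsub>sect \<X> W\<^esub> g)) = \<Phi> W (v W f \<oplus>\<^bsub>sect \<X> W\<^esub> v W g)"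
      using Dop_Phi[OF W(1,2) sect_closed(1)[OF W(1) f(1) g(1)]] v_simps(2)[OF W(1) f(1) g(1)] by simp
    then show ?thesis
      using Phi_add[OF W(1,2)] f g v_simps(1)[OF W(1)] Dop_Phi[OF W(1,2) f(1)] Dop_Phi[OF W(1,2) g(1)] W(3) by simp
  qed
next
  fix Y Y' F assume Y: "open_in_Cspace n Y" "open_in_Cspace n Y'" "Y' \<subseteq> Y" "Y \<subseteq> \<phi> ` U" and F: "F \<in> superfuns n m Y"
  have Y'U: "Y' \<subseteq> \<phi> ` U" using Y by auto
  have sub: "pull Y' \<subseteq> pull Y" using Y(3) by (auto simp: pull_def)
  note W = open_pull[OF Y(1,4)] pull_subset[of Y] and W' = open_pull[OF Y(2) Y'U] pull_subset[of Y']
  note f = Psi[OF Y(1,4) F]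
  have "superfun_restrict Y' F = \<Phi> (pull Y') (restr \<X> (pull Y) (pull Y') (Psi Y F))"
    using Phi_restr[OF W W'(1) sub f(1)] f(2) image_pull[OF Y'U] by simp
  then have "Dop Y' (superfun_restrict Y' F) = \<Phi> (pull Y') (v (pull Y') (restr \<X> (pull Y) (pull Y') (Psi Y F)))"
    using Dop_Phi[OF W' restr_simps(1)[OF W(1) W'(1) sub f(1)]] image_pull[OF Y'U] by simp
  also have "\<dots> = superfun_restrict Y' (\<Phi> (pull Y) (v (pull Y) (Psi Y F)))"
    using v_restr[OF W(1) W'(1) sub f(1)] Phi_restr[OF W W'(1) sub v_simps(1)[OF W(1) f(1)]] image_pull[OF Y'U] by simp
  finally show "Dop Y' (superfun_restrict Y' F) = superfun_restrict Y' (Dop Y F)" by (simp add: Dop_def)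
qed

text \<open>Multiplication by \<open>a\<close> corresponds to an even section \<open>b\<close>, so
  the first rule has no sign. In the second, \<open>v W b\<close> is odd, and moving the field past
  it produces the minus sign.\<close>

lemma Dop_leibniz:
  assumes Y: "open_in_Cspace n Y" "Y \<subseteq> \<phi> ` U" and F: "F \<in> superfuns n m Y" and a: "several_holomorphic_on n Y a"
  shows "Dop Y (\<lambda>I z. a z * F I z) = (\<lambda>I z. superfun_mult (Dop Y (smono Y {} a)) F I z + a z * Dop Y F I z)"
    "Dop Y (superfun_mult (Dop Y (smono Y {} a)) F) =
      (\<lambda>I z. superfun_mult (Dop Y (Dop Y (smono Y {} a))) F I z - superfun_mult (Dop Y (smono Y {} a)) (Dop Y F) I z)"
proof -
  interpret D: superdomain_operator n m "\<phi> ` U" Dop by (rule Dop_superdomain_operator)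
  obtain W where W: "openin (body \<X>) W" "W \<subseteq> U" "Y = \<phi> ` W"
    "\<And>F. F \<in> superfuns n m Y \<Longrightarrow> \<exists>f\<in>carrier (sect \<X> W). F = \<Phi> W f" using section_of[OF Y] by blast
  obtain f where f: "f \<in> carrier (sect \<X> W)" "F = \<Phi> W f" using W(4)[OF F] by blast
  have "smono Y {} a \<in> superfuns n m Y" by (intro smono_in_superfuns Y a) auto
  then obtain b where b: "b \<in> carrier (sect \<X> W)" "smono Y {} a = \<Phi> W b" using W(4) by blast
  have b0: "b \<in> grade (sect \<X> W) 0" using even_preimage[OF W(1,2) b(1)] b(2) W(3) by metis
  have b1: "v W b \<in> grade (sect \<X> W) 1" using v_simps(4)[OF W(1) _ b0] by simp
  have DF: "Dop Y F = \<Phi> W (v W f)" and Db: "Dop Y (smono Y {} a) = \<Phi> W (v W b)"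
    using Dop_Phi[OF W(1,2)] f b W(3) by auto
  have DDb: "Dop Y (\<Phi> W (v W b)) = \<Phi> W (v W (v W b))"
    using Dop_Phi[OF W(1,2) v_simps(1)[OF W(1) b(1)]] W(3) by simp
  note cl = v_simps(1)[OF W(1)] sect_closed[OF W(1)] f(1) b(1)
  have "(\<lambda>I z. a z * F I z) = \<Phi> W (b \<otimes>\<^bsub>sect \<X> W\<^esub> f)"
    using superfun_mult_scalar[OF F, of a] Phi_mult[OF W(1,2) b(1) f(1)] b(2) f(2) by simp
  then have "Dop Y (\<lambda>I z. a z * F I z) = \<Phi> W (v W (b \<otimes>\<^bsub>sect \<X> W\<^esub> f))"
    using Dop_Phi[OF W(1,2)] W(3) cl by simp
  also have "\<dots> = \<Phi> W ((v W b \<otimes>\<^bsub>sect \<X> W\<^esub> f) \<oplus>\<^bsub>sect \<X> W\<^esub> ((- 1) ^ 0 \<odot>\<^bsub>sect \<X> W\<^esub> (b \<otimes>\<^bsub>sect \<X> W\<^esub> v W f)))"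
    using v_simps(5)[OF W(1) _ b0 f(1)] by simp
  also have "\<dots> = (\<lambda>I z. superfun_mult (\<Phi> W (v W b)) (\<Phi> W f) I z + superfun_mult (\<Phi> W b) (\<Phi> W (v W f)) I z)"
    using cl by (simp add: Phi_add[OF W(1,2)] Phi_mult[OF W(1,2)] Phi_smult[OF W(1,2)])
  also have "superfun_mult (\<Phi> W b) (\<Phi> W (v W f)) = (\<lambda>I z. a z * Dop Y F I z)"
    using superfun_mult_scalar[OF D.closed[OF Y F], of a] DF b(2) by simp
  finally show "Dop Y (\<lambda>I z. a z * F I z) = (\<lambda>I z. superfun_mult (Dop Y (smono Y {} a)) F I z + a z * Dop Y F I z)"
    using Db f by simp
  have "superfun_mult (Dop Y (smono Y {} a)) F = \<Phi> W (v W b \<otimes>\<^bsub>sect \<X> W\<^esub> f)"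
    using Phi_mult[OF W(1,2) cl(1)[OF b(1)] f(1)] Db f by simp
  then have "Dop Y (superfun_mult (Dop Y (smono Y {} a)) F) = \<Phi> W (v W (v W b \<otimes>\<^bsub>sect \<X> W\<^esub> f))"
    using Dop_Phi[OF W(1,2)] W(3) cl by simp
  also have "\<dots> = \<Phi> W ((v W (v W b) \<otimes>\<^bsub>sect \<X> W\<^esub> f) \<oplus>\<^bsub>sect \<X> W\<^esub> ((- 1) ^ 1 \<odot>\<^bsub>sect \<X> W\<^esub> (v W b \<otimes>\<^bsub>sect \<X> W\<^esub> v W f)))"
    using v_simps(5)[OF W(1) _ b1 f(1)] by simp
  also have "\<dots> = (\<lambda>I z. superfun_mult (\<Phi> W (v W (v W b))) (\<Phi> W f) I z - superfun_mult (\<Phi> W (v W b)) (\<Phi> W (v W f)) I z)"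
    using cl by (simp add: Phi_add[OF W(1,2)] Phi_mult[OF W(1,2)] Phi_smult[OF W(1,2)])
  finally show "Dop Y (superfun_mult (Dop Y (smono Y {} a)) F) =
      (\<lambda>I z. superfun_mult (Dop Y (Dop Y (smono Y {} a))) F I z - superfun_mult (Dop Y (smono Y {} a)) (Dop Y F) I z)"
    unfolding Db DDb DF unfolding f(2) .
qed

text \<open>In the second application the product of \<open>D a\<close> and \<open>D F\<close>
  arises twice: with a minus sign from passing the odd factor \<open>D a\<close>, and with a plus
  sign from differentiating the even factor \<open>a\<close>. The two cancel, so the square is a
  derivation.\<close>

lemma Dop_odd_derivation: "odd_superdomain_derivation n m (\<phi> ` U) Dop"
proof -
  interpret D: superdomain_operator n m "\<phi> ` U" Dop by (rule Dop_superdomain_operator)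
  have "superdomain_derivation n m (\<phi> ` U) Dop"
    by unfold_locales (rule Dop_leibniz(1))
  moreover have "superdomain_operator n m (\<phi> ` U) (\<lambda>W F. Dop W (Dop W F))"
    using D.funpow[of 2] by (simp add: numeral_2_eq_2 comp_def)
  then have "superdomain_derivation n m (\<phi> ` U) (\<lambda>W F. Dop W (Dop W F))"
  proof (intro superdomain_derivation.intro superdomain_derivation_axioms.intro)
    fix Y F a assume Y: "open_in_Cspace n Y" "Y \<subseteq> \<phi> ` U" and F: "F \<in> superfuns n m Y" and a: "several_holomorphic_on n Y a"
    let ?A = "smono Y {} a"
    have A: "?A \<in> superfuns n m Y" by (intro smono_in_superfuns Y a) auto
    have "Dop Y (Dop Y (\<lambda>I z. a z * F I z)) = (\<lambda>I z. Dop Y (superfun_mult (Dop Y ?A) F) I z + Dop Y (\<lambda>I z. a z * Dop Y F I z) I z)"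
      unfolding Dop_leibniz(1)[OF Y F a]
      by (intro D.add Y superfuns_mult superfuns_scale a D.closed F A)
    then show "Dop Y (Dop Y (\<lambda>I z. a z * F I z)) =
        (\<lambda>I z. superfun_mult (Dop Y (Dop Y ?A)) F I z + a z * Dop Y (Dop Y F) I z)"
      unfolding Dop_leibniz(2)[OF Y F a] Dop_leibniz(1)[OF Y D.closed[OF Y F] a] by simp
  qed
  ultimately show ?thesis by (rule odd_superdomain_derivation.intro)
qed

sublocale D: odd_superdomain_derivation n m "\<phi> ` U" Dop
  by (rule Dop_odd_derivation)

end

section \<open>The exponential of an odd vector field\<close>

context odd_vector_field_sheaf
begin

text \<open>Asking for convergence in every chart inside \<open>W\<close> makes the notion
  independent of coordinates and stable under restriction. Pointwise sums already determine
  \<open>t\<close>; uniform convergence on compact sets is recovered from the chart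
  estimates.\<close>

definition is_exp :: "nat \<Rightarrow> nat \<Rightarrow> 'x set \<Rightarrow> 's \<Rightarrow> 's \<Rightarrow> bool" where
  "is_exp n m W f t \<longleftrightarrow> t \<in> carrier (sect \<X> W) \<and>
    (\<forall>U \<phi> \<Phi>. super_chart n m \<X> U \<phi> \<Phi> \<and> U \<subseteq> W \<longrightarrow> (\<forall>L\<subseteq>{..<m}. \<forall>z\<in>\<phi> ` U.
       (\<lambda>j. \<Phi> U (restr \<X> W U ((v W ^^ j) f)) L z / fact j) sums \<Phi> U (restr \<X> W U t) L z))"

lemma is_exp_sums:
  assumes "is_exp n m W f t" "super_chart n m \<X> U \<phi> \<Phi>" "U \<subseteq> W" "L \<subseteq> {..<m}" "z \<in> \<phi> ` U"
  shows "(\<lambda>j. \<Phi> U (restr \<X> W U ((v W ^^ j) f)) L z / fact j) sums \<Phi> U (restr \<X> W U t) L z"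
  using assms unfolding is_exp_def by blast

lemma is_expI:
  assumes "t \<in> carrier (sect \<X> W)"
    "\<And>U \<phi> \<Phi> L z. \<lbrakk>super_chart n m \<X> U \<phi> \<Phi>; U \<subseteq> W; L \<subseteq> {..<m}; z \<in> \<phi> ` U\<rbrakk> \<Longrightarrow>
      (\<lambda>j. \<Phi> U (restr \<X> W U ((v W ^^ j) f)) L z / fact j) sums \<Phi> U (restr \<X> W U t) L z"
  shows "is_exp n m W f t"
  unfolding is_exp_def using assms(1) by (intro conjI allI impI ballI assms(2)) simp_all

lemma is_exp_closed: "is_exp n m W f t \<Longrightarrow> t \<in> carrier (sect \<X> W)"
  by (simp add: is_exp_def)

lemma super_chart_open: "super_chart n m \<X> U \<phi> \<Phi> \<Longrightarrow> openin (body \<X>) U"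
  by (simp add: super_chart_def)

lemma is_exp_restr:
  assumes W: "openin (body \<X>) W" "openin (body \<X>) W'" "W' \<subseteq> W" and f: "f \<in> carrier (sect \<X> W)"
    and t: "is_exp n m W f t"
  shows "is_exp n m W' (restr \<X> W W' f) (restr \<X> W W' t)"
proof (rule is_expI)
  show "restr \<X> W W' t \<in> carrier (sect \<X> W')" using restr_simps(1)[OF W is_exp_closed[OF t]] .
  fix U \<phi> \<Phi> L z assume U: "super_chart n m \<X> U \<phi> \<Phi>" "U \<subseteq> W'" and Lz: "L \<subseteq> {..<m}" "z \<in> \<phi> ` U"
  have oU: "openin (body \<X>) U" using U(1) by (rule super_chart_open)
  have rr: "restr \<X> W' U (restr \<X> W W' h) = restr \<X> W U h" if "h \<in> carrier (sect \<X> W)" for h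
    using restr_restr[OF W(1,2) oU U(2) W(3) that] .
  have "restr \<X> W' U ((v W' ^^ j) (restr \<X> W W' f)) = restr \<X> W U ((v W ^^ j) f)" for j
    unfolding funpow_v_restr[OF W f] by (rule rr[OF funpow_v_simps(1)[OF W(1) f]])
  then show "(\<lambda>j. \<Phi> U (restr \<X> W' U ((v W' ^^ j) (restr \<X> W W' f))) L z / fact j)
      sums \<Phi> U (restr \<X> W' U (restr \<X> W W' t)) L z"
    using is_exp_sums[OF t U(1) _ Lz] U(2) W(3) rr[OF is_exp_closed[OF t]] by simp
qed

lemma is_exp_chart_unique:
  assumes c: "super_chart n m \<X> U \<phi> \<Phi>" and s: "is_exp n m U f s" and t: "is_exp n m U f t"
  shows "s = t"
proof -
  interpret C: chart \<X> n m U \<phi> \<Phi> by unfold_locales (rule c)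
  have st: "s \<in> carrier (sect \<X> U)" "t \<in> carrier (sect \<X> U)" using s t by (auto simp: is_exp_def)
  have "\<Phi> U (restr \<X> U U s) L z = \<Phi> U (restr \<X> U U t) L z" if "L \<subseteq> {..<m}" "z \<in> \<phi> ` U" for L z
    using is_exp_sums[OF s c order_refl that] is_exp_sums[OF t c order_refl that] by (rule sums_unique2)
  then have "\<Phi> U s = \<Phi> U t"
    using st by (intro superfuns_eqI[OF C.Phi_closed C.Phi_closed]) (auto simp: C.open_U restr_id)
  then show ?thesis using C.Phi_inject[OF C.open_U order_refl st] by simp
qed

end

context odd_vector_field_chart
begin

lemma sums_exp_op:
  assumes "f \<in> carrier (sect \<X> U)"
  shows "(\<lambda>j. \<Phi> U ((v U ^^ j) f) L z / fact j) sums D.exp_op (\<phi> ` U) (\<Phi> U f) L z"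
  using D.exp_summable[OF open_image_U order_refl Phi_closed[OF open_U order_refl assms], of L z]
  by (simp add: D.exp_op_def summable_sums funpow_Dop_Phi[OF open_U order_refl assms])

text \<open>Near \<open>x\<close> the series converges uniformly in the first chart. The change of
  charts evaluated at \<open>x\<close> is a continuous functional there, so it sends the remainders
  to a null sequence, and their images are the remainders at \<open>z\<close> in the second
  chart.\<close>

lemma sums_transition:
  assumes c: "super_chart n m \<X> U \<phi>' \<Phi>'" and f: "f \<in> carrier (sect \<X> U)"
    and t: "t \<in> carrier (sect \<X> U)" "\<Phi> U t = D.exp_op (\<phi> ` U) (\<Phi> U f)"
    and L: "L \<subseteq> {..<m}" and z: "z \<in> \<phi>' ` U"
  shows "(\<lambda>j. \<Phi>' U ((v U ^^ j) f) L z / fact j) sums \<Phi>' U t L z"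
proof -
  interpret B: chart \<X> n m U \<phi>' \<Phi>' by unfold_locales (rule c)
  obtain x where x: "x \<in> U" "z = \<phi>' x" using z by blast
  let ?V = "\<phi> ` U" and ?F = "\<Phi> U f"
  have F: "?F \<in> superfuns n m ?V" by (rule Phi_closed[OF open_U order_refl f])
  have px: "\<phi> x \<in> ?V" using x by simp
  from D.exp_partial_sums[OF open_image_U order_refl F px]
  obtain R where R: "R > 0" "polydisc n (\<phi> x) R \<subseteq> ?V"
    "\<forall>L\<subseteq>{..<m}. uniform_limit (polydisc n (\<phi> x) R) (\<lambda>N z. \<Sum>j<N. (Dop ?V ^^ j) ?F L z / fact j) (D.exp_op ?V ?F L) sequentially \<and>
    (\<forall>z\<in>polydisc n (\<phi> x) R. summable (\<lambda>j. (Dop ?V ^^ j) ?F L z / fact j))"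
    by (elim exE conjE)
  let ?D = "polydisc n (\<phi> x) R"
  let ?W = "pull ?D"
  interpret G: germ_hom n m "\<phi> x" R "\<lambda>s F L. \<Phi>' (pull (polydisc n (\<phi> x) s)) (Psi (polydisc n (\<phi> x) s) F) L (\<phi>' x)"
    by (rule transition_germ_hom[OF super_chart c x(1) R(2)])
  define \<tau> where "\<tau> = (\<lambda>F. \<Phi>' ?W (Psi ?D F) L (\<phi>' x))"
  obtain C where C: "C \<ge> 0" "\<And>F B. F \<in> superfuns n m ?D \<Longrightarrow> bounded_on m ?D F B \<Longrightarrow> cmod (\<tau> F) \<le> C * B"
    using G.continuous[OF R(1) order_refl L] unfolding \<tau>_def by blast
  have W: "openin (body \<X>) ?W" "?W \<subseteq> U" using open_pull[OF open_polydisc R(2)] pull_subset by auto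
  have xW: "\<phi>' x \<in> \<phi>' ` ?W"
    using x centre_in_polydisc[of "\<phi> x" n R] px openin_imp_subset[OF open_image_U] R(1) by (auto simp: pull_def)
  have \<tau>: "superfun_restrict ?D (\<Phi> U h) \<in> superfuns n m ?D \<and> \<tau> (superfun_restrict ?D (\<Phi> U h)) = \<Phi>' U h L z"
    if h: "h \<in> carrier (sect \<X> U)" for h
  proof -
    have hW: "restr \<X> U ?W h \<in> carrier (sect \<X> ?W)" by (rule restr_simps(1)[OF open_U W h])
    have "superfun_restrict ?D (\<Phi> U h) = \<Phi> ?W (restr \<X> U ?W h)"
      using Phi_restr[OF open_U order_refl W h] image_pull[OF R(2)] by simp
    moreover have "Psi ?D (\<Phi> ?W (restr \<X> U ?W h)) = restr \<X> U ?W h"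
      using Psi_Phi[OF W hW] image_pull[OF R(2)] by simp
    moreover have "\<Phi>' ?W (restr \<X> U ?W h) L z = \<Phi>' U h L z"
      using B.Phi_restr[OF open_U order_refl W h] xW x(2) by (simp add: superfun_restrict_def)
    moreover have "\<Phi> ?W (restr \<X> U ?W h) \<in> superfuns n m ?D"
      using Phi_closed[OF W hW] image_pull[OF R(2)] by simp
    ultimately show ?thesis by (simp add: \<tau>_def x(2))
  qed
  define h where "h j = (v U ^^ j) f" for j
  have h: "h j \<in> carrier (sect \<X> U)" for j unfolding h_def by (rule funpow_v_simps(1)[OF open_U f])
  have hD: "(Dop ?V ^^ j) ?F = \<Phi> U (h j)" for j
    unfolding h_def by (rule funpow_Dop_Phi[OF open_U order_refl f])
  let ?r = "\<lambda>h. superfun_restrict ?D (\<Phi> U h)"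
  have lin: "\<tau> (\<lambda>I y. (\<Sum>j<N. (1 / fact j) * ?r (h j) I y) + (- 1) * ?r t I y) = (\<Sum>j<N. \<Phi>' U (h j) L z / fact j) - \<Phi>' U t L z" for N
  proof -
    have s1: "(\<lambda>I y. (1 / fact j) * ?r (h j) I y) \<in> superfuns n m ?D" for j
      using \<tau>[OF h] by (intro superfuns_smult) blast
    have s2: "(\<lambda>I y. \<Sum>j<N. (1 / fact j) * ?r (h j) I y) \<in> superfuns n m ?D" by (intro superfuns_sum s1)
    have s3: "(\<lambda>I y. (- 1) * ?r t I y) \<in> superfuns n m ?D" using \<tau>[OF t(1)] by (intro superfuns_smult) blast
    have 1: "\<tau> (\<lambda>I y. (\<Sum>j<N. (1 / fact j) * ?r (h j) I y) + (- 1) * ?r t I y) =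
        \<tau> (\<lambda>I y. \<Sum>j<N. (1 / fact j) * ?r (h j) I y) + \<tau> (\<lambda>I y. (- 1) * ?r t I y)"
      unfolding \<tau>_def by (rule G.add[OF R(1) order_refl s2 s3])
    have 2: "\<tau> (\<lambda>I y. \<Sum>j<N. (1 / fact j) * ?r (h j) I y) = (\<Sum>j<N. \<tau> (\<lambda>I y. (1 / fact j) * ?r (h j) I y))"
      unfolding \<tau>_def by (rule G.sum[OF R(1) order_refl _ s1]) simp
    have 3: "\<tau> (\<lambda>I y. c * ?r g I y) = c * \<Phi>' U g L z" if "g \<in> carrier (sect \<X> U)" for c g
    proof -
      have "\<tau> (\<lambda>I y. c * ?r g I y) = c * \<tau> (?r g)"
        unfolding \<tau>_def by (rule G.smult[OF R(1) order_refl]) (use \<tau>[OF that] in blast)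
      then show ?thesis using \<tau>[OF that] by simp
    qed
    show ?thesis unfolding 1 2 3[OF h] 3[OF t(1)] by simp
  qed
  have mem: "(\<lambda>I y. (\<Sum>j<N. (1 / fact j) * ?r (h j) I y) + (- 1) * ?r t I y) \<in> superfuns n m ?D" for N
    using \<tau>[OF h] \<tau>[OF t(1)] by (intro superfuns_add superfuns_sum superfuns_smult) blast+
  have "(\<lambda>N. \<Sum>j<N. \<Phi>' U (h j) L z / fact j) \<longlonglongrightarrow> \<Phi>' U t L z"
  proof (rule tendstoI)
    fix e :: real assume e: "e > 0"
    define e' where "e' = e / (C + 1)"
    have e': "e' > 0" "C * e' < e" using e C(1) by (simp_all add: e'_def divide_simps)
    have "\<forall>\<^sub>F N in sequentially. \<forall>I\<in>Pow {..<m}. \<forall>y\<in>?D. dist (\<Sum>j<N. (Dop ?V ^^ j) ?F I y / fact j) (D.exp_op ?V ?F I y) < e'"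
    proof (rule eventually_ball_finite)
      show "\<forall>I\<in>Pow {..<m}. \<forall>\<^sub>F N in sequentially. \<forall>y\<in>?D.
          dist (\<Sum>j<N. (Dop ?V ^^ j) ?F I y / fact j) (D.exp_op ?V ?F I y) < e'"
      proof
        fix I assume "I \<in> Pow {..<m}"
        then have "uniform_limit ?D (\<lambda>N z. \<Sum>j<N. (Dop ?V ^^ j) ?F I z / fact j) (D.exp_op ?V ?F I) sequentially"
          using R(3)[rule_format, of I] by simp
        then show "\<forall>\<^sub>F N in sequentially. \<forall>y\<in>?D.
            dist (\<Sum>j<N. (Dop ?V ^^ j) ?F I y / fact j) (D.exp_op ?V ?F I y) < e'"
          by (rule uniform_limitD) (rule e'(1))
      qed
    qed simp
    then show "\<forall>\<^sub>F N in sequentially. dist (\<Sum>j<N. \<Phi>' U (h j) L z / fact j) (\<Phi>' U t L z) < e"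
    proof eventually_elim
      case (elim N)
      have "bounded_on m ?D (\<lambda>I y. (\<Sum>j<N. (1 / fact j) * ?r (h j) I y) + (- 1) * ?r t I y) e'"
        unfolding bounded_on_def
      proof (intro allI impI ballI)
        fix I y assume "I \<subseteq> {..<m}" "y \<in> ?D"
        then have "cmod ((\<Sum>j<N. \<Phi> U (h j) I y / fact j) - \<Phi> U t I y) \<le> e'"
          using elim by (auto simp: dist_norm hD t(2) less_imp_le)
        then show "cmod ((\<Sum>j<N. (1 / fact j) * ?r (h j) I y) + (- 1) * ?r t I y) \<le> e'"
          using \<open>y \<in> ?D\<close> by (simp add: superfun_restrict_def)
      qed
      from C(2)[OF mem this] show ?case unfolding lin using e'(2) by (simp add: dist_norm)
    qed
  qed
  then show ?thesis by (simp add: sums_def h_def)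
qed

text \<open>The sum is formed in one chart, while a second chart may live on a smaller set
  \<open>U'\<close>. Restricting the first chart to \<open>U'\<close> gives two charts with the same
  domain, the situation of \<open>sums_transition\<close>.\<close>

lemma ex_is_exp:
  assumes f: "f \<in> carrier (sect \<X> U)"
  shows "\<exists>t. is_exp n m U f t"
proof -
  have F: "\<Phi> U f \<in> superfuns n m (\<phi> ` U)" by (rule Phi_closed[OF open_U order_refl f])
  have "D.exp_op (\<phi> ` U) (\<Phi> U f) \<in> superfuns n m (\<phi> ` U)"
    by (rule superdomain_operator.closed[OF D.exp_op_superdomain_operator open_image_U order_refl F])
  then obtain t where t: "t \<in> carrier (sect \<X> U)" "\<Phi> U t = D.exp_op (\<phi> ` U) (\<Phi> U f)"
    using Phi_bij[OF open_U order_refl] unfolding bij_betw_def by (metis imageE)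
  have "is_exp n m U f t"
  proof (rule is_expI[OF t(1)])
    fix U' \<phi>' \<Phi>' L z assume c: "super_chart n m \<X> U' \<phi>' \<Phi>'" and U': "U' \<subseteq> U" and Lz: "L \<subseteq> {..<m}" "z \<in> \<phi>' ` U'"
    have oU': "openin (body \<X>) U'" by (rule super_chart_open[OF c])
    interpret C: odd_vector_field_chart \<X> v n m U' \<phi> \<Phi>
      by unfold_locales (rule subchart[OF oU' U'])
    let ?f = "restr \<X> U U' f" and ?t = "restr \<X> U U' t"
    have f': "?f \<in> carrier (sect \<X> U')" and t': "?t \<in> carrier (sect \<X> U')"
      by (rule restr_simps(1)[OF open_U oU' U'], fact)+
    have "\<Phi> U' ?t L z = C.D.exp_op (\<phi> ` U') (\<Phi> U' ?f) L z" for L z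
    proof (cases "L \<subseteq> {..<m} \<and> z \<in> \<phi> ` U'")
      case True
      have "\<Phi> U' (restr \<X> U U' ((v U ^^ j) f)) L z = \<Phi> U ((v U ^^ j) f) L z" for j
        using Phi_restr[OF open_U order_refl oU' U' funpow_v_simps(1)[OF open_U f]] True by (simp add: superfun_restrict_def)
      then have "(\<lambda>j. \<Phi> U ((v U ^^ j) f) L z / fact j) sums C.D.exp_op (\<phi> ` U') (\<Phi> U' ?f) L z"
        using C.sums_exp_op[OF f', of L z] by (simp add: funpow_v_restr[OF open_U oU' U' f])
      moreover have "(\<lambda>j. \<Phi> U ((v U ^^ j) f) L z / fact j) sums \<Phi> U t L z"
        unfolding t(2) by (rule sums_exp_op[OF f])
      ultimately have "C.D.exp_op (\<phi> ` U') (\<Phi> U' ?f) L z = \<Phi> U t L z" by (rule sums_unique2)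
      then show ?thesis
        using Phi_restr[OF open_U order_refl oU' U' t(1)] True by (simp add: superfun_restrict_def)
    next
      case False
      have "C.D.exp_op (\<phi> ` U') (\<Phi> U' ?f) \<in> superfuns n m (\<phi> ` U')"
        by (rule superdomain_operator.closed[OF C.D.exp_op_superdomain_operator C.open_image_U order_refl
              C.Phi_closed[OF oU' order_refl f']])
      then show ?thesis
        using superfun_eq_0[OF _ False] C.Phi_closed[OF oU' order_refl t'] by metis
    qed
    then have "\<Phi> U' ?t = C.D.exp_op (\<phi> ` U') (\<Phi> U' ?f)" by (intro ext)
    from C.sums_transition[OF c f' t' this Lz]
    show "(\<lambda>j. \<Phi>' U' (restr \<X> U U' ((v U ^^ j) f)) L z / fact j) sums \<Phi>' U' (restr \<X> U U' t) L z"
      by (simp add: funpow_v_restr[OF open_U oU' U' f])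
  qed
  then show ?thesis ..
qed

end

section \<open>Gluing the local exponentials\<close>

locale odd_vector_field_supermanifold = complex_supermanifold n m \<X> + odd_vector_field_sheaf \<X> v
  for n m and \<X> :: "('x, 's) superspace" and v
begin

definition charts_in :: "'x set \<Rightarrow> 'x set set" where
  "charts_in W = {U. U \<subseteq> W \<and> (\<exists>\<phi> \<Phi>. super_chart n m \<X> U \<phi> \<Phi>)}"

lemma subchart:
  assumes "super_chart n m \<X> U \<phi> \<Phi>" "openin (body \<X>) W" "W \<subseteq> U"
  shows "super_chart n m \<X> W \<phi> \<Phi>"
proof -
  interpret chart \<X> n m U \<phi> \<Phi> by unfold_locales (rule assms)
  show ?thesis using subchart assms by blast
qed

lemma Union_charts_in:
  assumes "openin (body \<X>) W" shows "\<Union> (charts_in W) = W"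
proof (intro equalityI subsetI)
  fix x assume x: "x \<in> W"
  then have "x \<in> topspace (body \<X>)" using openin_subset[OF assms] by auto
  then obtain U \<phi> \<Phi> where U: "x \<in> U" "super_chart n m \<X> U \<phi> \<Phi>" using charts by blast
  have "openin (body \<X>) (U \<inter> W)" using super_chart_open[OF U(2)] assms by (rule openin_Int)
  then have "super_chart n m \<X> (U \<inter> W) \<phi> \<Phi>" using subchart[OF U(2)] by simp
  then have "U \<inter> W \<in> charts_in W" by (auto simp: charts_in_def)
  then show "x \<in> \<Union> (charts_in W)" using x U(1) by blast
qed (auto simp: charts_in_def)

lemma charts_in_open: "U \<in> charts_in W \<Longrightarrow> openin (body \<X>) U \<and> U \<subseteq> W"
  using super_chart_open by (auto simp: charts_in_def)

lemma chart_exp: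
  assumes "U \<in> charts_in W" "f \<in> carrier (sect \<X> U)"
  shows "\<exists>!t. is_exp n m U f t"
proof -
  obtain \<phi> \<Phi> where c: "super_chart n m \<X> U \<phi> \<Phi>" using assms(1) by (auto simp: charts_in_def)
  interpret odd_vector_field_chart \<X> v n m U \<phi> \<Phi> by unfold_locales (rule c)
  show ?thesis using ex_is_exp[OF assms(2)] is_exp_chart_unique[OF c] by blast
qed

text \<open>Separatedness of the sheaf, taken from the uniqueness half of \<open>gluing\<close>
  applied to the restrictions of \<open>s\<close>.\<close>

lemma section_unique:
  assumes W: "openin (body \<X>) W" and s: "s \<in> carrier (sect \<X> W)" and t: "t \<in> carrier (sect \<X> W)"
    and eq: "\<And>U. U \<in> charts_in W \<Longrightarrow> restr \<X> W U s = restr \<X> W U t"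
  shows "s = t"
proof -
  have rr: "restr \<X> U (U \<inter> U') (restr \<X> W U s) = restr \<X> U' (U \<inter> U') (restr \<X> W U' s)"
    if U: "U \<in> charts_in W" "U' \<in> charts_in W" for U U'
  proof -
    note o = charts_in_open[OF U(1)] charts_in_open[OF U(2)]
    have oi: "openin (body \<X>) (U \<inter> U')" using o by blast
    have "restr \<X> U (U \<inter> U') (restr \<X> W U s) = restr \<X> W (U \<inter> U') s"
      using o by (intro restr_restr[OF W _ oi _ _ s]) auto
    moreover have "restr \<X> U' (U \<inter> U') (restr \<X> W U' s) = restr \<X> W (U \<inter> U') s"
      using o by (intro restr_restr[OF W _ oi _ _ s]) auto
    ultimately show ?thesis by simp
  qed
  have "\<exists>!f. f \<in> carrier (sect \<X> (\<Union> (charts_in W))) \<and>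
      (\<forall>U\<in>charts_in W. restr \<X> (\<Union> (charts_in W)) U f = restr \<X> W U s)"
  proof (rule gluing)
    fix U assume U: "U \<in> charts_in W"
    show "openin (body \<X>) U" using charts_in_open[OF U] by blast
    show "restr \<X> W U s \<in> carrier (sect \<X> U)" using charts_in_open[OF U] by (intro restr_simps(1)[OF W _ _ s]) auto
  qed (rule rr)
  then show ?thesis unfolding Union_charts_in[OF W] using s t eq by metis
qed

text \<open>Open subsets of chart domains are chart domains, and exponentials on these are unique.
  The local ones therefore agree on overlaps and glue; uniqueness over \<open>W\<close> is again
  local.\<close>

lemma ex1_is_exp:
  assumes W: "openin (body \<X>) W" and f: "f \<in> carrier (sect \<X> W)"
  shows "\<exists>!t. is_exp n m W f t"
proof (rule ex_ex1I)
  define e where "e U = (THE t. is_exp n m U (restr \<X> W U f) t)" for U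
  have fU: "restr \<X> W U f \<in> carrier (sect \<X> U)" if "U \<in> charts_in W" for U
    using charts_in_open[OF that] by (intro restr_simps(1)[OF W _ _ f]) auto
  have e: "is_exp n m U (restr \<X> W U f) (e U)" if "U \<in> charts_in W" for U
    unfolding e_def by (rule theI'[OF chart_exp[OF that fU[OF that]]])
  have loc: "restr \<X> U Y (e U) = e Y" if U: "U \<in> charts_in W" and Y: "openin (body \<X>) Y" "Y \<subseteq> U" for U Y
  proof -
    note o = charts_in_open[OF U]
    obtain \<phi> \<Phi> where "super_chart n m \<X> U \<phi> \<Phi>" using U by (auto simp: charts_in_def)
    then have YW: "Y \<in> charts_in W" using subchart Y o unfolding charts_in_def by blast
    have "is_exp n m Y (restr \<X> U Y (restr \<X> W U f)) (restr \<X> U Y (e U))"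
      using o Y by (intro is_exp_restr fU[OF U] e[OF U]) auto
    moreover have "restr \<X> U Y (restr \<X> W U f) = restr \<X> W Y f"
      using o Y by (intro restr_restr[OF W _ _ _ _ f]) auto
    ultimately show ?thesis using chart_exp[OF YW fU[OF YW]] e[OF YW] by auto
  qed
  have "\<exists>!t. t \<in> carrier (sect \<X> (\<Union> (charts_in W))) \<and> (\<forall>U\<in>charts_in W. restr \<X> (\<Union> (charts_in W)) U t = e U)"
  proof (rule gluing)
    fix U assume U: "U \<in> charts_in W"
    show "openin (body \<X>) U" using charts_in_open[OF U] by blast
    show "e U \<in> carrier (sect \<X> U)" by (rule is_exp_closed[OF e[OF U]])
    fix U' assume U': "U' \<in> charts_in W"
    have "openin (body \<X>) (U \<inter> U')" using charts_in_open[OF U] charts_in_open[OF U'] by blast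
    then show "restr \<X> U (U \<inter> U') (e U) = restr \<X> U' (U \<inter> U') (e U')"
      using loc[OF U] loc[OF U'] by simp
  qed
  then obtain t where t: "t \<in> carrier (sect \<X> W)" "\<And>U. U \<in> charts_in W \<Longrightarrow> restr \<X> W U t = e U"
    unfolding Union_charts_in[OF W] by blast
  have "is_exp n m W f t"
  proof (rule is_expI[OF t(1)])
    fix U \<phi> \<Phi> L z assume c: "super_chart n m \<X> U \<phi> \<Phi>" "U \<subseteq> W" and Lz: "L \<subseteq> {..<m}" "z \<in> \<phi> ` U"
    have oU: "openin (body \<X>) U" by (rule super_chart_open[OF c(1)])
    have U: "U \<in> charts_in W" using c by (auto simp: charts_in_def)
    have "restr \<X> U U ((v U ^^ j) (restr \<X> W U f)) = restr \<X> W U ((v W ^^ j) f)" for j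
      using restr_id[OF oU funpow_v_simps(1)[OF oU fU[OF U]]] funpow_v_restr[OF W oU c(2) f] by simp
    then show "(\<lambda>j. \<Phi> U (restr \<X> W U ((v W ^^ j) f)) L z / fact j) sums \<Phi> U (restr \<X> W U t) L z"
      using is_exp_sums[OF e[OF U] c(1) order_refl Lz] restr_id[OF oU is_exp_closed[OF e[OF U]]] t(2)[OF U] by simp
  qed
  then show "\<exists>t. is_exp n m W f t" ..
next
  fix s t assume s: "is_exp n m W f s" and t: "is_exp n m W f t"
  show "s = t"
  proof (rule section_unique[OF W is_exp_closed[OF s] is_exp_closed[OF t]])
    fix U assume U: "U \<in> charts_in W"
    note o = charts_in_open[OF U]
    have "restr \<X> W U f \<in> carrier (sect \<X> U)" using o by (intro restr_simps(1)[OF W _ _ f]) auto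
    moreover have "is_exp n m U (restr \<X> W U f) (restr \<X> W U s)" "is_exp n m U (restr \<X> W U f) (restr \<X> W U t)"
      using o by (intro is_exp_restr[OF W _ _ f] s t; simp)+
    ultimately show "restr \<X> W U s = restr \<X> W U t" using chart_exp[OF U] by blast
  qed
qed

definition exp_sheaf_op :: "('x, 's) sheaf_operator" where
  "exp_sheaf_op W f = (THE t. is_exp n m W f t)"

lemma exp_sheaf_op:
  "openin (body \<X>) W \<Longrightarrow> f \<in> carrier (sect \<X> W) \<Longrightarrow> is_exp n m W f (exp_sheaf_op W f)"
  unfolding exp_sheaf_op_def by (rule theI'[OF ex1_is_exp])

lemma exp_sheaf_op_eqI:
  "openin (body \<X>) W \<Longrightarrow> f \<in> carrier (sect \<X> W) \<Longrightarrow> is_exp n m W f t \<Longrightarrow> exp_sheaf_op W f = t"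
  using ex1_is_exp exp_sheaf_op by blast

text \<open>In each law the right-hand side also satisfies \<open>is_exp\<close> for the section on
  the left, and such a section is unique.\<close>

lemma exp_sheaf_endomorphism: "sheaf_endomorphism \<X> exp_sheaf_op"
  unfolding sheaf_endomorphism_def
proof (intro conjI allI impI ballI)
  fix W f assume W: "openin (body \<X>) W" and f: "f \<in> carrier (sect \<X> W)"
  note E = exp_sheaf_op[OF W f]
  show "exp_sheaf_op W f \<in> carrier (sect \<X> W)" by (rule is_exp_closed[OF E])
  show "exp_sheaf_op W (c \<odot>\<^bsub>sect \<X> W\<^esub> f) = c \<odot>\<^bsub>sect \<X> W\<^esub> exp_sheaf_op W f" for c
  proof (rule exp_sheaf_op_eqI[OF W sect_closed(4)[OF W f] is_expI])
    show "c \<odot>\<^bsub>sect \<X> W\<^esub> exp_sheaf_op W f \<in> carrier (sect \<X> W)"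
      by (rule sect_closed(4)[OF W is_exp_closed[OF E]])
    fix U \<phi> \<Phi> L z assume U: "super_chart n m \<X> U \<phi> \<Phi>" "U \<subseteq> W" and Lz: "L \<subseteq> {..<m}" "z \<in> \<phi> ` U"
    interpret C: chart \<X> n m U \<phi> \<Phi> by unfold_locales (rule U)
    have "\<Phi> U (restr \<X> W U (c \<odot>\<^bsub>sect \<X> W\<^esub> h)) L z = c * \<Phi> U (restr \<X> W U h) L z" if "h \<in> carrier (sect \<X> W)" for h
      by (simp add: restr_simps[OF W C.open_U U(2)] C.Phi_smult[OF C.open_U order_refl] that)
    then show "(\<lambda>j. \<Phi> U (restr \<X> W U ((v W ^^ j) (c \<odot>\<^bsub>sect \<X> W\<^esub> f))) L z / fact j)
        sums \<Phi> U (restr \<X> W U (c \<odot>\<^bsub>sect \<X> W\<^esub> exp_sheaf_op W f)) L z"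
      using sums_mult[OF is_exp_sums[OF E U Lz], of c] is_exp_closed[OF E]
      by (simp add: funpow_v_simps[OF W f])
  qed
  show "exp_sheaf_op W (f \<oplus>\<^bsub>sect \<X> W\<^esub> g) = exp_sheaf_op W f \<oplus>\<^bsub>sect \<X> W\<^esub> exp_sheaf_op W g"
    if g: "g \<in> carrier (sect \<X> W)" for g
  proof (rule exp_sheaf_op_eqI[OF W sect_closed(1)[OF W f g] is_expI])
    note G = exp_sheaf_op[OF W g]
    show "exp_sheaf_op W f \<oplus>\<^bsub>sect \<X> W\<^esub> exp_sheaf_op W g \<in> carrier (sect \<X> W)"
      by (rule sect_closed(1)[OF W is_exp_closed[OF E] is_exp_closed[OF G]])
    fix U \<phi> \<Phi> L z assume U: "super_chart n m \<X> U \<phi> \<Phi>" "U \<subseteq> W" and Lz: "L \<subseteq> {..<m}" "z \<in> \<phi> ` U"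
    interpret C: chart \<X> n m U \<phi> \<Phi> by unfold_locales (rule U)
    have "\<Phi> U (restr \<X> W U (h \<oplus>\<^bsub>sect \<X> W\<^esub> k)) L z = \<Phi> U (restr \<X> W U h) L z + \<Phi> U (restr \<X> W U k) L z"
      if "h \<in> carrier (sect \<X> W)" "k \<in> carrier (sect \<X> W)" for h k
      by (simp add: restr_simps[OF W C.open_U U(2)] C.Phi_add[OF C.open_U order_refl] that)
    then show "(\<lambda>j. \<Phi> U (restr \<X> W U ((v W ^^ j) (f \<oplus>\<^bsub>sect \<X> W\<^esub> g))) L z / fact j)
        sums \<Phi> U (restr \<X> W U (exp_sheaf_op W f \<oplus>\<^bsub>sect \<X> W\<^esub> exp_sheaf_op W g)) L z"
      using sums_add[OF is_exp_sums[OF E U Lz] is_exp_sums[OF G U Lz]] is_exp_closed[OF E] is_exp_closed[OF G]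
      by (simp add: funpow_v_simps[OF W f] funpow_v_simps[OF W g] g add_divide_distrib)
  qed
next
  fix W W' f assume *: "openin (body \<X>) W \<and> openin (body \<X>) W' \<and> W' \<subseteq> W" and f: "f \<in> carrier (sect \<X> W)"
  then have W: "openin (body \<X>) W" "openin (body \<X>) W'" "W' \<subseteq> W" by blast+
  show "exp_sheaf_op W' (restr \<X> W W' f) = restr \<X> W W' (exp_sheaf_op W f)"
    by (rule exp_sheaf_op_eqI[OF W(2) restr_simps(1)[OF W f] is_exp_restr[OF W f exp_sheaf_op[OF W(1) f]]])
qed

section \<open>Symbol and convergence of the global exponential\<close>

lemma Phi_exp_sheaf_op:
  assumes c: "super_chart n m \<X> U \<phi> \<Phi>" and W: "openin (body \<X>) W" "W \<subseteq> U" and f: "f \<in> carrier (sect \<X> W)"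
    and L: "L \<subseteq> {..<m}" and z: "z \<in> \<phi> ` W"
  shows "\<Phi> W (exp_sheaf_op W f) L z =
    odd_superdomain_derivation.exp_op (odd_vector_field_chart.Dop \<X> v U \<phi> \<Phi>) (\<phi> ` W) (\<Phi> W f) L z"
proof -
  interpret C: odd_vector_field_chart \<X> v n m U \<phi> \<Phi> by unfold_locales (rule c)
  note E = exp_sheaf_op[OF W(1) f]
  have "(\<lambda>j. \<Phi> W ((v W ^^ j) f) L z / fact j) sums \<Phi> W (exp_sheaf_op W f) L z"
    using is_exp_sums[OF E subchart[OF c W] order_refl L z]
    by (simp add: restr_id[OF W(1)] is_exp_closed[OF E] funpow_v_simps[OF W(1) f])
  then show ?thesis
    by (simp add: C.D.exp_op_def C.funpow_Dop_Phi[OF W f] sums_iff)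
qed

text \<open>The symbol is computed once on the whole chart image, so the same coefficients
  \<open>a\<close> serve all open \<open>W\<close> inside \<open>U\<close>.\<close>

lemma exp_infinite_order_operator: "infinite_order_operator n m \<X> exp_sheaf_op"
  unfolding infinite_order_operator_def
proof (intro conjI exp_sheaf_endomorphism allI impI)
  fix U \<phi> \<Phi> assume c: "super_chart n m \<X> U \<phi> \<Phi>"
  interpret C: odd_vector_field_chart \<X> v n m U \<phi> \<Phi> by unfold_locales (rule c)
  from bounded_superdomain_operator.symbol_exists[OF C.D.exp_op_bounded]
  obtain a where a: "\<forall>I J. I \<subseteq> {..<m} \<and> J \<subseteq> {..<m} \<longrightarrow>
        (\<forall>K\<in>multi_indices n. several_holomorphic_on n (\<phi> ` U) (a I J K)) \<and> overconvergent n (\<phi> ` U) (a I J)"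
     "\<forall>W F L z. open_in_Cspace n W \<and> W \<subseteq> \<phi> ` U \<and> F \<in> superfuns n m W \<and> L \<subseteq> {..<m} \<and> z \<in> W \<longrightarrow>
        ((\<lambda>(I, J, K). diff_op_term n (a I J K) I J K F L z) has_sum C.D.exp_op W F L z)
          (Pow {..<m} \<times> Pow {..<m} \<times> multi_indices n)"
    by (elim exE conjE)
  have "((\<lambda>(I, J, K). diff_op_term n (a I J K) I J K (\<Phi> W f) L z) has_sum \<Phi> W (exp_sheaf_op W f) L z)
      (Pow {..<m} \<times> Pow {..<m} \<times> multi_indices n)"
    if W: "openin (body \<X>) W \<and> W \<subseteq> U" and f: "f \<in> carrier (sect \<X> W)" and L: "L \<subseteq> {..<m}" and z: "z \<in> \<phi> ` W" for W f L z
  proof -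
    have W': "openin (body \<X>) W" "W \<subseteq> U" using W by auto
    have "open_in_Cspace n (\<phi> ` W) \<and> \<phi> ` W \<subseteq> \<phi> ` U \<and> \<Phi> W f \<in> superfuns n m (\<phi> ` W) \<and> L \<subseteq> {..<m} \<and> z \<in> \<phi> ` W"
      using C.open_image[OF W'] C.Phi_closed[OF W' f] W'(2) L z by auto
    then show ?thesis
      unfolding Phi_exp_sheaf_op[OF c W' f L z] by (rule a(2)[rule_format])
  qed
  then show "\<exists>a. (\<forall>I J. I \<subseteq> {..<m} \<and> J \<subseteq> {..<m} \<longrightarrow>
        (\<forall>K\<in>multi_indices n. several_holomorphic_on n (\<phi> ` U) (a I J K)) \<and> overconvergent n (\<phi> ` U) (a I J)) \<and>
      (\<forall>W. openin (body \<X>) W \<and> W \<subseteq> U \<longrightarrow> (\<forall>f\<in>carrier (sect \<X> W). \<forall>L\<subseteq>{..<m}. \<forall>z\<in>\<phi> ` W.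
        ((\<lambda>(I, J, K). diff_op_term n (a I J K) I J K (\<Phi> W f) L z) has_sum \<Phi> W (exp_sheaf_op W f) L z)
          (Pow {..<m} \<times> Pow {..<m} \<times> multi_indices n)))"
    by (intro exI[of _ a] conjI a(1) allI impI ballI)
qed

text \<open>A chart that is not contained in \<open>W\<close> is first cut down to
  \<open>U \<inter> W\<close>. There convergence is uniform near each point, and a finite cover
  extends it to compact sets.\<close>

lemma exp_operator_sums: "operator_sums n m \<X> (exp_term \<X> v) exp_sheaf_op"
  unfolding operator_sums_def section_sums_def
proof (intro allI impI ballI, elim conjE)
  fix W f U \<phi> \<Phi> L C
  assume W: "openin (body \<X>) W" and f: "f \<in> carrier (sect \<X> W)" and c: "super_chart n m \<X> U \<phi> \<Phi>"
    and L: "L \<subseteq> {..<m}" and C: "compact C" "C \<subseteq> \<phi> ` (U \<inter> W)"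
  interpret C: odd_vector_field_chart \<X> v n m U \<phi> \<Phi> by unfold_locales (rule c)
  let ?Y = "U \<inter> W"
  have Y: "openin (body \<X>) ?Y" "?Y \<subseteq> U" "?Y \<subseteq> W" using C.open_U W by auto
  let ?f = "restr \<X> W ?Y f"
  have fY: "?f \<in> carrier (sect \<X> ?Y)" by (rule restr_simps(1)[OF W Y(1,3) f])
  let ?F = "\<Phi> ?Y ?f"
  have F: "?F \<in> superfuns n m (\<phi> ` ?Y)" by (rule C.Phi_closed[OF Y(1,2) fY])
  have im: "open_in_Cspace n (\<phi> ` ?Y)" "\<phi> ` ?Y \<subseteq> \<phi> ` U" using C.open_image[OF Y(1,2)] by auto
  have vj: "(v W ^^ j) f \<in> carrier (sect \<X> W)" for j by (rule funpow_v_simps(1)[OF W f])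
  have trm: "\<Phi> ?Y (restr \<X> W ?Y (exp_term \<X> v j W f)) L z = (C.Dop (\<phi> ` ?Y) ^^ j) ?F L z / fact j" for j z
  proof -
    have "restr \<X> W ?Y (exp_term \<X> v j W f) = (1 / fact j) \<odot>\<^bsub>sect \<X> ?Y\<^esub> (v ?Y ^^ j) ?f"
      unfolding exp_term_def restr_simps(3)[OF W Y(1,3) vj] funpow_v_restr[OF W Y(1,3) f] ..
    then show ?thesis
      by (simp add: C.Phi_smult[OF Y(1,2)] funpow_v_simps[OF Y(1) fY] C.funpow_Dop_Phi[OF Y(1,2) fY])
  qed
  have "restr \<X> W ?Y (exp_sheaf_op W f) = exp_sheaf_op ?Y ?f"
    using exp_sheaf_op_eqI[OF Y(1) fY is_exp_restr[OF W Y(1,3) f exp_sheaf_op[OF W f]]] by simp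
  then have lim: "\<Phi> ?Y (restr \<X> W ?Y (exp_sheaf_op W f)) L z = C.D.exp_op (\<phi> ` ?Y) ?F L z" if "z \<in> \<phi> ` ?Y" for z
    using Phi_exp_sheaf_op[OF c Y(1,2) fY L that] by simp
  have "uniform_limit C (\<lambda>N z. \<Sum>j<N. (C.Dop (\<phi> ` ?Y) ^^ j) ?F L z / fact j) (C.D.exp_op (\<phi> ` ?Y) ?F L) sequentially"
  proof (rule uniform_limit_compact_Cspace[OF C(1)])
    show "C \<subseteq> Cspace n" using C(2) openin_imp_subset[OF im(1)] by blast
    fix p assume "p \<in> C"
    then have "p \<in> \<phi> ` ?Y" using C(2) by blast
    from C.D.exp_partial_sums[OF im F this] L
    show "\<exists>r>0. uniform_limit (polydisc n p r) (\<lambda>N z. \<Sum>j<N. (C.Dop (\<phi> ` ?Y) ^^ j) ?F L z / fact j)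
        (C.D.exp_op (\<phi> ` ?Y) ?F L) sequentially" by blast
  qed
  moreover have "uniform_limit C (\<lambda>N z. \<Sum>j<N. (C.Dop (\<phi> ` ?Y) ^^ j) ?F L z / fact j) (C.D.exp_op (\<phi> ` ?Y) ?F L) sequentially \<longleftrightarrow>
      uniform_limit C (\<lambda>N z. \<Sum>j<N. \<Phi> ?Y (restr \<X> W ?Y (exp_term \<X> v j W f)) L z)
        (\<Phi> ?Y (restr \<X> W ?Y (exp_sheaf_op W f)) L) sequentially"
    using C(2) by (intro uniform_limit_cong always_eventually allI ballI) (auto simp: trm lim)
  ultimately show "uniform_limit C (\<lambda>N z. \<Sum>j<N. \<Phi> ?Y (restr \<X> W ?Y (exp_term \<X> v j W f)) L z)
      (\<Phi> ?Y (restr \<X> W ?Y (exp_sheaf_op W f)) L) sequentially" by blast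
qed

end

theorem proposition1p5p1:
  fixes \<X> :: "('x, 's) superspace" and v :: "('x, 's) sheaf_operator" and n m :: nat
  assumes "complex_supermanifold n m \<X>"
    and "odd_vector_field \<X> v"
  shows "\<exists>P. infinite_order_operator n m \<X> P \<and> operator_sums n m \<X> (exp_term \<X> v) P"
proof -
  interpret complex_supermanifold n m \<X> by (rule assms(1))
  interpret odd_vector_field_supermanifold n m \<X> v by unfold_locales (rule assms(2))
  show ?thesis using exp_infinite_order_operator exp_operator_sums by blast
qed

end
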